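(* Let $\mu$ be Haar measure (normalized arc length) on the unit circle $\mathbb{T}$, and let $\alpha$ be a $\|\cdot\|_{1}$-dominating normalized gauge norm on $L^{\infty}(\mathbb{T},\mu)$. Let $W$ be a $\sigma(L^{\alpha}(\mathbb{T},\mu),L^{\alpha'}(\mathbb{T},\mu))$-closed linear subspace of $L^{\alpha}(\mathbb{T},\mu)$. Then $zW\subseteq W$ if and only if either $W=\varphi H^{\alpha}(\mathbb{T},\mu)$ for some unimodular measurable function $\varphi$ on $\mathbb{T}$, or $W=\chi_{E}L^{\alpha}(\mathbb{T},\mu)$ for some Borel subset $E$ of $\mathbb{T}$. Moreover, if $zW\subseteq W$ and $0\neq W\subset H^{\alpha}(\mathbb{T},\mu)$, then $W=\varphi H^{\alpha}(\mathbb{T},\mu)$ for some inner function $\varphi$.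
   Context: $\mathbb{T}$ is the unit circle and $\mu$ is normalized arc length; $z$ denotes the identity function on $\mathbb{T}$. A norm $\alpha$ on $L^{\infty}(\mathbb{T},\mu)$ is a normalized gauge norm if $\alpha(1)=1$ and $\alpha(|f|)=\alpha(f)$ for all $f$; it is $\|\cdot\|_1$-dominating if there is $c>0$ with $\alpha(f)\ge c\|f\|_{1}$ for all $f\in L^{\infty}(\mathbb{T},\mu)$. Such $\alpha$ is extended to all measurable $f$ by $\alpha(f)=\sup\{\alpha(s): s \text{ simple},\ 0\le s\le |f|\}\in[0,\infty]$. Put $\mathcal{L}^{\alpha}(\mathbb{T},\mu)=\{f \text{ measurable}:\alpha(f)<\infty\}\subset L^1(\mathbb{T},\mu)$, and let $L^{\alpha}(\mathbb{T},\mu)$ be the $\alpha$-closure of $L^{\infty}(\mathbb{T},\mu)$ in $\mathcal{L}^{\alpha}(\mathbb{T},\mu)$. The dual norm is $\alpha'(f)=\sup\{|\int_{\mathbb{T}} fh\,d\mu| : h\in L^{\infty}(\mathbb{T},\mu),\ \alpha(h)\le 1\}$ for $f\in L^{\infty}(\mathbb{T},\mu)$, extended to measurable functions in the same way; $\mathcal{L}^{\alpha'}(\mathbb{T},\mu)=\{f \text{ measurable}:\alpha'(f)<\infty\}$, and $L^{\alpha'}(\mathbb{T},\mu)$ is the $\alpha'$-closure of $L^{\infty}(\mathbb{T},\mu)$ in $\mathcal{L}^{\alpha'}(\mathbb{T},\mu)$. For $Y=L^{\alpha'}$ or $\mathcal{L}^{\alpha'}$, $\sigma(L^{\alpha},Y)$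 is the weakest topology on $L^{\alpha}(\mathbb{T},\mu)$ making all functionals $f\mapsto\int_{\mathbb{T}} fg\,d\mu$, $g\in Y$, continuous. $H^{\infty}(\mathbb{T},\mu)$ is the classical Hardy space (functions in $L^\infty$ with vanishing negative Fourier coefficients), and $H^{\alpha}(\mathbb{T},\mu)$ is the closure of $H^{\infty}(\mathbb{T},\mu)$ in $L^{\alpha}(\mathbb{T},\mu)$ in the topology $\sigma(L^{\alpha},\mathcal{L}^{\alpha'})$. Unimodular means $|\varphi|=1$ a.e.; an inner function is a unimodular function in $H^{\infty}(\mathbb{T},\mu)$. *)

theory Defs
  imports "HOL-Analysis.Analysis"
begin

text \<open>
  Functions on the unit circle are represented by Borel functions \<open>complex \<Rightarrow> complex\<close>, of which
  only the values on the circle matter, and not by almost-everywhere classes. Accordingly, every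
  space of functions below is a set of functions closed under changes on null sets, and equations
  between functions are stated almost everywhere.
\<close>

definition arc_length :: "complex measure" where
  "arc_length = distr (uniform_measure lborel {0..<2*pi}) (restrict_space borel (sphere 0 1)) cis"

definition L_infinity :: "(complex \<Rightarrow> complex) set" where
  "L_infinity = {f \<in> borel_measurable arc_length. \<exists>C. AE z in arc_length. cmod (f z) \<le> C}"

text \<open>Only the values of a norm on \<open>L_infinity\<close> are constrained. That these depend only on the
  almost-everywhere class follows from definiteness and the triangle inequality.\<close>

definition norm_on_L_infinity :: "((complex \<Rightarrow> complex) \<Rightarrow> real) \<Rightarrow> bool" where
  "norm_on_L_infinity \<alpha> \<longleftrightarrow>
     (\<forall>f\<in>L_infinity. 0 \<le> \<alpha> f) \<and>
     (\<forall>f\<in>L_infinity. \<alpha> f = 0 \<longleftrightarrow> (AE z in arc_length. f z = 0)) \<and>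
     (\<forall>f\<in>L_infinity. \<forall>c. \<alpha> (\<lambda>z. c * f z) = cmod c * \<alpha> f) \<and>
     (\<forall>f\<in>L_infinity. \<forall>g\<in>L_infinity. \<alpha> (\<lambda>z. f z + g z) \<le> \<alpha> f + \<alpha> g)"

definition normalized_gauge_norm :: "((complex \<Rightarrow> complex) \<Rightarrow> real) \<Rightarrow> bool" where
  "normalized_gauge_norm \<alpha> \<longleftrightarrow>
     norm_on_L_infinity \<alpha> \<and> \<alpha> (\<lambda>z. 1) = 1 \<and>
     (\<forall>f\<in>L_infinity. \<alpha> (\<lambda>z. of_real (cmod (f z))) = \<alpha> f)"

definition L1_dominating :: "((complex \<Rightarrow> complex) \<Rightarrow> real) \<Rightarrow> bool" where
  "L1_dominating \<alpha> \<longleftrightarrow>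
     (\<exists>c>0. \<forall>f\<in>L_infinity. \<alpha> f \<ge> c * (LINT z|arc_length. cmod (f z)))"

definition dual_norm :: "((complex \<Rightarrow> complex) \<Rightarrow> real) \<Rightarrow> (complex \<Rightarrow> complex) \<Rightarrow> ennreal" where
  "dual_norm \<alpha> f =
     (SUP h\<in>{h \<in> L_infinity. \<alpha> h \<le> 1}. ennreal (cmod (LINT z|arc_length. f z * h z)))"

text \<open>The next three definitions are applied both to \<open>\<alpha>\<close> and to its dual norm, so they take an
  \<open>ennreal\<close>-valued function \<open>N\<close> of which only the values on \<open>L_infinity\<close> are used.\<close>

definition norm_extension ::
  "((complex \<Rightarrow> complex) \<Rightarrow> ennreal) \<Rightarrow> (complex \<Rightarrow> complex) \<Rightarrow> ennreal" where
  "norm_extension N f =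
     (SUP s\<in>{s :: complex \<Rightarrow> real. simple_function arc_length s \<and>
                (AE z in arc_length. 0 \<le> s z \<and> s z \<le> cmod (f z))}. N (\<lambda>z. of_real (s z)))"

definition finite_norm_space ::
  "((complex \<Rightarrow> complex) \<Rightarrow> ennreal) \<Rightarrow> (complex \<Rightarrow> complex) set" where
  "finite_norm_space N = {f \<in> borel_measurable arc_length. norm_extension N f < \<infinity>}"

definition closure_of_L_infinity ::
  "((complex \<Rightarrow> complex) \<Rightarrow> ennreal) \<Rightarrow> (complex \<Rightarrow> complex) set" where
  "closure_of_L_infinity N =
     {f \<in> finite_norm_space N. \<forall>\<epsilon>>0. \<exists>g\<in>L_infinity. norm_extension N (\<lambda>z. f z - g z) < \<epsilon>}"

definition L_space :: "((complex \<Rightarrow> complex) \<Rightarrow> real) \<Rightarrow> (complex \<Rightarrow> complex) set" where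
  "L_space \<alpha> = closure_of_L_infinity (\<lambda>f. ennreal (\<alpha> f))"

definition dual_L_space :: "((complex \<Rightarrow> complex) \<Rightarrow> real) \<Rightarrow> (complex \<Rightarrow> complex) set" where
  "dual_L_space \<alpha> = closure_of_L_infinity (dual_norm \<alpha>)"

definition dual_finite_norm_space ::
  "((complex \<Rightarrow> complex) \<Rightarrow> real) \<Rightarrow> (complex \<Rightarrow> complex) set" where
  "dual_finite_norm_space \<alpha> = finite_norm_space (dual_norm \<alpha>)"

text \<open>The topology \<open>\<sigma>(X, Y)\<close>. Inserting \<open>X\<close> among the generators only serves to make \<open>X\<close> the
  underlying set by construction. On functions (as opposed to classes) the topology does not
  separate almost-everywhere equal functions, so its closed sets respect almost-everywhere
  equality.\<close>

definition weak_topology ::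
  "(complex \<Rightarrow> complex) set \<Rightarrow> (complex \<Rightarrow> complex) set \<Rightarrow> (complex \<Rightarrow> complex) topology" where
  "weak_topology X Y = topology_generated_by
     (insert X {{f \<in> X. (LINT z|arc_length. f z * g z) \<in> U} |g U. g \<in> Y \<and> open U})"

definition fourier_coeff :: "(complex \<Rightarrow> complex) \<Rightarrow> int \<Rightarrow> complex" where
  "fourier_coeff f k = (LINT z|arc_length. f z * z powi (- k))"

definition H_infinity :: "(complex \<Rightarrow> complex) set" where
  "H_infinity = {f \<in> L_infinity. \<forall>k<0. fourier_coeff f k = 0}"

definition H_space :: "((complex \<Rightarrow> complex) \<Rightarrow> real) \<Rightarrow> (complex \<Rightarrow> complex) set" where
  "H_space \<alpha> = weak_topology (L_space \<alpha>) (dual_finite_norm_space \<alpha>) closure_of H_infinity"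

definition unimodular :: "(complex \<Rightarrow> complex) \<Rightarrow> bool" where
  "unimodular \<phi> \<longleftrightarrow> \<phi> \<in> borel_measurable arc_length \<and> (AE z in arc_length. cmod (\<phi> z) = 1)"

definition inner_function :: "(complex \<Rightarrow> complex) \<Rightarrow> bool" where
  "inner_function \<phi> \<longleftrightarrow> unimodular \<phi> \<and> \<phi> \<in> H_infinity"

definition mult_set ::
  "(complex \<Rightarrow> complex) \<Rightarrow> (complex \<Rightarrow> complex) set \<Rightarrow> (complex \<Rightarrow> complex) set" where
  "mult_set \<phi> S =
     {f \<in> borel_measurable arc_length. \<exists>g\<in>S. AE z in arc_length. f z = \<phi> z * g z}"

definition linear_subspace :: "(complex \<Rightarrow> complex) set \<Rightarrow> bool" where
  "linear_subspace W \<longleftrightarrow>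
     (\<lambda>z. 0) \<in> W \<and>
     (\<forall>f\<in>W. \<forall>g\<in>W. (\<lambda>z. f z + g z) \<in> W) \<and>
     (\<forall>c. \<forall>f\<in>W. (\<lambda>z. c * f z) \<in> W)"

end

(*
  A weakly closed shift-invariant W is compared with the L^2 closure M of its bounded elements.
  Beurling's argument applies to M. If z M is not all of M, a unit vector phi in M orthogonal to z M
  is unimodular, because all Fourier coefficients of |phi|^2 but the zeroth vanish. Otherwise M
  reduces multiplication by z, and the projection of 1 to M is an indicator function.
  Both passages between W and M rest on outer functions exp k, where Re k <= 0 is a prescribed real
  L^2 function. Multiplication by exp k preserves W, since exp k is a limit of exponentials of
  polynomials with nonpositive real part; and exp k is close to 1 when Re k is small, since
  conjugation is an L^2 contraction. Choosing |exp k| as a truncation shows that every bounded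
  element of M is in W, and that every f in W is the limit of bounded elements h n f of W with
  |h n| <= 1. Of the two weak topologies one only needs that these dominated limits converge in them.
*)
theory Submission
  imports Defs
begin

section \<open>Arc length\<close>

text \<open>A gauge norm need not be continuous, and \<open>W\<close> is closed only in a weak
  topology. What remains available is that products of the paired spaces are integrable, so
  dominated limits are weak limits. This dictates the shape of the multipliers \<open>exp k\<close>.
  Their modulus is at most 1, so that multiples of \<open>f\<close> stay dominated by
  \<open>f\<close>; hence the sign condition on \<open>Re k\<close>, which has to survive the
  polynomial approximation. Their exponents must be small in a norm for which conjugation is
  bounded. This fails in L^1 and in L^infinity but holds in L^2, and the logarithm grows so slowly
  that truncating a merely integrable function still has a square integrable exponent. Polynomial
  exponents suffice because \<open>exp p\<close> is a power series in \<open>p\<close>: shift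
  invariance and weak closedness alone make \<open>W\<close> invariant under it. The detour through
  L^2 supplies orthogonal projections. The zero subspace is covered by the case of a null set
  \<open>E\<close>.\<close>

lemma space_arc_length [simp]: "space arc_length = sphere 0 1"
  by (simp add: arc_length_def space_restrict_space)

lemma sets_arc_length: "sets arc_length = sets (restrict_space borel (sphere 0 1))"
  by (simp add: arc_length_def)

lemma cis_measurable:
  "cis \<in> uniform_measure lborel {0..<2*pi} \<rightarrow>\<^sub>M restrict_space borel (sphere 0 1)"
proof -
  have "cis \<in> borel_measurable borel"
    by (intro borel_measurable_continuous_onI continuous_intros)
  then have "cis \<in> lborel \<rightarrow>\<^sub>M restrict_space borel (sphere 0 1)"
    by (intro measurable_restrict_space2) auto
  then show ?thesis
    by (simp cong: measurable_cong_sets)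
qed

lemma emeasure_arc_length: "emeasure arc_length (space arc_length) = 1"
proof -
  have "emeasure arc_length (space arc_length)
      = emeasure (uniform_measure lborel {0..<2*pi}) (cis -` sphere 0 1 \<inter> UNIV)"
    unfolding space_arc_length arc_length_def
    by (subst emeasure_distr[OF cis_measurable])
       (auto simp: sets_restrict_space)
  also have "cis -` sphere 0 1 \<inter> UNIV = (UNIV :: real set)"
    by auto
  also have "emeasure (uniform_measure lborel {0..<2*pi}) UNIV = 1"
    by (subst emeasure_uniform_measure) (auto simp: divide_ennreal)
  finally show ?thesis .
qed

interpretation arc: finite_measure arc_length
  by standard (simp only: emeasure_arc_length, simp)

lemma measure_arc_length [simp]: "measure arc_length (sphere 0 1) = 1"
  using emeasure_arc_length by (simp add: measure_def)

lemma AE_arc_length_norm: "AE z in arc_length. cmod z = 1"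
  by (rule AE_I2) simp

lemma borel_measurable_arc_length:
  "f \<in> borel_measurable borel \<Longrightarrow> f \<in> borel_measurable arc_length"
  by (simp add: arc_length_def measurable_restrict_space1)

lemma ident_arc_length [measurable]: "(\<lambda>z. z) \<in> borel_measurable arc_length"
  by (rule borel_measurable_arc_length) simp

lemma borel_measurable_continuous_arc_length:
  fixes f :: "complex \<Rightarrow> 'a :: topological_space"
  shows "continuous_on (sphere 0 1) f \<Longrightarrow> f \<in> borel_measurable arc_length"
  using borel_measurable_continuous_on_restrict[of "sphere 0 1" f] by (simp add: arc_length_def)

text \<open>The antiderivative \<open>cis (n * t) / (\<i> * n)\<close> takes equal values at both
  ends of the period. This is the one place where an integral is computed from the parametrisation
  of the circle.\<close>

lemma integral_power_arc_length:
  assumes "n > 0" shows "(LINT z|arc_length. z ^ n) = 0"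
proof -
  have "(LINT z|arc_length. z ^ n) = (LINT t|uniform_measure lborel {0..<2*pi}. cis t ^ n)"
    unfolding arc_length_def
    by (rule integral_distr[OF cis_measurable])
       (auto simp: measurable_restrict_space1)
  also have "\<dots> = (LINT t|lborel. (1 / (2*pi)) *\<^sub>R (indicator {0..2*pi} t *\<^sub>R cis (n * t)))"
  proof -
    have [measurable]: "(\<lambda>t. cis (real n * t)) \<in> borel_measurable borel"
      by (intro borel_measurable_continuous_onI continuous_intros)
    have "uniform_measure lborel {0..<2*pi}
        = density lborel (\<lambda>t. ennreal (1 / (2*pi) * indicator {0..<2*pi} t))"
      unfolding uniform_measure_def
      by (intro arg_cong2[where f=density] refl ext)
         (auto simp: indicator_def divide_ennreal[symmetric])
    then have "(LINT t|uniform_measure lborel {0..<2*pi}. cis t ^ n)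
        = (LINT t|lborel. (1 / (2*pi) * indicator {0..<2*pi} t) *\<^sub>R cis (n * t))"
      by (simp only: Complex.DeMoivre) (rule integral_density, auto)
    \<comment> \<open>\<open>integral_FTC_Icc\<close> works on a closed interval; the added endpoint
      \<open>2*pi\<close> is a null set.\<close>
    also have "\<dots> = (LINT t|lborel. (1 / (2*pi)) *\<^sub>R (indicator {0..2*pi} t *\<^sub>R cis (n * t)))"
      using AE_lborel_singleton[of "2*pi"]
      by (intro integral_cong_AE) (auto simp: indicator_def elim!: eventually_mono)
    finally show ?thesis .
  qed
  also have "\<dots> = (1 / (2*pi)) *\<^sub>R (LINT t|lborel. indicator {0..2*pi} t *\<^sub>R cis (n * t))"
    by (rule integral_scaleR_right)
  also have "(LINT t|lborel. indicator {0..2*pi} t *\<^sub>R cis (n * t))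
     = cis (n * (2 * pi)) / (\<i> * n) - cis (real n * 0) / (\<i> * n)"
  proof (rule integral_FTC_Icc[where F="\<lambda>t. cis (n * t) / (\<i> * n)"])
    fix x :: real
    have "((\<lambda>t. cis (real n * t) / (\<i> * n)) has_derivative
        (\<lambda>t. (real n * t) *\<^sub>R (\<i> * cis (real n * x)) / (\<i> * n))) (at x within {0..2*pi})"
      using assms by (auto intro!: derivative_eq_intros simp: fun_eq_iff field_simps scaleR_conv_of_real)
    also have "(\<lambda>t. (real n * t) *\<^sub>R (\<i> * cis (real n * x)) / (\<i> * n)) = (\<lambda>t. t *\<^sub>R cis (n * x))"
      using assms by (auto simp: fun_eq_iff scaleR_conv_of_real) (simp add: complex_eq_iff)
    finally show "((\<lambda>t. cis (n * t) / (\<i> * n)) has_vector_derivative cis (n * x)) (at x within {0..2*pi})"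
      by (simp add: has_vector_derivative_def)
  qed (auto intro!: continuous_intros)
  also have "cis (n * (2 * pi)) = 1"
    using cis_multiple_2pi[of "real n"] by (simp add: mult_ac)
  finally show ?thesis by simp
qed

section \<open>Square integrable functions\<close>

text \<open>The square of the L^2 norm. Keeping the square avoids roots; the price is a factor 2 at
  each use of the triangle inequality (\<open>sqn_triangle\<close>), which is where the quarters of
  \<open>e\<close> below come from.\<close>

definition sqn :: "'a measure \<Rightarrow> ('a \<Rightarrow> complex) \<Rightarrow> real" where
  "sqn M f = (LINT x|M. (cmod (f x))\<^sup>2)"

definition L2 :: "'a measure \<Rightarrow> ('a \<Rightarrow> complex) set" where
  "L2 M = {f \<in> borel_measurable M. integrable M (\<lambda>x. (cmod (f x))\<^sup>2)}"

lemma L2_measurable: "f \<in> L2 M \<Longrightarrow> f \<in> borel_measurable M"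
  and L2_integrable: "f \<in> L2 M \<Longrightarrow> integrable M (\<lambda>x. (cmod (f x))\<^sup>2)"
  by (auto simp: L2_def)

lemma sqn_nonneg [simp]: "0 \<le> sqn M f"
  by (simp add: sqn_def)

lemma sqn_minus_commute: "sqn M (\<lambda>x. f x - g x) = sqn M (\<lambda>x. g x - f x)"
  by (simp add: sqn_def norm_minus_commute)

lemma sqn_mono:
  assumes "g \<in> L2 M" "f \<in> borel_measurable M" "AE x in M. cmod (f x) \<le> cmod (g x)"
  shows "f \<in> L2 M" "sqn M f \<le> sqn M g"
proof -
  have *: "AE x in M. (cmod (f x))\<^sup>2 \<le> (cmod (g x))\<^sup>2"
    using assms(3) by eventually_elim (simp add: power_mono)
  show "f \<in> L2 M"
    unfolding L2_def using assms * 
    by (auto intro!: Bochner_Integration.integrable_bound[OF L2_integrable[OF assms(1)]])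
  then show "sqn M f \<le> sqn M g"
    unfolding sqn_def using * by (intro integral_mono_AE L2_integrable assms)
qed

lemma L2_cmult: "f \<in> L2 M \<Longrightarrow> (\<lambda>x. c * f x) \<in> L2 M"
  by (auto simp: L2_def norm_mult power_mult_distrib)

lemma sqn_cmult: "sqn M (\<lambda>x. c * f x) = (cmod c)\<^sup>2 * sqn M f"
  by (simp add: sqn_def norm_mult power_mult_distrib)

lemma cmod_add_sq_le: "(cmod (a + b))\<^sup>2 \<le> 2 * (cmod a)\<^sup>2 + 2 * (cmod b)\<^sup>2"
proof -
  have "(cmod (a + b))\<^sup>2 \<le> (cmod a + cmod b)\<^sup>2"
    by (simp add: power_mono norm_triangle_ineq)
  also have "\<dots> \<le> 2 * (cmod a)\<^sup>2 + 2 * (cmod b)\<^sup>2"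
    using sum_squares_bound[of "cmod a" "cmod b"] by (simp add: power2_sum)
  finally show ?thesis .
qed

lemma L2_add:
  assumes "f \<in> L2 M" "g \<in> L2 M" shows "(\<lambda>x. f x + g x) \<in> L2 M"
proof -
  have "integrable M (\<lambda>x. 2 * (cmod (f x))\<^sup>2 + 2 * (cmod (g x))\<^sup>2)"
    using assms by (auto simp: L2_def)
  then have "integrable M (\<lambda>x. (cmod (f x + g x))\<^sup>2)"
  proof (rule Bochner_Integration.integrable_bound)
    show "AE x in M. norm ((cmod (f x + g x))\<^sup>2) \<le> norm (2 * (cmod (f x))\<^sup>2 + 2 * (cmod (g x))\<^sup>2)"
      using cmod_add_sq_le by (intro AE_I2) (simp add: abs_of_nonneg)
  qed (use assms in \<open>auto simp: L2_def\<close>)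
  then show ?thesis
    using assms by (auto simp: L2_def)
qed

lemma L2_diff:
  assumes "f \<in> L2 M" "g \<in> L2 M" shows "(\<lambda>x. f x - g x) \<in> L2 M"
  using L2_add[OF assms(1) L2_cmult[OF assms(2), of "-1"]] by simp

lemma sqn_add_le:
  assumes "f \<in> L2 M" "g \<in> L2 M"
  shows "sqn M (\<lambda>x. f x + g x) \<le> 2 * sqn M f + 2 * sqn M g"
proof -
  have "sqn M (\<lambda>x. f x + g x) \<le> (LINT x|M. 2 * (cmod (f x))\<^sup>2 + 2 * (cmod (g x))\<^sup>2)"
    unfolding sqn_def using L2_add[OF assms] assms
    by (intro integral_mono cmod_add_sq_le) (auto simp: L2_def)
  then show ?thesis
    using assms by (simp add: L2_def sqn_def)
qed

lemma sqn_triangle: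
  assumes "f \<in> L2 M" "g \<in> L2 M" "h \<in> L2 M"
  shows "sqn M (\<lambda>x. f x - h x) \<le> 2 * sqn M (\<lambda>x. f x - g x) + 2 * sqn M (\<lambda>x. g x - h x)"
  using sqn_add_le[OF L2_diff[OF assms(1,2)] L2_diff[OF assms(2,3)]] by simp

lemma L2_mult_integrable:
  assumes "f \<in> L2 M" "g \<in> L2 M" shows "integrable M (\<lambda>x. f x * g x)"
proof (rule Bochner_Integration.integrable_bound)
  show "integrable M (\<lambda>x. (cmod (f x))\<^sup>2 + (cmod (g x))\<^sup>2)"
    using assms by (auto simp: L2_def)
  show "AE x in M. cmod (f x * g x) \<le> norm ((cmod (f x))\<^sup>2 + (cmod (g x))\<^sup>2)"
  proof (rule AE_I2)
    fix x
    have "2 * (cmod (f x) * cmod (g x)) \<le> (cmod (f x))\<^sup>2 + (cmod (g x))\<^sup>2"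
      using sum_squares_bound[of "cmod (f x)" "cmod (g x)"] by simp
    then show "cmod (f x * g x) \<le> norm ((cmod (f x))\<^sup>2 + (cmod (g x))\<^sup>2)"
      using mult_nonneg_nonneg[OF norm_ge_zero[of "f x"] norm_ge_zero[of "g x"]]
      unfolding norm_mult real_norm_def by linarith
  qed
qed (use assms in \<open>auto simp: L2_def\<close>)

lemma borel_measurable_cnj [measurable (raw)]:
  "f \<in> borel_measurable M \<Longrightarrow> (\<lambda>x. cnj (f x)) \<in> borel_measurable M"
  by (rule borel_measurable_continuous_on[where f=cnj]) (auto intro: continuous_intros)

lemma L2_cnj: "f \<in> L2 M \<Longrightarrow> (\<lambda>x. cnj (f x)) \<in> L2 M"
  by (auto simp: L2_def)

lemma sqn_diff_expand:
  assumes f: "f \<in> L2 M" and g: "g \<in> L2 M"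
  shows "sqn M (\<lambda>x. f x - g x) = sqn M f - 2 * Re (LINT x|M. f x * cnj (g x)) + sqn M g"
proof -
  have i: "integrable M (\<lambda>x. f x * cnj (g x))"
    by (intro L2_mult_integrable L2_cnj assms)
  have "sqn M (\<lambda>x. f x - g x)
      = (LINT x|M. (cmod (f x))\<^sup>2 - 2 * Re (f x * cnj (g x)) + (cmod (g x))\<^sup>2)"
    unfolding sqn_def
    by (intro Bochner_Integration.integral_cong refl)
       (simp add: cmod_power2, simp add: power2_eq_square algebra_simps)
  also have "\<dots> = sqn M f - 2 * (LINT x|M. Re (f x * cnj (g x))) + sqn M g"
    using f g integrable_Re[OF i] by (simp add: L2_def sqn_def del: times_complex.sel)
  finally show ?thesis
    by (simp only: integral_Re[OF i])
qed

lemma sqn_zero_iff: "f \<in> L2 M \<Longrightarrow> sqn M f = 0 \<longleftrightarrow> (AE x in M. f x = 0)"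
  unfolding sqn_def by (subst integral_nonneg_eq_0_iff_AE) (auto simp: L2_def)

text \<open>The Cauchy--Schwarz inequality, before optimising in \<open>t\<close>.\<close>
lemma L2_inner_bound:
  assumes f: "f \<in> L2 M" and g: "g \<in> L2 M" and t: "t > 0"
  shows "2 * cmod (LINT x|M. f x * cnj (g x)) \<le> t * sqn M f + sqn M g / t"
proof -
  have i: "integrable M (\<lambda>x. f x * cnj (g x))"
    by (intro L2_mult_integrable L2_cnj assms)
  have "2 * cmod (LINT x|M. f x * cnj (g x)) \<le> (LINT x|M. 2 * cmod (f x * cnj (g x)))"
    using integral_norm_bound[of M "\<lambda>x. f x * cnj (g x)"] by simp
  also have "\<dots> \<le> (LINT x|M. t * (cmod (f x))\<^sup>2 + (cmod (g x))\<^sup>2 / t)"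
  proof (rule integral_mono)
    fix x
    have "0 \<le> (t * cmod (f x) - cmod (g x))\<^sup>2 / t"
      using t by simp
    also have "\<dots> = t * (cmod (f x))\<^sup>2 + (cmod (g x))\<^sup>2 / t - 2 * (cmod (f x) * cmod (g x))"
      using t by (simp add: power2_eq_square field_simps)
    finally show "2 * cmod (f x * cnj (g x)) \<le> t * (cmod (f x))\<^sup>2 + (cmod (g x))\<^sup>2 / t"
      by (simp add: norm_mult)
  qed (use f g i in \<open>auto simp: L2_def\<close>)
  also have "\<dots> = t * sqn M f + sqn M g / t"
    using f g by (simp add: L2_def sqn_def)
  finally show ?thesis .
qed

text \<open>L^2 convergence is L^1 convergence of the squared moduli of the differences, for which
  an almost everywhere convergent subsequence exists.\<close>

lemma L2_tendsto_AE_subseq: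
  assumes f: "\<And>n. f n \<in> L2 M" and g: "g \<in> L2 M"
    and lim: "(\<lambda>n. sqn M (\<lambda>x. f n x - g x)) \<longlonglongrightarrow> 0"
  obtains r where "strict_mono r" "AE x in M. (\<lambda>n. f (r n) x) \<longlonglongrightarrow> g x"
proof -
  have "integrable M (\<lambda>x. (cmod (f n x - g x))\<^sup>2)" for n
    by (rule L2_integrable[OF L2_diff[OF f g]])
  then obtain r where r: "strict_mono r" "AE x in M. (\<lambda>n. (cmod (f (r n) x - g x))\<^sup>2) \<longlonglongrightarrow> 0"
    using tendsto_L1_AE_subseq[of M "\<lambda>n x. (cmod (f n x - g x))\<^sup>2"] lim by (auto simp: sqn_def)
  from r(2) have "AE x in M. (\<lambda>n. f (r n) x) \<longlonglongrightarrow> g x"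
  proof eventually_elim
    fix x assume "(\<lambda>n. (cmod (f (r n) x - g x))\<^sup>2) \<longlonglongrightarrow> 0"
    from tendsto_real_sqrt[OF this] show "(\<lambda>n. f (r n) x) \<longlonglongrightarrow> g x"
      by (simp add: tendsto_norm_zero_iff LIM_zero_iff)
  qed
  with r that show thesis by blast
qed

text \<open>Only here does finiteness of the measure matter: it reduces an \<open>L\<^sup>2\<close> Cauchy sequence to an
  \<open>L\<^sup>1\<close> one, for which an almost everywhere convergent subsequence is known to exist.\<close>
context finite_measure
begin

lemma L2_integrable1:
  assumes "f \<in> L2 M" shows "integrable M f"
proof (rule Bochner_Integration.integrable_bound)
  show "integrable M (\<lambda>x. 1 + (cmod (f x))\<^sup>2)"
    using assms by (auto simp: L2_def)
  show "AE x in M. cmod (f x) \<le> norm (1 + (cmod (f x))\<^sup>2)"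
  proof (rule AE_I2)
    fix x
    have "2 * cmod (f x) \<le> 1 + (cmod (f x))\<^sup>2"
      using sum_squares_bound[of 1 "cmod (f x)"] by simp
    then show "cmod (f x) \<le> norm (1 + (cmod (f x))\<^sup>2)"
      using norm_ge_zero[of "f x"] by (simp, linarith)
  qed
qed (use assms in \<open>auto simp: L2_def\<close>)

text \<open>Cauchy-Schwarz against the constant 1, again with the parameter \<open>t\<close> left
  free.\<close>

lemma L1_norm_le_sqn:
  assumes f: "f \<in> L2 M" and t: "t > 0"
  shows "2 * (LINT x|M. cmod (f x)) \<le> t * measure M (space M) + sqn M f / t"
proof -
  have "2 * (LINT x|M. cmod (f x)) = (LINT x|M. 2 * cmod (f x))"
    by simp
  also have "\<dots> \<le> (LINT x|M. t + (cmod (f x))\<^sup>2 / t)"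
  proof (rule integral_mono)
    fix x
    have "0 \<le> (t - cmod (f x))\<^sup>2 / t"
      using t by simp
    also have "\<dots> = t + (cmod (f x))\<^sup>2 / t - 2 * cmod (f x)"
      using t by (simp add: power2_eq_square field_simps)
    finally show "2 * cmod (f x) \<le> t + (cmod (f x))\<^sup>2 / t"
      by simp
  qed (use f L2_integrable1[OF f] in \<open>auto simp: L2_def\<close>)
  also have "\<dots> = t * measure M (space M) + sqn M f / t"
    using f by (simp add: L2_def sqn_def mult.commute)
  finally show ?thesis .
qed

text \<open>The limit is defined pointwise along an almost everywhere convergent subsequence.
  Fatou's lemma then turns the Cauchy bounds into bounds on the distance of every member of the full
  sequence to that limit.\<close>

lemma L2_complete:
  assumes f: "\<And>n. f n \<in> L2 M"
    and cauchy: "\<And>e. e > 0 \<Longrightarrow> \<exists>N. \<forall>m\<ge>N. \<forall>n\<ge>N. sqn M (\<lambda>x. f m x - f n x) < e"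
  obtains g where "g \<in> L2 M" "(\<lambda>n. sqn M (\<lambda>x. f n x - g x)) \<longlonglongrightarrow> 0"
proof -
  \<comment> \<open>The summand 1 keeps \<open>K\<close> positive if the whole space is
    null.\<close>
  define K where "K = measure M (space M) + 1"
  have K: "K > 0"
    by (simp add: K_def add_nonneg_pos)
  have [measurable]: "f n \<in> borel_measurable M" for n
    using f by (simp add: L2_measurable)
  obtain r where r: "strict_mono r" "AE x in M. Cauchy (\<lambda>n. f (r n) x)"
  proof (rule cauchy_L1_AE_cauchy_subseq[of M f])
    show "integrable M (f n)" for n
      by (rule L2_integrable1[OF f])
    fix e :: real assume e: "e > 0"
    \<comment> \<open>With \<open>t = e / K\<close> in \<open>L1_norm_le_sqn\<close>, this bound
      makes both terms there less than \<open>e\<close>.\<close>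
    obtain N where N: "\<And>m n. m \<ge> N \<Longrightarrow> n \<ge> N \<Longrightarrow> sqn M (\<lambda>x. f m x - f n x) < e\<^sup>2 / K"
      using cauchy[of "e\<^sup>2 / K"] e K by fastforce
    have "(LINT x|M. cmod (f i x - f j x)) < e" if "i \<ge> N" "j \<ge> N" for i j
    proof -
      have "2 * (LINT x|M. cmod (f i x - f j x))
          \<le> (e / K) * measure M (space M) + sqn M (\<lambda>x. f i x - f j x) / (e / K)"
        using e K by (intro L1_norm_le_sqn L2_diff f) auto
      also have "\<dots> < (e / K) * K + (e\<^sup>2 / K) / (e / K)"
        using e K N[OF that] by (intro add_strict_mono mult_strict_left_mono divide_strict_right_mono)
          (auto simp: K_def)
      also have "\<dots> = 2 * e"
        using e K by (simp add: power2_eq_square)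
      finally show ?thesis by simp
    qed
    then show "\<exists>N. \<forall>i\<ge>N. \<forall>j\<ge>N. (LINT x|M. cmod (f i x - f j x)) < e"
      by blast
  qed
  define g where "g x = lim (\<lambda>n. f (r n) x)" for x
  have [measurable]: "g \<in> borel_measurable M"
    unfolding g_def by measurable
  have lim: "AE x in M. (\<lambda>n. f (r n) x) \<longlonglongrightarrow> g x"
    using r(2) by eventually_elim (simp add: g_def Cauchy_convergent_iff convergent_LIMSEQ_iff)
  have fatou: "(\<integral>\<^sup>+x. ennreal ((cmod (f n x - g x))\<^sup>2) \<partial>M) \<le> ennreal e"
    if e: "e \<ge> 0" and N: "\<And>m. m \<ge> N \<Longrightarrow> sqn M (\<lambda>x. f n x - f m x) \<le> e" for e n N
  proof -
    have "(\<integral>\<^sup>+x. ennreal ((cmod (f n x - g x))\<^sup>2) \<partial>M)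
        = (\<integral>\<^sup>+x. liminf (\<lambda>k. ennreal ((cmod (f n x - f (r k) x))\<^sup>2)) \<partial>M)"
    proof (rule nn_integral_cong_AE)
      show "AE x in M. ennreal ((cmod (f n x - g x))\<^sup>2)
          = liminf (\<lambda>k. ennreal ((cmod (f n x - f (r k) x))\<^sup>2))"
        using lim
      proof eventually_elim
        fix x assume "(\<lambda>n. f (r n) x) \<longlonglongrightarrow> g x"
        then have "(\<lambda>k. ennreal ((cmod (f n x - f (r k) x))\<^sup>2)) \<longlonglongrightarrow> ennreal ((cmod (f n x - g x))\<^sup>2)"
          by (intro tendsto_intros)
        then show "ennreal ((cmod (f n x - g x))\<^sup>2)
          = liminf (\<lambda>k. ennreal ((cmod (f n x - f (r k) x))\<^sup>2))"
          by (metis lim_imp_Liminf trivial_limit_sequentially)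
      qed
    qed
    also have "\<dots> \<le> liminf (\<lambda>k. \<integral>\<^sup>+x. ennreal ((cmod (f n x - f (r k) x))\<^sup>2) \<partial>M)"
      by (rule nn_integral_liminf) measurable
    also have "\<dots> \<le> ennreal e"
    proof (rule Liminf_le)
      show "\<forall>\<^sub>F k in sequentially. (\<integral>\<^sup>+x. ennreal ((cmod (f n x - f (r k) x))\<^sup>2) \<partial>M) \<le> ennreal e"
        using eventually_ge_at_top[of N]
      proof eventually_elim
        fix k assume "k \<ge> N"
        then have "r k \<ge> N"
          using seq_suble[OF r(1), of k] by linarith
        then show "(\<integral>\<^sup>+x. ennreal ((cmod (f n x - f (r k) x))\<^sup>2) \<partial>M) \<le> ennreal e"
          using N[of "r k"] L2_integrable[OF L2_diff[OF f f], of n "r k"]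
          by (subst nn_integral_eq_integral) (auto simp: sqn_def ennreal_leI)
      qed
    qed simp
    finally show ?thesis .
  qed
  have g: "g \<in> L2 M"
  proof -
    obtain N where N: "\<And>m n. m \<ge> N \<Longrightarrow> n \<ge> N \<Longrightarrow> sqn M (\<lambda>x. f m x - f n x) < 1"
      using cauchy[of 1] by auto
    have "(\<integral>\<^sup>+x. ennreal ((cmod (f N x - g x))\<^sup>2) \<partial>M) \<le> ennreal 1"
      by (rule fatou[of 1 N]) (use N in \<open>auto intro: less_imp_le\<close>)
    then have "(\<integral>\<^sup>+x. ennreal ((cmod (f N x - g x))\<^sup>2) \<partial>M) < \<infinity>"
      using ennreal_one_less_top le_less_trans by (simp add: le_less_trans)
    then have "(\<lambda>x. f N x - g x) \<in> L2 M"
      by (auto simp: L2_def integrable_iff_bounded)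
    from L2_diff[OF f[of N] this] show ?thesis by simp
  qed
  have "(\<lambda>n. sqn M (\<lambda>x. f n x - g x)) \<longlonglongrightarrow> 0"
  proof (rule LIMSEQ_I)
    fix e :: real assume e: "e > 0"
    obtain N where N: "\<And>m n. m \<ge> N \<Longrightarrow> n \<ge> N \<Longrightarrow> sqn M (\<lambda>x. f m x - f n x) < e / 2"
      using cauchy[of "e / 2"] e by auto
    have "sqn M (\<lambda>x. f n x - g x) < e" if "n \<ge> N" for n
    proof -
      have "ennreal (sqn M (\<lambda>x. f n x - g x)) = (\<integral>\<^sup>+x. ennreal ((cmod (f n x - g x))\<^sup>2) \<partial>M)"
        unfolding sqn_def
        by (rule nn_integral_eq_integral[symmetric]) (auto intro: L2_integrable[OF L2_diff[OF f g]])
      also have "\<dots> \<le> ennreal (e / 2)"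
        by (rule fatou[of _ N]) (use N that e in \<open>auto intro: less_imp_le\<close>)
      finally show ?thesis
        using e by (simp add: ennreal_le_iff)
    qed
    then show "\<exists>N. \<forall>n\<ge>N. norm (sqn M (\<lambda>x. f n x - g x) - 0) < e"
      by auto
  qed
  with g that show thesis by blast
qed

end

section \<open>Closures and orthogonal projections in L^2\<close>

definition L2_closure :: "'a measure \<Rightarrow> ('a \<Rightarrow> complex) set \<Rightarrow> ('a \<Rightarrow> complex) set" where
  "L2_closure M V = {f \<in> L2 M. \<forall>e>0. \<exists>g\<in>V. sqn M (\<lambda>x. f x - g x) < e}"

lemma L2_closureI:
  assumes "f \<in> L2 M" "\<And>e. e > 0 \<Longrightarrow> \<exists>g\<in>V. sqn M (\<lambda>x. f x - g x) < e"
  shows "f \<in> L2_closure M V"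
  using assms by (auto simp: L2_closure_def)

lemma L2_closure_approx:
  assumes "f \<in> L2_closure M V" "e > 0"
  obtains g where "g \<in> V" "sqn M (\<lambda>x. f x - g x) < e"
  using assms by (auto simp: L2_closure_def)

lemma L2_closure_subset: "L2_closure M V \<subseteq> L2 M"
  by (auto simp: L2_closure_def)

lemma L2_closure_superset: "V \<subseteq> L2 M \<Longrightarrow> V \<subseteq> L2_closure M V"
  unfolding L2_closure_def by (auto intro!: bexI simp: sqn_def)

lemma L2_closure_closed:
  assumes V: "V \<subseteq> L2 M" shows "L2_closure M (L2_closure M V) = L2_closure M V"
proof
  show "L2_closure M (L2_closure M V) \<subseteq> L2_closure M V"
  proof
    fix f assume f: "f \<in> L2_closure M (L2_closure M V)"
    show "f \<in> L2_closure M V"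
    proof (rule L2_closureI)
      show fL: "f \<in> L2 M"
        using f by (simp add: L2_closure_def)
      fix e :: real assume "e > 0"
      then obtain g where g: "g \<in> L2_closure M V" "sqn M (\<lambda>x. f x - g x) < e / 4"
        using L2_closure_approx[OF f, of "e / 4"] by auto
      with \<open>e > 0\<close> obtain h where h: "h \<in> V" "sqn M (\<lambda>x. g x - h x) < e / 4"
        using L2_closure_approx[of g M V "e / 4"] by auto
      have "sqn M (\<lambda>x. f x - h x) \<le> 2 * sqn M (\<lambda>x. f x - g x) + 2 * sqn M (\<lambda>x. g x - h x)"
        using fL g h V by (intro sqn_triangle) (auto simp: L2_closure_def)
      also have "\<dots> < e"
        using g(2) h(2) by linarith
      finally show "\<exists>g\<in>V. sqn M (\<lambda>x. f x - g x) < e"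
        using h by blast
    qed
  qed
qed (rule L2_closure_superset[OF L2_closure_subset])

text \<open>The Lipschitz bound is asked for \<open>T f - T g\<close> itself and takes the place of
  linearity. Instances are multiplication by a constant and by \<open>z\<close>.\<close>

lemma L2_closure_linear_map:
  assumes f: "f \<in> L2_closure M V" and Tf: "T f \<in> L2 M" and C: "C \<ge> 0"
    and T: "\<And>g. g \<in> V \<Longrightarrow> T g \<in> V \<and> sqn M (\<lambda>x. T f x - T g x) \<le> C * sqn M (\<lambda>x. f x - g x)"
  shows "T f \<in> L2_closure M V"
proof (rule L2_closureI[OF Tf])
  fix e :: real assume "e > 0"
  \<comment> \<open>\<open>C + 1\<close> instead of \<open>C\<close>, since \<open>C\<close> may be
    0.\<close>
  then obtain g where g: "g \<in> V" "sqn M (\<lambda>x. f x - g x) < e / (C + 1)"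
    using L2_closure_approx[OF f, of "e / (C + 1)"] C by auto
  have "sqn M (\<lambda>x. T f x - T g x) \<le> C * sqn M (\<lambda>x. f x - g x)"
    using T[OF g(1)] by simp
  also have "\<dots> \<le> (C + 1) * sqn M (\<lambda>x. f x - g x)"
    by (intro mult_right_mono) auto
  also have "\<dots> < e"
    using g(2) C by (simp add: field_simps add_nonneg_pos)
  finally show "\<exists>g\<in>V. sqn M (\<lambda>x. T f x - g x) < e"
    using T[OF g(1)] by blast
qed

lemma linear_subspace_add: "linear_subspace V \<Longrightarrow> f \<in> V \<Longrightarrow> g \<in> V \<Longrightarrow> (\<lambda>x. f x + g x) \<in> V"
  and linear_subspace_cmult: "linear_subspace V \<Longrightarrow> f \<in> V \<Longrightarrow> (\<lambda>x. c * f x) \<in> V"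
  by (auto simp: linear_subspace_def)

lemma linear_subspace_L2_closure:
  assumes V: "linear_subspace V" "V \<subseteq> L2 M" shows "linear_subspace (L2_closure M V)"
proof -
  have "(\<lambda>x. 0) \<in> L2_closure M V"
    using V L2_closure_superset by (auto simp: linear_subspace_def)
  moreover have "(\<lambda>x. f x + g x) \<in> L2_closure M V"
    if f: "f \<in> L2_closure M V" and g: "g \<in> L2_closure M V" for f g
  proof (rule L2_closureI)
    have fgL: "f \<in> L2 M" "g \<in> L2 M"
      using f g by (auto simp: L2_closure_def)
    then show "(\<lambda>x. f x + g x) \<in> L2 M"
      by (rule L2_add)
    fix e :: real assume "e > 0"
    then have e4: "e / 4 > 0" by simp
    obtain a where a: "a \<in> V" "sqn M (\<lambda>x. f x - a x) < e / 4"
      using f e4 unfolding L2_closure_def by blast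
    obtain b where b: "b \<in> V" "sqn M (\<lambda>x. g x - b x) < e / 4"
      using g e4 unfolding L2_closure_def by blast
    have "sqn M (\<lambda>x. f x + g x - (a x + b x)) = sqn M (\<lambda>x. (f x - a x) + (g x - b x))"
      by (simp add: algebra_simps)
    also have "\<dots> \<le> 2 * sqn M (\<lambda>x. f x - a x) + 2 * sqn M (\<lambda>x. g x - b x)"
      using fgL a b V by (intro sqn_add_le L2_diff) auto
    also have "\<dots> < e"
      using a b by linarith
    finally show "\<exists>h\<in>V. sqn M (\<lambda>x. f x + g x - h x) < e"
      using linear_subspace_add[OF V(1) a(1) b(1)] by (intro bexI)
  qed
  moreover have "(\<lambda>x. c * f x) \<in> L2_closure M V" if f: "f \<in> L2_closure M V" for c f
  proof (rule L2_closure_linear_map[OF f, where C="(cmod c)\<^sup>2" and T="\<lambda>f x. c * f x"])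
    show "(\<lambda>x. c * f x) \<in> L2 M"
      using f by (auto simp: L2_closure_def intro: L2_cmult)
    fix g assume g: "g \<in> V"
    then show "(\<lambda>x. c * g x) \<in> V \<and>
        sqn M (\<lambda>x. c * f x - c * g x) \<le> (cmod c)\<^sup>2 * sqn M (\<lambda>x. f x - g x)"
      using V sqn_cmult[of M c "\<lambda>x. f x - g x"]
      by (auto simp: linear_subspace_def right_diff_distrib)
  qed simp
  ultimately show ?thesis
    by (simp add: linear_subspace_def)
qed

lemma L2_inner_small:
  assumes g: "g \<in> L2 M" and e: "e > 0"
  obtains d where "d > 0" "\<And>f. f \<in> L2 M \<Longrightarrow> sqn M f < d \<Longrightarrow> cmod (LINT x|M. f x * cnj (g x)) < e"
proof -
  \<comment> \<open>Chosen so that \<open>sqn M g / t\<close> is at most \<open>e\<close>; the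
    summand 1 keeps \<open>t\<close> positive when \<open>g\<close> vanishes.\<close>
  define t where "t = (sqn M g + 1) / e"
  have t: "t > 0"
    using e by (simp add: t_def add_nonneg_pos)
  show thesis
  proof (rule that[of "e / t"])
    fix f assume f: "f \<in> L2 M" "sqn M f < e / t"
    have "2 * cmod (LINT x|M. f x * cnj (g x)) \<le> t * sqn M f + sqn M g / t"
      by (rule L2_inner_bound[OF f(1) g t])
    also have "t * sqn M f < e"
      using f(2) t by (simp add: field_simps)
    also have "sqn M g / t \<le> e"
      using e sqn_nonneg[of M g] by (simp add: t_def field_simps add_pos_nonneg)
    finally show "cmod (LINT x|M. f x * cnj (g x)) < e" by simp
  qed (use e t in simp)
qed

lemma L2_inner_diff:
  assumes "f \<in> L2 M" "v \<in> L2 M" "g \<in> L2 M"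
  shows "(LINT x|M. (f x - v x) * cnj (g x)) = (LINT x|M. f x * cnj (g x)) - (LINT x|M. v x * cnj (g x))"
  unfolding left_diff_distrib
  by (intro Bochner_Integration.integral_diff L2_mult_integrable L2_cnj assms)

text \<open>The Hilbert space argument: a minimising sequence is Cauchy by the parallelogram law,
  and varying it in the direction of \<open>h\<close> gives orthogonality. The variation is carried
  out on the sequence \<open>g\<close> and then passed to the limit, so that minimality of
  \<open>p\<close> never has to be stated. The measure lives on the complex plane because
  \<open>linear_subspace\<close> speaks of functions defined there.\<close>

lemma L2_projection:
  fixes M :: "complex measure"
  assumes "finite_measure M"
    and V: "linear_subspace V" "V \<subseteq> L2 M" "L2_closure M V \<subseteq> V" and f: "f \<in> L2 M"
  obtains p where "p \<in> V" "\<And>g. g \<in> V \<Longrightarrow> (LINT x|M. (f x - p x) * cnj (g x)) = 0"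
proof -
  interpret finite_measure M by fact
  define D where "D = (\<lambda>g. sqn M (\<lambda>x. f x - g x)) ` V"
  define d where "d = Inf D"
  have D: "D \<noteq> {}" "bdd_below D"
    using V by (auto simp: D_def linear_subspace_def intro!: bdd_belowI[of _ 0])
  have d_le: "d \<le> sqn M (\<lambda>x. f x - g x)" if "g \<in> V" for g
    using that D unfolding d_def by (intro cInf_lower) (auto simp: D_def)
  have "\<exists>g\<in>V. sqn M (\<lambda>x. f x - g x) < d + 1 / Suc n" for n
    using cInf_lessD[OF D(1), of "d + 1 / Suc n"] by (auto simp: d_def D_def)
  then obtain g where gV: "\<And>n. g n \<in> V" and g: "\<And>n. sqn M (\<lambda>x. f x - g n x) < d + 1 / Suc n"
    by metis
  have gL: "g n \<in> L2 M" for n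
    using gV V by blast
  \<comment> \<open>The midpoint of \<open>g m\<close> and \<open>g n\<close> lies in
    \<open>V\<close>, so its squared distance to \<open>f\<close> is at least \<open>d\<close>; the
    four copies of \<open>d\<close> cancel.\<close>
  have parallelogram: "sqn M (\<lambda>x. g m x - g n x) \<le> 2 / Suc m + 2 / Suc n" for m n
  proof -
    have mid: "(\<lambda>x. 1/2 * (g m x + g n x)) \<in> V"
      by (intro linear_subspace_cmult linear_subspace_add V gV)
    then have midL: "(\<lambda>x. 1/2 * (g m x + g n x)) \<in> L2 M"
      using V by blast
    have par: "(cmod (a - b))\<^sup>2 = 2 * (cmod (c - a))\<^sup>2 + 2 * (cmod (c - b))\<^sup>2
        - 4 * (cmod (c - 1/2 * (a + b)))\<^sup>2" for a b c :: complex
      unfolding cmod_power2 by (simp add: power2_eq_square) (simp add: field_simps)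
    have "sqn M (\<lambda>x. g m x - g n x) = 2 * sqn M (\<lambda>x. f x - g m x) + 2 * sqn M (\<lambda>x. f x - g n x)
        - 4 * sqn M (\<lambda>x. f x - 1/2 * (g m x + g n x))"
    proof -
      define q where "q = (\<lambda>x. 1/2 * (g m x + g n x))"
      have "(\<lambda>x. (cmod (g m x - g n x))\<^sup>2) = (\<lambda>x. 2 * (cmod (f x - g m x))\<^sup>2 + 2 * (cmod (f x - g n x))\<^sup>2
          - 4 * (cmod (f x - q x))\<^sup>2)"
        unfolding q_def by (rule ext) (rule par)
      then have "sqn M (\<lambda>x. g m x - g n x) = 2 * sqn M (\<lambda>x. f x - g m x) + 2 * sqn M (\<lambda>x. f x - g n x)
          - 4 * sqn M (\<lambda>x. f x - q x)"
        using L2_integrable[OF L2_diff[OF f gL]]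
          L2_integrable[OF L2_diff[OF f midL[folded q_def]]]
        by (simp add: sqn_def)
      then show ?thesis
        by (simp only: q_def)
    qed
    then show ?thesis
      using g[of m] g[of n] d_le[OF mid] mult_2[of "1 / real (Suc m)"] mult_2[of "1 / real (Suc n)"]
      by simp
  qed
  have "\<exists>N. \<forall>m\<ge>N. \<forall>n\<ge>N. sqn M (\<lambda>x. g m x - g n x) < e" if e: "e > 0" for e
  proof -
    obtain N where N: "4 / Suc N < e"
      using reals_Archimedean[of "e / 4"] e by (auto simp: field_simps)
    have "sqn M (\<lambda>x. g m x - g n x) < e" if "m \<ge> N" "n \<ge> N" for m n
    proof -
      have "sqn M (\<lambda>x. g m x - g n x) \<le> 2 / Suc m + 2 / Suc n"
        by (rule parallelogram)
      also have "\<dots> \<le> 2 / Suc N + 2 / Suc N"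
        using that by (intro add_mono divide_left_mono) auto
      finally show ?thesis using N by simp
    qed
    then show ?thesis by blast
  qed
  then obtain p where pL: "p \<in> L2 M" and p: "(\<lambda>n. sqn M (\<lambda>x. g n x - p x)) \<longlonglongrightarrow> 0"
    using L2_complete[of g] gL by blast
  have pV: "p \<in> V"
  proof -
    have "p \<in> L2_closure M V"
    proof (rule L2_closureI[OF pL])
      fix e :: real assume "e > 0"
      then have "\<forall>\<^sub>F n in sequentially. sqn M (\<lambda>x. g n x - p x) < e"
        using order_tendstoD(2)[OF p] by auto
      then obtain n where "sqn M (\<lambda>x. g n x - p x) < e"
        using eventually_happens' sequentially_bot by blast
      then show "\<exists>h\<in>V. sqn M (\<lambda>x. p x - h x) < e"
        using gV by (metis sqn_minus_commute)
    qed
    then show ?thesis using V by blast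
  qed
  have orth: "(LINT x|M. (f x - p x) * cnj (h x)) = 0" if h: "h \<in> V" for h
  proof -
    \<comment> \<open>Moving in the direction \<open>s * c\<close> with \<open>s\<close> real makes
      the linear term of the expansion tend to \<open>2 * s * (cmod c)^2\<close>, so that one real
      parameter is enough.\<close>
    define c where "c = (LINT x|M. (f x - p x) * cnj (h x))"
    have hL: "h \<in> L2 M"
      using h V by blast
    have shift: "d \<le> sqn M (\<lambda>x. f x - g n x) - 2 * s * Re (cnj c * (LINT x|M. (f x - g n x) * cnj (h x)))
        + s\<^sup>2 * (cmod c)\<^sup>2 * sqn M h" for s :: real and n
    proof -
      have "(\<lambda>x. g n x + (s * c) * h x) \<in> V"
        by (intro linear_subspace_cmult linear_subspace_add V gV h)
      then have "d \<le> sqn M (\<lambda>x. f x - (g n x + (s * c) * h x))"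
        by (rule d_le)
      also have "\<dots> = sqn M (\<lambda>x. (f x - g n x) - (s * c) * h x)"
        by (simp add: algebra_simps)
      also have "\<dots> = sqn M (\<lambda>x. f x - g n x)
          - 2 * Re (LINT x|M. (f x - g n x) * cnj ((s * c) * h x)) + sqn M (\<lambda>x. (s * c) * h x)"
        by (intro sqn_diff_expand L2_diff f gL L2_cmult hL)
      also have "(LINT x|M. (f x - g n x) * cnj ((s * c) * h x))
          = s * (cnj c * (LINT x|M. (f x - g n x) * cnj (h x)))"
        by (simp add: integral_mult_right_zero[symmetric] mult_ac del: integral_mult_right_zero)
      also have "sqn M (\<lambda>x. (s * c) * h x) = s\<^sup>2 * (cmod c)\<^sup>2 * sqn M h"
        by (subst sqn_cmult) (simp add: norm_mult power_mult_distrib)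
      finally show ?thesis by simp
    qed
    have lim: "(\<lambda>n. LINT x|M. (f x - g n x) * cnj (h x)) \<longlonglongrightarrow> c"
    proof (rule LIMSEQ_I)
      fix e :: real assume "e > 0"
      then obtain \<delta> where \<delta>: "\<delta> > 0"
        "\<And>f. f \<in> L2 M \<Longrightarrow> sqn M f < \<delta> \<Longrightarrow> cmod (LINT x|M. f x * cnj (h x)) < e"
        using L2_inner_small[OF hL] by metis
      obtain N where N: "\<And>n. n \<ge> N \<Longrightarrow> sqn M (\<lambda>x. g n x - p x) < \<delta>"
        using order_tendstoD(2)[OF p \<delta>(1)] by (auto simp: eventually_sequentially)
      have "norm ((LINT x|M. (f x - g n x) * cnj (h x)) - c) < e" if "n \<ge> N" for n
        using \<delta>(2)[OF L2_diff[OF gL pL] N[OF that]]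
        by (simp add: c_def L2_inner_diff f gL pL hL norm_minus_commute)
      then show "\<exists>N. \<forall>n\<ge>N. norm ((LINT x|M. (f x - g n x) * cnj (h x)) - c) < e"
        by blast
    qed
    have quad: "2 * s * (cmod c)\<^sup>2 \<le> s\<^sup>2 * (cmod c)\<^sup>2 * sqn M h" for s :: real
    proof -
      have "(\<lambda>n. 1 / Suc n - 2 * s * Re (cnj c * (LINT x|M. (f x - g n x) * cnj (h x)))
        + s\<^sup>2 * (cmod c)\<^sup>2 * sqn M h) \<longlonglongrightarrow> 0 - 2 * s * Re (cnj c * c) + s\<^sup>2 * (cmod c)\<^sup>2 * sqn M h"
        by (intro tendsto_intros lim LIMSEQ_inverse_real_of_nat[unfolded inverse_eq_divide])
      moreover have "0 \<le> 1 / Suc n - 2 * s * Re (cnj c * (LINT x|M. (f x - g n x) * cnj (h x)))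
        + s\<^sup>2 * (cmod c)\<^sup>2 * sqn M h" for n
        using shift[of n s] g[of n] by linarith
      ultimately have "0 \<le> 0 - 2 * s * Re (cnj c * c) + s\<^sup>2 * (cmod c)\<^sup>2 * sqn M h"
        by (intro LIMSEQ_le_const) auto
      moreover have "Re (cnj c * c) = (cmod c)\<^sup>2"
        unfolding cmod_power2 by (simp add: power2_eq_square)
      ultimately show ?thesis by simp
    qed
    have "c = 0"
    proof -
      \<comment> \<open>Now \<open>s * sqn M h\<close> is at most 1, and \<open>quad\<close> says
        that twice a nonnegative number is at most that number.\<close>
      define s where "s = 1 / (sqn M h + 1)"
      have K: "sqn M h + 1 > 0"
        by (simp add: add_nonneg_pos)
      have s: "s > 0" "s * sqn M h \<le> 1"
        using K by (auto simp: s_def)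
      have "2 * (cmod c)\<^sup>2 * s \<le> (s * sqn M h) * (cmod c)\<^sup>2 * s"
        using quad[of s] by (simp add: power2_eq_square mult_ac)
      also have "\<dots> \<le> 1 * (cmod c)\<^sup>2 * s"
        using s by (intro mult_right_mono) auto
      finally have "(cmod c)\<^sup>2 * s \<le> 0" by (simp add: mult.commute)
      then show "c = 0"
        using s(1) by (simp add: mult_le_0_iff)
    qed
    then show ?thesis by (simp add: c_def)
  qed
  show thesis
    using that[OF pV orth] .
qed

section \<open>Polynomials on the circle and outer functions\<close>

text \<open>By regularity there are a compact \<open>K\<close> inside \<open>A\<close> and an open
  \<open>U\<close> around \<open>A\<close>, each off by less than \<open>e / 2\<close> in measure.
  An Urysohn function between them differs from the indicator at most by the indicator of
  \<open>U\<close> minus that of \<open>K\<close>.\<close>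

lemma continuous_approx_indicator:
  assumes A: "A \<in> sets arc_length" and e: "e > 0"
  obtains v :: "complex \<Rightarrow> real" where "continuous_on UNIV v"
    "(LINT z|arc_length. \<bar>indicator A z - v z\<bar>) < e"
proof -
  \<comment> \<open>\<open>inner_regular\<close> and \<open>outer_regular\<close> concern Borel
    measures on a whole Polish space, so arc length is pushed forward to the plane.\<close>
  define N where "N = distr arc_length borel (\<lambda>z. z)"
  have sphere: "sphere 0 1 \<in> sets (borel :: complex measure)"
    by (simp add: borel_closed)
  have AB: "A \<in> sets borel" "A \<subseteq> sphere 0 1"
    using A sphere by (auto simp: sets_arc_length sets_restrict_space)
  have N: "emeasure N B = emeasure arc_length (B \<inter> sphere 0 1)" if "B \<in> sets borel" for B
    using that by (simp add: N_def emeasure_distr)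
  have finN: "emeasure N (space N) \<noteq> \<infinity>"
    by (simp add: N space_borel N_def[THEN arg_cong[where f=space]] arc.emeasure_finite)
  have "\<exists>K\<in>{K. K \<subseteq> A \<and> compact K}. emeasure N A < emeasure N K + ennreal (e / 2)"
  proof (rule ccontr)
    assume "\<not> ?thesis"
    then have "emeasure N K + ennreal (e / 2) \<le> emeasure N A" if "K \<subseteq> A" "compact K" for K
      using that by (auto simp: not_less)
    then have "(SUP K\<in>{K. K \<subseteq> A \<and> compact K}. emeasure N K + ennreal (e / 2)) \<le> emeasure N A"
      by (intro SUP_least) auto
    moreover have "(SUP K\<in>{K. K \<subseteq> A \<and> compact K}. emeasure N K + ennreal (e / 2))
        = emeasure N A + ennreal (e / 2)"
      by (subst inner_regular[OF _ finN AB(1)])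
         (auto simp: N_def intro!: ennreal_SUP_add_left)
    moreover have "emeasure N A \<noteq> \<infinity>"
      by (simp add: N AB arc.emeasure_finite)
    ultimately show False
      using e by (simp add: ennreal_add_left_cancel_le top_unique)
  qed
  then obtain K where K: "K \<subseteq> A" "compact K" "emeasure N A < emeasure N K + ennreal (e / 2)"
    by blast
  have "(INF U\<in>{U. A \<subseteq> U \<and> open U}. emeasure N U) < emeasure N A + ennreal (e / 2)"
  proof -
    have "(INF U\<in>{U. A \<subseteq> U \<and> open U}. emeasure N U) = emeasure N A"
      by (rule outer_regular[OF _ finN AB(1), symmetric]) (simp add: N_def)
    moreover have "emeasure N A < emeasure N A + ennreal (e / 2)"
      using e by (simp add: N AB arc.emeasure_eq_measure ennreal_less_iff flip: ennreal_plus)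
    ultimately show ?thesis by simp
  qed
  then obtain U where U: "A \<subseteq> U" "open U" "emeasure N U < emeasure N A + ennreal (e / 2)"
    unfolding INF_less_iff by blast
  have Km: "K \<inter> sphere 0 1 \<in> sets arc_length" and Um: "U \<inter> sphere 0 1 \<in> sets arc_length"
    using K(2) U(2) by (auto simp: sets_arc_length sets_restrict_space compact_imp_closed Int_commute)
  have mK: "measure arc_length A < measure arc_length (K \<inter> sphere 0 1) + e / 2"
    using K(3) e AB compact_imp_closed[OF K(2)]
    by (simp add: N arc.emeasure_eq_measure Int_absorb2 ennreal_less_iff flip: ennreal_plus)
  have mU: "measure arc_length (U \<inter> sphere 0 1) < measure arc_length A + e / 2"
    using U(3) e AB U(2)
    by (simp add: N arc.emeasure_eq_measure Int_absorb2 ennreal_less_iff flip: ennreal_plus)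
  obtain v :: "complex \<Rightarrow> real" where v: "continuous_on UNIV v"
    "\<And>x. v x \<in> closed_segment 1 0" "\<And>x. x \<in> K \<Longrightarrow> v x = 1" "\<And>x. x \<in> - U \<Longrightarrow> v x = 0"
    using Urysohn[of K "- U" "1::real" 0] K U by (auto simp: compact_imp_closed)
  have v01: "0 \<le> v x" "v x \<le> 1" for x
    using v(2)[of x] by (auto simp: closed_segment_eq_real_ivl)
  have [measurable]: "v \<in> borel_measurable arc_length"
    using v(1) by (intro borel_measurable_arc_length borel_measurable_continuous_onI)
  have int: "integrable arc_length (indicat_real B)" if "B \<in> sets arc_length" for B
    using that by (simp add: sets.Int_space_eq2[of _ arc_length, simplified] integrable_indicator_iff
        arc.emeasure_finite less_top[symmetric])
  have "(LINT z|arc_length. \<bar>indicator A z - v z\<bar>)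
      \<le> (LINT z|arc_length. indicat_real (U \<inter> sphere 0 1) z - indicat_real (K \<inter> sphere 0 1) z)"
  proof (rule integral_mono)
    show "integrable arc_length (\<lambda>z. \<bar>indicator A z - v z\<bar>)"
      by (rule arc.integrable_const_bound[of _ 1])
         (use A v01 in \<open>auto simp: indicator_def abs_le_iff intro!: AE_I2 intro: order_trans[of _ 0] order_trans[of _ 1]\<close>)
    show "integrable arc_length (\<lambda>z. indicat_real (U \<inter> sphere 0 1) z - indicat_real (K \<inter> sphere 0 1) z)"
      by (intro Bochner_Integration.integrable_diff int Um Km)
    fix z assume "z \<in> space arc_length"
    then show "\<bar>indicator A z - v z\<bar> \<le> indicat_real (U \<inter> sphere 0 1) z - indicat_real (K \<inter> sphere 0 1) z"
      using v01[of z] v(3)[of z] v(4)[of z] U(1) K(1) by (auto simp: indicator_def)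
  qed
  also have "\<dots> = measure arc_length (U \<inter> sphere 0 1) - measure arc_length (K \<inter> sphere 0 1)"
    using int[OF Um] int[OF Km] Um Km by (simp add: sets.Int_space_eq2)
  also have "\<dots> < e"
    using mK mU by simp
  finally show thesis
    using that v(1) by blast
qed

lemma continuous_integrable_arc_length:
  fixes v :: "complex \<Rightarrow> real"
  assumes "continuous_on UNIV v" shows "integrable arc_length v"
proof -
  have "compact (v ` sphere 0 1)"
    by (rule compact_continuous_image[OF continuous_on_subset[OF assms]]) auto
  then obtain C where "\<And>z. z \<in> sphere 0 1 \<Longrightarrow> \<bar>v z\<bar> \<le> C"
    using compact_imp_bounded[of "v ` sphere 0 1"]
    unfolding bounded_iff by (metis imageI real_norm_def)
  then show ?thesis
    using assms by (intro arc.integrable_const_bound[of _ C] AE_I2)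
      (auto intro!: borel_measurable_arc_length borel_measurable_continuous_onI)
qed

lemma continuous_dense_L1:
  fixes f :: "complex \<Rightarrow> real"
  assumes f: "integrable arc_length f" and e: "e > 0"
  obtains v :: "complex \<Rightarrow> real" where "continuous_on UNIV v"
    "(LINT z|arc_length. \<bar>f z - v z\<bar>) < e"
proof -
  have "\<forall>e>0. \<exists>v. continuous_on UNIV v \<and> (LINT z|arc_length. \<bar>f z - v z\<bar>) < e"
    using f
  proof (induction rule: integrable_induct)
    case (base A c)
    show ?case
    proof (intro allI impI)
      fix e :: real assume e: "e > 0"
      have "e / (\<bar>c\<bar> + 1) > 0"
        using e by (simp add: add_nonneg_pos)
      then obtain v where v: "continuous_on UNIV v"
        "(LINT z|arc_length. \<bar>indicator A z - v z\<bar>) < e / (\<bar>c\<bar> + 1)"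
        using continuous_approx_indicator[OF base(1)] by metis
      have "(LINT z|arc_length. \<bar>indicator A z *\<^sub>R c - v z * c\<bar>)
          = (LINT z|arc_length. \<bar>indicator A z - v z\<bar> * \<bar>c\<bar>)"
        by (simp add: abs_mult[symmetric] left_diff_distrib)
      also have "\<dots> = (LINT z|arc_length. \<bar>indicator A z - v z\<bar>) * \<bar>c\<bar>"
        by simp
      also have "\<dots> \<le> (LINT z|arc_length. \<bar>indicator A z - v z\<bar>) * (\<bar>c\<bar> + 1)"
        by (intro mult_left_mono) auto
      also have "\<dots> < e"
        using v(2) by (simp add: pos_less_divide_eq add_nonneg_pos)
      finally show "\<exists>v. continuous_on UNIV v \<and> (LINT z|arc_length. \<bar>indicator A z *\<^sub>R c - v z\<bar>) < e"
        using v(1) by (intro exI[of _ "\<lambda>z. v z * c"]) (auto intro: continuous_intros)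
    qed
  next
    case (add f g)
    show ?case
    proof (intro allI impI)
      fix e :: real assume e: "e > 0"
      obtain v where v: "continuous_on UNIV v" "(LINT z|arc_length. \<bar>f z - v z\<bar>) < e / 2"
        using add.IH(1) e by (meson half_gt_zero)
      obtain w where w: "continuous_on UNIV w" "(LINT z|arc_length. \<bar>g z - w z\<bar>) < e / 2"
        using add.IH(2) e by (meson half_gt_zero)
      have "(LINT z|arc_length. \<bar>f z + g z - (v z + w z)\<bar>)
          \<le> (LINT z|arc_length. \<bar>f z - v z\<bar> + \<bar>g z - w z\<bar>)"
        using add.hyps continuous_integrable_arc_length[OF v(1)] continuous_integrable_arc_length[OF w(1)] by (intro integral_mono) auto
      also have "\<dots> < e"
        using add.hyps continuous_integrable_arc_length[OF v(1)] continuous_integrable_arc_length[OF w(1)] v(2) w(2) by simp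
      finally show "\<exists>v. continuous_on UNIV v \<and> (LINT z|arc_length. \<bar>f z + g z - v z\<bar>) < e"
        using v w by (intro exI[of _ "\<lambda>z. v z + w z"]) (auto intro: continuous_intros)
    qed
  next
    case (lim f s)
    show ?case
    proof (intro allI impI)
      fix e :: real assume e: "e > 0"
      have [measurable]: "f \<in> borel_measurable arc_length" "\<And>i. s i \<in> borel_measurable arc_length"
        using lim.hyps by auto
      have "(\<lambda>i. LINT z|arc_length. \<bar>f z - s i z\<bar>) \<longlonglongrightarrow> (LINT z|arc_length. 0)"
      \<comment> \<open>\<open>integrable_induct\<close> provides simple functions bounded by
        \<open>2 * \<bar>f\<bar>\<close>, which makes the difference at most
        \<open>3 * \<bar>f\<bar>\<close>.\<close>
      proof (rule integral_dominated_convergence[where w="\<lambda>z. 3 * \<bar>f z\<bar>"])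
        show "AE z in arc_length. (\<lambda>i. \<bar>f z - s i z\<bar>) \<longlonglongrightarrow> 0"
        proof (rule AE_I2)
          fix z assume "z \<in> space arc_length"
          from tendsto_rabs[OF tendsto_diff[OF tendsto_const[of "f z"] lim.hyps(2)[OF this]]]
          show "(\<lambda>i. \<bar>f z - s i z\<bar>) \<longlonglongrightarrow> 0" by simp
        qed
        show "AE z in arc_length. norm \<bar>f z - s i z\<bar> \<le> 3 * \<bar>f z\<bar>" for i
          using lim.hyps(3)[of _ i] by (intro AE_I2) fastforce
      qed (use lim.hyps in auto)
      then have "\<forall>\<^sub>F i in sequentially. (LINT z|arc_length. \<bar>f z - s i z\<bar>) < e / 2"
        using e by (intro order_tendstoD(2)) auto
      then obtain i where i: "(LINT z|arc_length. \<bar>f z - s i z\<bar>) < e / 2"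
        using eventually_happens' sequentially_bot by blast
      obtain v where v: "continuous_on UNIV v" "(LINT z|arc_length. \<bar>s i z - v z\<bar>) < e / 2"
        using lim.IH e by (meson half_gt_zero)
      have "(LINT z|arc_length. \<bar>f z - v z\<bar>)
          \<le> (LINT z|arc_length. \<bar>f z - s i z\<bar> + \<bar>s i z - v z\<bar>)"
        using lim.hyps continuous_integrable_arc_length[OF v(1)] by (intro integral_mono) auto
      also have "\<dots> < e"
        using lim.hyps continuous_integrable_arc_length[OF v(1)] v(2) i by simp
      finally show "\<exists>v. continuous_on UNIV v \<and> (LINT z|arc_length. \<bar>f z - v z\<bar>) < e"
        using v by blast
    qed
  qed
  then show thesis
    using e that by blast
qed

text \<open>On the unit circle a monomial in \<open>z\<close> and \<open>cnj z\<close> is a power of \<open>z\<close> or of \<open>cnj z\<close>.\<close>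
lemma Re_poly_mult_cnj:
  "\<exists>r. \<forall>z. cmod z = 1 \<longrightarrow> Re (poly p z * cnj (poly q z)) = Re (poly r z)"
proof (induction p q rule: poly_induct2)
  case 0
  show ?case by (intro exI[of _ 0]) simp
next
  case (pCons a p b q)
  then obtain r where r: "\<And>z. cmod z = 1 \<Longrightarrow> Re (poly p z * cnj (poly q z)) = Re (poly r z)"
    by blast
  have "Re (poly (pCons a p) z * cnj (poly (pCons b q) z))
      = Re (poly ([:a * cnj b:] + pCons 0 (smult (cnj a) q) + pCons 0 (smult (cnj b) p) + r) z)"
    if z: "cmod z = 1" for z
  proof -
    have "z * cnj z = 1"
      using z by (simp add: complex_norm_square[symmetric])
    \<comment> \<open>\<open>z * cnj z = 1\<close> removes the powers from the last product. The
      term containing \<open>cnj z\<close> is written as a conjugate and is conjugated back under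
      the real part.\<close>
    then have "poly (pCons a p) z * cnj (poly (pCons b q) z)
        = a * cnj b + cnj (z * (cnj a * poly q z)) + z * (cnj b * poly p z) + poly p z * cnj (poly q z)"
      by (simp add: algebra_simps)
    then have "Re (poly (pCons a p) z * cnj (poly (pCons b q) z))
        = Re (a * cnj b) + Re (z * (cnj a * poly q z)) + Re (z * (cnj b * poly p z))
          + Re (poly p z * cnj (poly q z))"
      by (simp only: plus_complex.sel complex_cnj_cnj cnj.sel)
    then show ?thesis
      by (simp only: r[OF z] poly_add poly_pCons poly_smult poly_0 plus_complex.sel) simp
  qed
  then show ?case by blast
qed

text \<open>On the circle a real polynomial in the coordinates is a real trigonometric polynomial.
  For products, \<open>Re a * Re b\<close> is half the sum of \<open>Re (a * b)\<close> and
  \<open>Re (a * cnj b)\<close>; the first is the real part of a polynomial, and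
  \<open>Re_poly_mult_cnj\<close> handles the second.\<close>

lemma real_polynomial_function_circle:
  fixes g :: "complex \<Rightarrow> real"
  assumes "real_polynomial_function g"
  shows "\<exists>p. \<forall>z. cmod z = 1 \<longrightarrow> g z = Re (poly p z)"
  using assms
proof induction
  case (linear f)
  then interpret bounded_linear f .
  have "f z = Re (poly [:0, Complex (f 1) (- f \<i>):] z)" for z
  proof -
    have "f z = f (Re z *\<^sub>R 1 + Im z *\<^sub>R \<i>)"
      by (rule arg_cong[where f=f]) (simp add: complex_eq_iff)
    also have "\<dots> = Re z * f 1 + Im z * f \<i>"
      by (simp only: add scaleR real_scaleR_def)
    finally show ?thesis by simp
  qed
  then show ?case by blast
next
  case (const c)
  show ?case by (intro exI[of _ "[:of_real c:]"]) simp
next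
  case (add f g)
  then obtain p q where "\<And>z. cmod z = 1 \<Longrightarrow> f z = Re (poly p z)" "\<And>z. cmod z = 1 \<Longrightarrow> g z = Re (poly q z)"
    by blast
  then show ?case by (intro exI[of _ "p + q"]) simp
next
  case (mult f g)
  then obtain p q where p: "\<And>z. cmod z = 1 \<Longrightarrow> f z = Re (poly p z)"
    and q: "\<And>z. cmod z = 1 \<Longrightarrow> g z = Re (poly q z)"
    by blast
  obtain r where r: "\<And>z. cmod z = 1 \<Longrightarrow> Re (poly p z * cnj (poly q z)) = Re (poly r z)"
    using Re_poly_mult_cnj by blast
  have "f z * g z = Re (poly (smult (1/2) (p * q + r)) z)" if z: "cmod z = 1" for z
  proof -
    have "Re (poly (smult (1/2) (p * q + r)) z) = (Re (poly p z * poly q z) + Re (poly r z)) / 2"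
      by simp
    also have "\<dots> = Re (poly p z) * Re (poly q z)"
      unfolding r[OF z, symmetric] by simp
    finally show ?thesis
      using p[OF z] q[OF z] by simp
  qed
  then show ?case by blast
qed

lemma Re_poly_dense:
  fixes v :: "complex \<Rightarrow> real"
  assumes "continuous_on UNIV v" "e > 0"
  obtains p where "\<And>z. cmod z = 1 \<Longrightarrow> \<bar>v z - Re (poly p z)\<bar> < e"
proof -
  obtain g where g: "real_polynomial_function g" "\<And>z. z \<in> sphere 0 1 \<Longrightarrow> \<bar>v z - g z\<bar> < e"
    using Stone_Weierstrass_real_polynomial_function[of "sphere 0 1" v e]
      assms continuous_on_subset by (metis compact_sphere subset_UNIV)
  obtain p where "\<And>z. cmod z = 1 \<Longrightarrow> g z = Re (poly p z)"
    using real_polynomial_function_circle[OF g(1)] by blast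
  with g(2) show thesis
    by (intro that[of p]) auto
qed

section \<open>Uniqueness of Fourier coefficients of integrable functions\<close>

lemma integrable_bounded_mult:
  fixes f h :: "'a \<Rightarrow> complex"
  assumes "integrable M f" "h \<in> borel_measurable M" "AE x in M. cmod (h x) \<le> C"
  shows "integrable M (\<lambda>x. f x * h x)"
proof (rule Bochner_Integration.integrable_bound)
  show "integrable M (\<lambda>x. C * cmod (f x))"
    using assms by simp
  show "AE x in M. norm (f x * h x) \<le> norm (C * cmod (f x))"
    using assms(3)
  proof eventually_elim
    fix x assume h: "cmod (h x) \<le> C"
    then have "C \<ge> 0"
      using norm_ge_zero order_trans by blast
    then show "norm (f x * h x) \<le> norm (C * cmod (f x))"
      using h by (simp add: norm_mult mult.commute[of C] mult_left_mono)
  qed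
qed (use assms in auto)

lemma poly_measurable_arc_length [measurable]: "poly p \<in> borel_measurable arc_length"
  by (intro borel_measurable_arc_length borel_measurable_continuous_onI continuous_intros)

lemma poly_bounded_circle: "\<exists>C. \<forall>z. cmod z = 1 \<longrightarrow> cmod (poly p z) \<le> C"
proof -
  have "compact (poly p ` sphere 0 1)"
    by (intro compact_continuous_image continuous_intros) auto
  then show ?thesis
    using compact_imp_bounded[of "poly p ` sphere 0 1"] unfolding bounded_iff
    by (metis imageI mem_sphere_0)
qed

text \<open>Vanishing against all powers extends to real parts of polynomials, by uniform
  approximation to continuous functions, and by dominated convergence to indicators. It is stated
  for L^1 because it will be applied to products of two L^2 functions.\<close>

lemma Fourier_unique:
  assumes f: "integrable arc_length f"
    and pos: "\<And>n. (LINT z|arc_length. f z * z ^ n) = 0"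
    and neg: "\<And>n. (LINT z|arc_length. f z * cnj z ^ n) = 0"
  shows "AE z in arc_length. f z = 0"
proof (rule arc.density_zero[OF f])
  have int: "integrable arc_length (\<lambda>z. f z * h z)"
    if "h \<in> borel_measurable arc_length" "\<And>z. cmod z = 1 \<Longrightarrow> cmod (h z) \<le> C" for h C
    using that by (intro integrable_bounded_mult[OF f, of _ C] AE_I2) auto
  have int_pow: "integrable arc_length (\<lambda>z. f z * z ^ n)" "integrable arc_length (\<lambda>z. f z * cnj z ^ n)" for n
    by (rule int[of _ 1]; simp add: norm_power)+
  have poly: "(LINT z|arc_length. f z * poly p z) = 0" "(LINT z|arc_length. f z * cnj (poly p z)) = 0" for p
  proof -
    have "(LINT z|arc_length. f z * poly p z)
        = (LINT z|arc_length. (\<Sum>i\<le>degree p. coeff p i * (f z * z ^ i)))"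
      by (simp add: poly_altdef sum_distrib_left mult_ac)
    also have "\<dots> = (\<Sum>i\<le>degree p. LINT z|arc_length. coeff p i * (f z * z ^ i))"
      by (rule Bochner_Integration.integral_sum) (intro integrable_mult_right int_pow)
    finally show "(LINT z|arc_length. f z * poly p z) = 0"
      by (simp add: pos)
    have "(LINT z|arc_length. f z * cnj (poly p z))
        = (LINT z|arc_length. (\<Sum>i\<le>degree p. cnj (coeff p i) * (f z * cnj z ^ i)))"
      by (simp add: poly_altdef sum_distrib_left mult_ac)
    also have "\<dots> = (\<Sum>i\<le>degree p. LINT z|arc_length. cnj (coeff p i) * (f z * cnj z ^ i))"
      by (rule Bochner_Integration.integral_sum) (intro integrable_mult_right int_pow)
    finally show "(LINT z|arc_length. f z * cnj (poly p z)) = 0"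
      by (simp add: neg)
  qed
  have Re_poly: "(LINT z|arc_length. f z * of_real (Re (poly p z))) = 0" for p
  proof -
    obtain C where C: "\<And>z. cmod z = 1 \<Longrightarrow> cmod (poly p z) \<le> C"
      using poly_bounded_circle by blast
    have Re_eq: "complex_of_real (Re w) = 1/2 * (w + cnj w)" for w
      by (simp add: complex_eq_iff)
    have "(LINT z|arc_length. f z * of_real (Re (poly p z)))
        = (LINT z|arc_length. 1/2 * (f z * poly p z + f z * cnj (poly p z)))"
      unfolding Re_eq by (simp add: algebra_simps)
    also have "\<dots> = 1/2 * ((LINT z|arc_length. f z * poly p z) + (LINT z|arc_length. f z * cnj (poly p z)))"
      by (subst integral_mult_right_zero, subst Bochner_Integration.integral_add)
         (auto intro!: int[of _ C] C)
    finally show ?thesis by (simp add: poly)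
  qed
  have cont: "(LINT z|arc_length. f z * of_real (v z)) = 0" if v: "continuous_on UNIV v" for v :: "complex \<Rightarrow> real"
  proof (rule ccontr)
    assume nz: "(LINT z|arc_length. f z * of_real (v z)) \<noteq> 0"
    \<comment> \<open>Replacing \<open>v\<close> by an approximant within \<open>e\<close> changes
      the integral by at most \<open>e\<close> times the L^1 norm of \<open>f\<close>, which is less
      than the modulus of the integral itself.\<close>
    define e where "e = cmod (LINT z|arc_length. f z * of_real (v z)) / ((LINT z|arc_length. cmod (f z)) + 1)"
    have pos: "(LINT z|arc_length. cmod (f z)) + 1 > 0"
      by (simp add: add_nonneg_pos)
    then have e: "e > 0"
      using nz by (simp add: e_def)
    obtain p where p: "\<And>z. cmod z = 1 \<Longrightarrow> \<bar>v z - Re (poly p z)\<bar> < e"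
      using Re_poly_dense[OF v e] by blast
    obtain C where C: "\<And>z. cmod z = 1 \<Longrightarrow> cmod (poly p z) \<le> C"
      using poly_bounded_circle by blast
    have [measurable]: "v \<in> borel_measurable arc_length"
      using v by (intro borel_measurable_arc_length borel_measurable_continuous_onI)
    have i1: "integrable arc_length (\<lambda>z. f z * of_real (Re (poly p z)))"
      using C abs_Re_le_cmod order_trans by (intro int[of _ C]) (auto, blast)
    have i2: "integrable arc_length (\<lambda>z. f z * of_real (v z - Re (poly p z)))"
      using p less_imp_le by (intro int[of _ e]) (auto simp del: of_real_diff)
    have "f z * of_real (v z) = f z * of_real (Re (poly p z)) + f z * of_real (v z - Re (poly p z))" for z
      by (simp add: algebra_simps)
    then have "(LINT z|arc_length. f z * of_real (v z)) = (LINT z|arc_length. f z * of_real (v z - Re (poly p z)))"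
      by (simp only: Bochner_Integration.integral_add[OF i1 i2] Re_poly add_0_left)
    then have "cmod (LINT z|arc_length. f z * of_real (v z))
        \<le> (LINT z|arc_length. cmod (f z * of_real (v z - Re (poly p z))))"
      by (simp only: integral_norm_bound)
    also have "\<dots> \<le> (LINT z|arc_length. cmod (f z) * e)"
    proof (rule integral_mono)
      show "integrable arc_length (\<lambda>z. cmod (f z * of_real (v z - Re (poly p z))))"
        using i2 by (rule integrable_norm)
      fix z :: complex assume "z \<in> space arc_length"
      then show "cmod (f z * of_real (v z - Re (poly p z))) \<le> cmod (f z) * e"
        using p[of z] by (simp only: norm_mult norm_of_real) (auto intro!: mult_left_mono)
    qed (use f in simp)
    also have "\<dots> = (LINT z|arc_length. cmod (f z)) * e"
      by simp
    also have "\<dots> < ((LINT z|arc_length. cmod (f z)) + 1) * e"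
      using e by simp
    also have "\<dots> = cmod (LINT z|arc_length. f z * of_real (v z))"
      using pos by (simp add: e_def)
    finally show False by simp
  qed
  fix A assume A: "A \<in> sets arc_length"
  have "\<exists>v :: complex \<Rightarrow> real. continuous_on UNIV v \<and> (LINT z|arc_length. \<bar>indicator A z - v z\<bar>) < 1 / Suc n" for n
    using continuous_approx_indicator[OF A, of "1 / Suc n"] by (metis of_nat_0_less_iff zero_less_Suc zero_less_divide_1_iff)
  then obtain v :: "nat \<Rightarrow> complex \<Rightarrow> real" where v: "\<And>n. continuous_on UNIV (v n)"
    "\<And>n. (LINT z|arc_length. \<bar>indicator A z - v n z\<bar>) < 1 / Suc n"
    by metis
  have "integrable arc_length (v n)" for n
    by (rule continuous_integrable_arc_length[OF v(1)])
  moreover have "integrable arc_length (indicat_real A)"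
    using A by (simp add: sets.Int_space_eq2[of _ arc_length, simplified] integrable_indicator_iff
        arc.emeasure_finite less_top[symmetric])
  moreover have "(\<lambda>n. LINT z|arc_length. \<bar>indicator A z - v n z\<bar>) \<longlonglongrightarrow> 0"
    by (rule real_tendsto_sandwich[OF _ _ tendsto_const LIMSEQ_inverse_real_of_nat[unfolded inverse_eq_divide]])
       (use v(2) in \<open>auto intro: less_imp_le always_eventually\<close>)
  ultimately obtain r where r: "strict_mono r" "AE z in arc_length. (\<lambda>n. indicator A z - v (r n) z) \<longlonglongrightarrow> 0"
    using tendsto_L1_AE_subseq[of arc_length "\<lambda>n z. indicator A z - v n z"] by auto
  \<comment> \<open>Clamping to [0, 1] does not disturb the limit, which is an indicator, and lets
    \<open>cmod (f z)\<close> dominate the products.\<close>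
  define w where "w n z = max 0 (min 1 (v (r n) z))" for n z
  have w: "continuous_on UNIV (w n)" "0 \<le> w n z" "w n z \<le> 1" for n z
    unfolding w_def by (auto intro!: continuous_intros v(1))
  have [measurable]: "w n \<in> borel_measurable arc_length" for n
    using w(1) by (intro borel_measurable_arc_length borel_measurable_continuous_onI)
  have "(\<lambda>n. LINT z|arc_length. f z * of_real (w n z)) \<longlonglongrightarrow> (LINT z|arc_length. f z * of_real (indicator A z))"
  proof (rule integral_dominated_convergence[where w="\<lambda>z. cmod (f z)"])
    show "AE z in arc_length. (\<lambda>n. f z * of_real (w n z)) \<longlonglongrightarrow> f z * of_real (indicator A z)"
      using r(2)
    proof eventually_elim
      fix z assume "(\<lambda>n. indicator A z - v (r n) z) \<longlonglongrightarrow> 0"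
      from tendsto_diff[OF tendsto_const[of "indicator A z"] this]
      have "(\<lambda>n. v (r n) z) \<longlonglongrightarrow> indicator A z" by simp
      then have "(\<lambda>n. w n z) \<longlonglongrightarrow> max 0 (min 1 (indicator A z))"
        unfolding w_def by (intro tendsto_intros)
      also have "max 0 (min 1 (indicat_real A z)) = indicator A z"
        by (simp add: indicator_def)
      finally show "(\<lambda>n. f z * of_real (w n z)) \<longlonglongrightarrow> f z * of_real (indicator A z)"
        by (intro tendsto_intros)
    qed
    show "AE z in arc_length. norm (f z * of_real (w n z)) \<le> cmod (f z)" for n
      using w(2,3) by (intro AE_I2) (simp add: norm_mult mult_left_le)
  qed (use f A in auto)
  then have "(LINT z|arc_length. f z * of_real (indicator A z)) = 0"
    by (simp add: cont[OF w(1)] LIMSEQ_const_iff)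
  then show "set_lebesgue_integral arc_length A f = 0"
    by (simp add: set_lebesgue_integral_def scaleR_conv_of_real mult.commute)
qed

section \<open>Polynomials of nonpositive real part and their L^2 limits\<close>

lemma integral_poly_arc_length: "(LINT z|arc_length. poly p z) = coeff p 0"
proof -
  have i: "integrable arc_length (\<lambda>z. z ^ n)" for n :: nat
    by (rule arc.integrable_const_bound[of _ 1]) (auto simp: norm_power)
  have "(LINT z|arc_length. poly p z) = (LINT z|arc_length. (\<Sum>k\<le>degree p. coeff p k * z ^ k))"
    by (simp add: poly_altdef)
  also have "\<dots> = (\<Sum>k\<le>degree p. LINT z|arc_length. coeff p k * z ^ k)"
    by (rule Bochner_Integration.integral_sum) (intro integrable_mult_right i)
  also have "\<dots> = (\<Sum>k\<le>degree p. if k = 0 then coeff p k else 0)"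
    by (intro sum.cong refl) (simp add: integral_power_arc_length)
  finally show ?thesis
    by (simp add: sum.delta)
qed

text \<open>The mean of \<open>(poly p)\<^sup>2\<close> is the square of the real number \<open>coeff p 0\<close>; its real part says that
  the imaginary part of \<open>poly p\<close> has a smaller \<open>L\<^sup>2\<close> norm than its real part.\<close>
lemma sqn_poly_le:
  assumes "Im (coeff p 0) = 0"
  shows "sqn arc_length (poly p) \<le> 2 * (LINT z|arc_length. (Re (poly p z))\<^sup>2)"
proof -
  obtain C where C: "\<And>z. cmod z = 1 \<Longrightarrow> cmod (poly p z) \<le> C"
    using poly_bounded_circle by blast
  have i: "integrable arc_length (\<lambda>z. (g (poly p z))\<^sup>2)"
    if [measurable]: "g \<in> borel_measurable borel" and g: "\<And>w. \<bar>g w\<bar> \<le> cmod w" for g :: "complex \<Rightarrow> real"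
  proof (rule arc.integrable_const_bound[of _ "C\<^sup>2"])
    show "AE z in arc_length. norm ((g (poly p z))\<^sup>2) \<le> C\<^sup>2"
      using AE_arc_length_norm
    proof eventually_elim
      fix z :: complex assume "cmod z = 1"
      then have "\<bar>g (poly p z)\<bar> \<le> C"
        using C[of z] g[of "poly p z"] by linarith
      then show "norm ((g (poly p z))\<^sup>2) \<le> C\<^sup>2"
        using power_mono[of "\<bar>g (poly p z)\<bar>" C 2] by simp
    qed
  qed measurable
  have iR: "integrable arc_length (\<lambda>z. (Re (poly p z))\<^sup>2)" and iI: "integrable arc_length (\<lambda>z. (Im (poly p z))\<^sup>2)"
    by (intro i; simp add: abs_Re_le_cmod abs_Im_le_cmod)+
  have "(LINT z|arc_length. (Re (poly p z))\<^sup>2) - (LINT z|arc_length. (Im (poly p z))\<^sup>2)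
      = (LINT z|arc_length. Re (poly (p * p) z))"
    using iR iI by (subst Bochner_Integration.integral_diff[symmetric]) (auto simp: power2_eq_square)
  also have "\<dots> = Re (LINT z|arc_length. poly (p * p) z)"
  proof (rule integral_Re, rule arc.integrable_const_bound)
    show "AE z in arc_length. norm (poly (p * p) z) \<le> C * C"
      using AE_arc_length_norm by eventually_elim (use C in \<open>auto simp: norm_mult intro!: mult_mono order_trans[OF norm_ge_zero]\<close>)
  qed measurable
  also have "\<dots> = (Re (coeff p 0))\<^sup>2"
    unfolding integral_poly_arc_length using assms by (simp add: coeff_mult power2_eq_square)
  finally have "(LINT z|arc_length. (Im (poly p z))\<^sup>2) \<le> (LINT z|arc_length. (Re (poly p z))\<^sup>2)"
    using zero_le_power2[of "Re (coeff p 0)"] by linarith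
  moreover have "sqn arc_length (poly p) = (LINT z|arc_length. (Re (poly p z))\<^sup>2) + (LINT z|arc_length. (Im (poly p z))\<^sup>2)"
    unfolding sqn_def cmod_power2 using iR iI by simp
  ultimately show ?thesis by simp
qed

lemma bounded_L2:
  assumes "f \<in> borel_measurable arc_length" "AE z in arc_length. cmod (f z) \<le> C"
  shows "f \<in> L2 arc_length"
proof -
  have "AE z in arc_length. cmod (f z) \<le> cmod (of_real C)"
    using assms(2) by eventually_elim simp
  moreover have "(\<lambda>z. of_real C) \<in> L2 arc_length"
    by (simp add: L2_def)
  ultimately show ?thesis
    using sqn_mono(1) assms(1) by blast
qed

lemma poly_L2 [simp]: "poly p \<in> L2 arc_length"
  and Re_poly_L2 [simp]: "(\<lambda>z. complex_of_real (Re (poly p z))) \<in> L2 arc_length"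
proof -
  obtain C where C: "\<And>z. cmod z = 1 \<Longrightarrow> cmod (poly p z) \<le> C"
    using poly_bounded_circle by blast
  then show p: "poly p \<in> L2 arc_length"
    by (intro bounded_L2[of _ C] AE_I2) auto
  show "(\<lambda>z. complex_of_real (Re (poly p z))) \<in> L2 arc_length"
    by (rule sqn_mono(1)[OF p]) (auto simp: abs_Re_le_cmod)
qed

text \<open>An L^1 approximation by a continuous \<open>v\<close> suffices: after clamping to
  [-N, 0] all functions involved are bounded, so squared distances are controlled by
  \<open>N + 2\<close> times plain distances. The clamped function is lowered by \<open>d\<close>
  before it is approximated within \<open>d\<close>, which keeps the polynomial's real part
  nonpositive.\<close>

lemma nonpos_Re_poly_approx_bounded:
  fixes u :: "complex \<Rightarrow> real"
  assumes [measurable]: "u \<in> borel_measurable arc_length" and u: "\<And>z. u z \<le> 0" "\<And>z. - N \<le> u z"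
    and e: "e > 0"
  obtains p where "Im (coeff p 0) = 0" "\<And>z. cmod z = 1 \<Longrightarrow> Re (poly p z) \<le> 0"
    "sqn arc_length (\<lambda>z. complex_of_real (u z) - complex_of_real (Re (poly p z))) < e"
proof -
  have N: "N \<ge> 0"
    using u(1)[of 0] u(2)[of 0] by linarith
  have uN: "\<bar>u z\<bar> \<le> N" for z
    using u(1)[of z] u(2)[of z] by linarith
  \<comment> \<open>The final bound is \<open>(N + 2) * (d + 2 * d)\<close>: one \<open>d\<close>
    from the L^1 approximation and two from lowering and uniform approximation. \<open>d\<close> at
    most 1 gives the pointwise bound \<open>N + 2\<close>.\<close>
  define d where "d = min 1 (e / (4 * (N + 2)))"
  have d: "0 < d" "d \<le> 1" "4 * (N + 2) * d \<le> e"
  proof -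
    show "0 < d" "d \<le> 1"
      using e N by (auto simp: d_def)
    have "4 * (N + 2) * d \<le> 4 * (N + 2) * (e / (4 * (N + 2)))"
      using N by (intro mult_left_mono) (auto simp: d_def)
    then show "4 * (N + 2) * d \<le> e"
      using N by simp
  qed
  have ui: "integrable arc_length u"
    using uN by (intro arc.integrable_const_bound[of _ N] AE_I2) auto
  obtain v :: "complex \<Rightarrow> real" where v: "continuous_on UNIV v" "(LINT z|arc_length. \<bar>u z - v z\<bar>) < d"
    using continuous_dense_L1[OF ui d(1)] by blast
  define w where "w z = max (- N) (min 0 (v z))" for z
  have w: "continuous_on UNIV w" "\<And>z. w z \<le> 0" "\<And>z. - N \<le> w z"
    using N unfolding w_def by (auto intro!: continuous_intros v(1))
  have wv: "\<bar>u z - w z\<bar> \<le> \<bar>u z - v z\<bar>" for z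
    using u[of z] by (auto simp: w_def max_def min_def)
  have "continuous_on UNIV (\<lambda>z. w z - d)"
    by (intro continuous_intros w(1))
  then obtain q where q: "\<And>z. cmod z = 1 \<Longrightarrow> \<bar>w z - d - Re (poly q z)\<bar> < d"
    using Re_poly_dense[OF _ d(1)] by blast
  \<comment> \<open>Subtracting an imaginary constant leaves the real part alone and makes the
    constant coefficient real, as \<open>sqn_poly_le\<close> demands.\<close>
  define p where "p = q - [:\<i> * of_real (Im (coeff q 0)):]"
  have Re_p: "Re (poly p z) = Re (poly q z)" for z
    by (simp add: p_def)
  have [measurable]: "v \<in> borel_measurable arc_length"
    using v(1) by (intro borel_measurable_arc_length borel_measurable_continuous_onI)
  have vi: "integrable arc_length v"
    by (rule continuous_integrable_arc_length[OF v(1)])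
  have uL: "(\<lambda>z. complex_of_real (u z)) \<in> L2 arc_length"
    using uN by (intro bounded_L2[of _ N] AE_I2) auto
  show thesis
  proof (rule that[of p])
    show "Im (coeff p 0) = 0"
      by (simp add: p_def)
    show "Re (poly p z) \<le> 0" if "cmod z = 1" for z
      using q[OF that] w(2)[of z] by (simp add: Re_p)
    have "sqn arc_length (\<lambda>z. complex_of_real (u z) - complex_of_real (Re (poly p z)))
        \<le> (LINT z|arc_length. (N + 2) * (\<bar>u z - v z\<bar> + 2 * d))"
      unfolding sqn_def
    proof (rule integral_mono)
      show "integrable arc_length (\<lambda>z. (cmod (complex_of_real (u z) - complex_of_real (Re (poly p z))))\<^sup>2)"
        by (rule L2_integrable[OF L2_diff[OF uL Re_poly_L2]])
      show "integrable arc_length (\<lambda>z. (N + 2) * (\<bar>u z - v z\<bar> + 2 * d))"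
        using ui vi by simp
      fix z :: complex assume "z \<in> space arc_length"
      then have z: "cmod z = 1" by simp
      define a where "a = \<bar>u z - Re (poly p z)\<bar>"
      have 1: "a \<le> \<bar>u z - v z\<bar> + 2 * d"
        using q[OF z] wv[of z] by (simp add: Re_p a_def)
      have 2: "a \<le> N + 2"
        using q[OF z] u[of z] w(2,3)[of z] d(2) by (simp add: Re_p a_def)
      have "(cmod (complex_of_real (u z) - complex_of_real (Re (poly p z))))\<^sup>2 = a * a"
        by (simp add: a_def power2_eq_square norm_of_real flip: of_real_diff)
      also have "\<dots> \<le> (N + 2) * (\<bar>u z - v z\<bar> + 2 * d)"
        using 1 2 N by (intro mult_mono) (auto simp: a_def)
      finally show "(cmod (complex_of_real (u z) - complex_of_real (Re (poly p z))))\<^sup>2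
          \<le> (N + 2) * (\<bar>u z - v z\<bar> + 2 * d)" .
    qed
    also have "\<dots> = (N + 2) * ((LINT z|arc_length. \<bar>u z - v z\<bar>) + 2 * d)"
      using ui vi by simp
    also have "\<dots> < (N + 2) * (d + 2 * d)"
      using v(2) N by (intro mult_strict_left_mono) auto
    also have "\<dots> \<le> 4 * (N + 2) * d"
      using N d(1) by (simp add: field_simps)
    also have "\<dots> \<le> e"
      by (rule d(3))
    finally show "sqn arc_length (\<lambda>z. complex_of_real (u z) - complex_of_real (Re (poly p z))) < e" .
  qed
qed

lemma nonpos_Re_poly_approx:
  fixes u :: "complex \<Rightarrow> real"
  assumes uL: "(\<lambda>z. complex_of_real (u z)) \<in> L2 arc_length" and u: "\<And>z. u z \<le> 0" and e: "e > 0"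
  obtains p where "Im (coeff p 0) = 0" "\<And>z. cmod z = 1 \<Longrightarrow> Re (poly p z) \<le> 0"
    "sqn arc_length (\<lambda>z. complex_of_real (u z) - complex_of_real (Re (poly p z))) < e"
proof -
  have "(\<lambda>z. Re (complex_of_real (u z))) \<in> borel_measurable arc_length"
    using L2_measurable[OF uL] by measurable
  then have [measurable]: "u \<in> borel_measurable arc_length" by simp
  define t where "t n z = max (u z) (- real n)" for n z
  have [measurable]: "t n \<in> borel_measurable arc_length" for n
    unfolding t_def by measurable
  have t: "t n z \<le> 0" "- real n \<le> t n z" "\<bar>t n z\<bar> \<le> \<bar>u z\<bar>" "\<bar>u z - t n z\<bar> \<le> \<bar>u z\<bar>" for n z
    using u[of z] by (auto simp: t_def)
  have tL: "(\<lambda>z. complex_of_real (t n z)) \<in> L2 arc_length" for n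
    by (rule sqn_mono(1)[OF uL]) (use t in auto)
  have "(\<lambda>n. sqn arc_length (\<lambda>z. complex_of_real (u z) - complex_of_real (t n z))) \<longlonglongrightarrow> (LINT z|arc_length. 0)"
    unfolding sqn_def
  proof (rule integral_dominated_convergence[where w="\<lambda>z. (cmod (complex_of_real (u z)))\<^sup>2"])
    show "AE z in arc_length. (\<lambda>n. (cmod (complex_of_real (u z) - complex_of_real (t n z)))\<^sup>2) \<longlonglongrightarrow> 0"
    proof (rule AE_I2, rule tendsto_eventually)
      fix z
      obtain n where "- u z \<le> real n"
        using real_arch_simple by blast
      then show "\<forall>\<^sub>F n in sequentially. (cmod (complex_of_real (u z) - complex_of_real (t n z)))\<^sup>2 = 0"
        by (intro eventually_mono[OF eventually_ge_at_top[of n]]) (auto simp: t_def max_def)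
    qed
    show "AE z in arc_length. norm ((cmod (complex_of_real (u z) - complex_of_real (t n z)))\<^sup>2)
        \<le> (cmod (complex_of_real (u z)))\<^sup>2" for n
      using t(4) by (intro AE_I2) (simp add: abs_le_square_iff flip: of_real_diff)
  qed (use L2_integrable[OF uL] in auto)
  then have "\<forall>\<^sub>F n in sequentially. sqn arc_length (\<lambda>z. complex_of_real (u z) - complex_of_real (t n z)) < e / 4"
    using e by (intro order_tendstoD(2)) auto
  then obtain n where n: "sqn arc_length (\<lambda>z. complex_of_real (u z) - complex_of_real (t n z)) < e / 4"
    using eventually_happens' sequentially_bot by blast
  obtain p where p: "Im (coeff p 0) = 0" "\<And>z. cmod z = 1 \<Longrightarrow> Re (poly p z) \<le> 0"
    "sqn arc_length (\<lambda>z. complex_of_real (t n z) - complex_of_real (Re (poly p z))) < e / 4"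
    using nonpos_Re_poly_approx_bounded[of "t n" "real n" "e / 4"] t e by auto
  have "sqn arc_length (\<lambda>z. complex_of_real (u z) - complex_of_real (Re (poly p z))) < e"
    using sqn_triangle[OF uL tL[of n] Re_poly_L2[of p]] n p(3) by linarith
  with p that show thesis by blast
qed

text \<open>The harmonic completion of \<open>u\<close>: \<open>exp \<circ> k\<close> is the outer function of modulus \<open>exp \<circ> u\<close>.\<close>
lemma outer_exponent:
  fixes u :: "complex \<Rightarrow> real"
  assumes uL: "(\<lambda>z. complex_of_real (u z)) \<in> L2 arc_length" and u: "\<And>z. u z \<le> 0"
  obtains k p where "k \<in> L2 arc_length" "AE z in arc_length. Re (k z) = u z"
    "sqn arc_length k \<le> 8 * sqn arc_length (\<lambda>z. complex_of_real (u z))"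
    "\<And>n z. cmod z = 1 \<Longrightarrow> Re (poly (p n) z) \<le> 0"
    "AE z in arc_length. (\<lambda>n. poly (p n) z) \<longlonglongrightarrow> k z"
proof -
  define U where "U z = complex_of_real (u z)" for z
  define R where "R p z = complex_of_real (Re (poly p z))" for p :: "complex poly" and z
  have RL: "R p \<in> L2 arc_length" for p
    unfolding R_def by simp
  have UL: "U \<in> L2 arc_length"
    unfolding U_def by (rule uL)
  have R_diff: "R (p - q) = (\<lambda>z. R p z - R q z)" for p q
    by (simp add: R_def fun_eq_iff)
  have sqn_R: "sqn arc_length (poly p) \<le> 2 * sqn arc_length (R p)" if "Im (coeff p 0) = 0" for p
    using sqn_poly_le[OF that] by (simp add: sqn_def R_def)
  have "\<exists>p. Im (coeff p 0) = 0 \<and> (\<forall>z. cmod z = 1 \<longrightarrow> Re (poly p z) \<le> 0) \<and>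
      sqn arc_length (\<lambda>z. U z - R p z) < 1 / Suc n" for n
    using nonpos_Re_poly_approx[OF uL u, of "1 / Suc n"] unfolding U_def R_def
    by (metis of_nat_0_less_iff zero_less_Suc zero_less_divide_1_iff)
  then obtain p where p: "\<And>n. Im (coeff (p n) 0) = 0" "\<And>n z. cmod z = 1 \<Longrightarrow> Re (poly (p n) z) \<le> 0"
    "\<And>n. sqn arc_length (\<lambda>z. U z - R (p n) z) < 1 / Suc n"
    by metis
  \<comment> \<open>By \<open>sqn_R\<close> the real parts control the whole polynomials, so
    convergence of the real parts to \<open>U\<close> already makes the polynomials Cauchy.\<close>
  have diff: "sqn arc_length (\<lambda>z. poly (p m) z - poly (p n) z) \<le> 4 / Suc m + 4 / Suc n" for m n
  proof -
    have "sqn arc_length (\<lambda>z. poly (p m) z - poly (p n) z) = sqn arc_length (poly (p m - p n))"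
      by (simp add: sqn_def)
    also have "\<dots> \<le> 2 * sqn arc_length (R (p m - p n))"
      by (rule sqn_R) (simp add: p)
    also have "\<dots> \<le> 2 * (2 * sqn arc_length (\<lambda>z. R (p m) z - U z) + 2 * sqn arc_length (\<lambda>z. U z - R (p n) z))"
      unfolding R_diff by (intro mult_left_mono sqn_triangle RL UL) simp
    also have "\<dots> \<le> 2 * (2 * (1 / Suc m) + 2 * (1 / Suc n))"
      using p(3)[of m] p(3)[of n] by (simp add: sqn_minus_commute[of _ U])
    finally show ?thesis by simp
  qed
  have cauchy: "\<exists>N. \<forall>m\<ge>N. \<forall>n\<ge>N. sqn arc_length (\<lambda>z. poly (p m) z - poly (p n) z) < e" if e: "e > 0" for e
  proof -
    obtain N where N: "8 / Suc N < e"
      using reals_Archimedean[of "e / 8"] e by (auto simp: field_simps)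
    have "sqn arc_length (\<lambda>z. poly (p m) z - poly (p n) z) < e" if "m \<ge> N" "n \<ge> N" for m n
    proof -
      have "sqn arc_length (\<lambda>z. poly (p m) z - poly (p n) z) \<le> 4 / Suc m + 4 / Suc n"
        by (rule diff)
      also have "\<dots> \<le> 4 / Suc N + 4 / Suc N"
        using that by (intro add_mono divide_left_mono) auto
      finally show ?thesis using N by simp
    qed
    then show ?thesis by blast
  qed
  obtain k where kL: "k \<in> L2 arc_length" and k: "(\<lambda>n. sqn arc_length (\<lambda>z. poly (p n) z - k z)) \<longlonglongrightarrow> 0"
    using arc.L2_complete[of "\<lambda>n. poly (p n)"] cauchy by auto
  have inv0: "(\<lambda>n. 1 / real (Suc n)) \<longlonglongrightarrow> 0"
    using LIMSEQ_inverse_real_of_nat by (simp add: inverse_eq_divide)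
  define Rk where "Rk z = complex_of_real (Re (k z))" for z
  have RkL: "Rk \<in> L2 arc_length"
    unfolding Rk_def by (rule sqn_mono(1)[OF kL]) (use L2_measurable[OF kL] in \<open>auto simp: abs_Re_le_cmod\<close>)
  have "sqn arc_length (\<lambda>z. U z - Rk z) \<le> 0"
  proof (rule LIMSEQ_le_const)
    show "(\<lambda>n. 2 * (1 / Suc n) + 2 * sqn arc_length (\<lambda>z. poly (p n) z - k z)) \<longlonglongrightarrow> 0"
      using tendsto_add[OF tendsto_mult_left[OF inv0, of 2] tendsto_mult_left[OF k, of 2]] by simp
    have "sqn arc_length (\<lambda>z. U z - Rk z) \<le> 2 * (1 / Suc n) + 2 * sqn arc_length (\<lambda>z. poly (p n) z - k z)" for n
    proof -
      have "sqn arc_length (\<lambda>z. R (p n) z - Rk z) \<le> sqn arc_length (\<lambda>z. poly (p n) z - k z)"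
      proof (rule sqn_mono(2))
        show "AE z in arc_length. cmod (R (p n) z - Rk z) \<le> cmod (poly (p n) z - k z)"
        proof (rule AE_I2)
          fix z
          show "cmod (R (p n) z - Rk z) \<le> cmod (poly (p n) z - k z)"
            using abs_Re_le_cmod[of "poly (p n) z - k z"] by (simp add: R_def Rk_def flip: of_real_diff)
        qed
      qed (use L2_diff[OF poly_L2 kL] L2_measurable[OF L2_diff[OF RL RkL]] in auto)
      then show ?thesis
        using sqn_triangle[OF UL RL[of "p n"] RkL] p(3)[of n] by linarith
    qed
    then show "\<exists>N. \<forall>n\<ge>N. sqn arc_length (\<lambda>z. U z - Rk z)
        \<le> 2 * (1 / Suc n) + 2 * sqn arc_length (\<lambda>z. poly (p n) z - k z)"
      by blast
  qed
  then have "sqn arc_length (\<lambda>z. U z - Rk z) = 0"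
    using sqn_nonneg by (rule antisym)
  then have "AE z in arc_length. U z - Rk z = 0"
    using sqn_zero_iff[OF L2_diff[OF UL RkL]] by simp
  then have Re_k: "AE z in arc_length. Re (k z) = u z"
    by eventually_elim (simp add: U_def Rk_def)
  \<comment> \<open>The 8 is a product of three factors 2: two triangle inequalities for squared
    norms, and \<open>sqn_R\<close> between them.\<close>
  have "sqn arc_length k \<le> 8 * sqn arc_length U"
  proof (rule LIMSEQ_le_const)
    show "(\<lambda>n. 2 * sqn arc_length (\<lambda>z. poly (p n) z - k z) + 8 * (1 / Suc n) + 8 * sqn arc_length U)
        \<longlonglongrightarrow> 8 * sqn arc_length U"
      using tendsto_add[OF tendsto_add[OF tendsto_mult_left[OF k, of 2] tendsto_mult_left[OF inv0, of 8]]
          tendsto_const[of "8 * sqn arc_length U"]] by simp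
    have "sqn arc_length k \<le> 2 * sqn arc_length (\<lambda>z. poly (p n) z - k z) + 8 * (1 / Suc n) + 8 * sqn arc_length U" for n
    proof -
      have zero: "(\<lambda>z. 0) \<in> L2 arc_length"
        by (simp add: L2_def)
      have "sqn arc_length k \<le> 2 * sqn arc_length (\<lambda>z. poly (p n) z - k z) + 2 * sqn arc_length (poly (p n))"
        using sqn_triangle[OF kL poly_L2[of "p n"] zero] by (simp add: sqn_minus_commute[of _ k])
      moreover have "sqn arc_length (poly (p n)) \<le> 2 * sqn arc_length (R (p n))"
        by (rule sqn_R[OF p(1)])
      moreover have "sqn arc_length (R (p n)) \<le> 2 * sqn arc_length (\<lambda>z. U z - R (p n) z) + 2 * sqn arc_length U"
        using sqn_triangle[OF RL[of "p n"] UL zero] by (simp add: sqn_minus_commute[of _ U])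
      ultimately show ?thesis
        using p(3)[of n] by linarith
    qed
    then show "\<exists>N. \<forall>n\<ge>N. sqn arc_length k \<le> 2 * sqn arc_length (\<lambda>z. poly (p n) z - k z) + 8 * (1 / Suc n) + 8 * sqn arc_length U"
      by blast
  qed
  moreover obtain r where "strict_mono r" "AE z in arc_length. (\<lambda>n. poly (p (r n)) z) \<longlonglongrightarrow> k z"
    using L2_tendsto_AE_subseq[OF poly_L2 kL k] by blast
  ultimately show thesis
    using that[of k "\<lambda>n. p (r n)"] kL Re_k p(2) by (simp add: U_def[abs_def])
qed

section \<open>Weak topologies and shift-invariant subspaces\<close>

lemma L_infinityI:
  "f \<in> borel_measurable arc_length \<Longrightarrow> AE z in arc_length. cmod (f z) \<le> C \<Longrightarrow> f \<in> L_infinity"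
  by (auto simp: L_infinity_def)

lemma L_infinity_measurable: "f \<in> L_infinity \<Longrightarrow> f \<in> borel_measurable arc_length"
  by (simp add: L_infinity_def)

lemma L_infinity_L2: "L_infinity \<subseteq> L2 arc_length"
  by (auto simp: L_infinity_def intro: bounded_L2)

lemma L_infinity_bounded_mult:
  assumes "f \<in> L_infinity" and h: "h \<in> borel_measurable arc_length" "AE z in arc_length. cmod (h z) \<le> B"
  shows "(\<lambda>z. h z * f z) \<in> L_infinity"
proof -
  obtain C where f: "f \<in> borel_measurable arc_length" "AE z in arc_length. cmod (f z) \<le> C"
    using assms(1) by (auto simp: L_infinity_def)
  have "AE z in arc_length. cmod (h z * f z) \<le> B * C"
    using h(2) f(2)
  proof eventually_elim
    fix z assume "cmod (h z) \<le> B" "cmod (f z) \<le> C"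
    then show "cmod (h z * f z) \<le> B * C"
      unfolding norm_mult using norm_ge_zero[of "h z"]
      by (intro mult_mono) (auto intro: order_trans[OF norm_ge_zero])
  qed
  then show ?thesis
    using f(1) h(1) by (intro L_infinityI) auto
qed

lemma linear_subspace_Int_L_infinity:
  assumes "linear_subspace W" shows "linear_subspace (W \<inter> L_infinity)"
proof -
  have "(\<lambda>z. f z + g z) \<in> L_infinity" if f: "f \<in> L_infinity" and g: "g \<in> L_infinity" for f g
  proof -
    obtain C where C: "AE z in arc_length. cmod (f z) \<le> C"
      using f by (auto simp: L_infinity_def)
    obtain D where D: "AE z in arc_length. cmod (g z) \<le> D"
      using g by (auto simp: L_infinity_def)
    show ?thesis
      using C D f g
      by (intro L_infinityI[of _ "C + D"]) (auto simp: L_infinity_def elim!: eventually_elim2 intro: norm_triangle_mono)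
  qed
  moreover have "(\<lambda>z. c * f z) \<in> L_infinity" if "f \<in> L_infinity" for c f
    using that by (rule L_infinity_bounded_mult[where h="\<lambda>z. c" and B="cmod c"]) auto
  ultimately show ?thesis
    using assms by (auto simp: linear_subspace_def intro: L_infinityI[of _ 0])
qed

section \<open>Weak topologies generated by a pairing\<close>

lemma topspace_weak_topology [simp]: "topspace (weak_topology X Z) = X"
  unfolding weak_topology_def topology_generated_by_topspace by auto

lemma openin_weak_topology:
  "g \<in> Z \<Longrightarrow> open U \<Longrightarrow> openin (weak_topology X Z) {f \<in> X. (LINT z|arc_length. f z * g z) \<in> U}"
  unfolding weak_topology_def by (rule topology_generated_by_Basis) auto

text \<open>By induction on how an open set is generated, every open neighbourhood of
  \<open>g\<close> contains almost all \<open>f n\<close>. Only this direction is available in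
  general, as a weak topology need not be determined by its sequences.\<close>

lemma weak_topology_seq_closed:
  assumes C: "closedin (weak_topology X Z) C" and f: "\<And>n. f n \<in> C" and g: "g \<in> X"
    and lim: "\<And>h. h \<in> Z \<Longrightarrow>
      (\<lambda>n. LINT z|arc_length. f n z * h z) \<longlonglongrightarrow> (LINT z|arc_length. g z * h z)"
  shows "g \<in> C"
proof (rule ccontr)
  assume "g \<notin> C"
  have fX: "f n \<in> X" for n
    using closedin_subset[OF C] f by auto
  have ev: "\<forall>\<^sub>F n in sequentially. f n \<in> U"
    if "generate_topology_on (insert X {{f \<in> X. (LINT z|arc_length. f z * h z) \<in> U} |h U. h \<in> Z \<and> open U}) U"
      "g \<in> U" for U
    using that
  proof induction
    case (Int a b)
    then show ?case by (auto intro: eventually_conj)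
  next
    case (UN K)
    then obtain k where k: "k \<in> K" "g \<in> k" by blast
    show ?case
      by (rule eventually_mono[OF UN.IH[OF k]]) (use k in blast)
  next
    case (Basis s)
    then consider "s = X" | h U where "h \<in> Z" "open U" "s = {f \<in> X. (LINT z|arc_length. f z * h z) \<in> U}"
      by auto
    then show ?case
    proof cases
      case 2
      then have "\<forall>\<^sub>F n in sequentially. (LINT z|arc_length. f n z * h z) \<in> U"
        using Basis(2) by (intro topological_tendstoD[OF lim]) auto
      then show ?thesis
        by (rule eventually_mono) (use fX 2 in auto)
    qed (simp add: fX)
  qed simp
  have "openin (weak_topology X Z) (X - C)"
    using C by (simp add: closedin_def)
  then have "\<forall>\<^sub>F n in sequentially. f n \<in> X - C"
    unfolding weak_topology_def
    by (intro ev openin_topology_generated_by) (use g \<open>g \<notin> C\<close> in auto)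
  then show False
    using f by simp
qed

text \<open>Multiplication is its own transpose for the pairing: the preimage of the subbasic set of
  \<open>g\<close> is the subbasic set of \<open>\<phi> * g\<close>. Two dual spaces occur because
  \<open>H\<close> is a closure for \<open>Y\<close> while \<open>W\<close> is closed for
  \<open>Z\<close>.\<close>

lemma continuous_map_weak_topology_mult:
  assumes X: "\<And>f. f \<in> X \<Longrightarrow> (\<lambda>z. \<phi> z * f z) \<in> X"
    and Z: "\<And>g. g \<in> Z \<Longrightarrow> (\<lambda>z. \<phi> z * g z) \<in> Y"
  shows "continuous_map (weak_topology X Y) (weak_topology X Z) (\<lambda>f z. \<phi> z * f z)"
  unfolding weak_topology_def[of X Z]
proof (rule continuous_on_generated_topo)
  let ?m = "\<lambda>f z. \<phi> z * f z"
  fix U assume "U \<in> insert X {{f \<in> X. (LINT z|arc_length. f z * g z) \<in> U} |g U. g \<in> Z \<and> open U}"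
  then consider "U = X" | g V where "g \<in> Z" "open V" "U = {f \<in> X. (LINT z|arc_length. f z * g z) \<in> V}"
    by auto
  then show "openin (weak_topology X Y) (?m -` U \<inter> topspace (weak_topology X Y))"
  proof cases
    case 1
    then have "?m -` U \<inter> topspace (weak_topology X Y) = topspace (weak_topology X Y)"
      using X by auto
    then show ?thesis by (simp only: openin_topspace)
  next
    case 2
    have "?m -` U \<inter> topspace (weak_topology X Y)
        = {f \<in> X. (LINT z|arc_length. f z * (\<phi> z * g z)) \<in> V}"
      using X 2 by (auto simp: mult_ac)
    also have "openin (weak_topology X Y) \<dots>"
      by (rule openin_weak_topology[OF Z[OF 2(1)] 2(2)])
    finally show ?thesis .
  qed
qed (use X in auto)

text \<open>To be read with \<open>X = L\<^sup>\<alpha>\<close>, \<open>Y = \<L>\<^sup>\<alpha>'\<close> and \<open>Z = L\<^sup>\<alpha>'\<close>: nothing else about the norm enters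
  Beurling's argument.\<close>
locale solid_dual_pair =
  fixes X Y Z :: "(complex \<Rightarrow> complex) set"
  assumes X_measurable: "X \<subseteq> borel_measurable arc_length"
    and Y_measurable: "Y \<subseteq> borel_measurable arc_length"
    and X_solid: "\<And>f g. f \<in> X \<Longrightarrow> g \<in> borel_measurable arc_length \<Longrightarrow>
      (AE z in arc_length. cmod (g z) \<le> cmod (f z)) \<Longrightarrow> g \<in> X"
    and Y_solid: "\<And>f g. f \<in> Y \<Longrightarrow> g \<in> borel_measurable arc_length \<Longrightarrow>
      (AE z in arc_length. cmod (g z) \<le> cmod (f z)) \<Longrightarrow> g \<in> Y"
    and L_infinity_X: "L_infinity \<subseteq> X"
    and L_infinity_Y: "L_infinity \<subseteq> Y"
    and Z_Y: "Z \<subseteq> Y"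
    and pairing: "\<And>f g. f \<in> X \<Longrightarrow> g \<in> Y \<Longrightarrow> integrable arc_length (\<lambda>z. f z * g z)"
begin

definition H :: "(complex \<Rightarrow> complex) set" where
  "H = weak_topology X Y closure_of H_infinity"

lemma X_mult:
  assumes "f \<in> X" "h \<in> borel_measurable arc_length" "AE z in arc_length. cmod (h z) \<le> 1"
  shows "(\<lambda>z. h z * f z) \<in> X"
proof (rule X_solid[OF assms(1)])
  show "AE z in arc_length. cmod (h z * f z) \<le> cmod (f z)"
    using assms(3) by eventually_elim (simp add: norm_mult mult_left_le_one_le)
qed (use assms X_measurable in auto)

lemma Y_mult:
  assumes "f \<in> Y" "h \<in> borel_measurable arc_length" "AE z in arc_length. cmod (h z) \<le> 1"
  shows "(\<lambda>z. h z * f z) \<in> Y"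
proof (rule Y_solid[OF assms(1)])
  show "AE z in arc_length. cmod (h z * f z) \<le> cmod (f z)"
    using assms(3) by eventually_elim (simp add: norm_mult mult_left_le_one_le)
qed (use assms Y_measurable in auto)

lemma X_integrable: "f \<in> X \<Longrightarrow> integrable arc_length f"
  using pairing[of f "\<lambda>z. 1"] L_infinity_Y L_infinityI[of "\<lambda>z. 1" 1] by auto

lemma H_infinity_H: "H_infinity \<subseteq> H"
  unfolding H_def using L_infinity_X by (intro closure_of_subset) (auto simp: H_infinity_def)

text \<open>A negative coefficient is the pairing with a bounded function, hence a weakly continuous
  functional, and its kernel contains \<open>H_infinity\<close>.\<close>

lemma H_fourier_coeff:
  assumes "f \<in> H" "k < 0" shows "fourier_coeff f k = 0"
proof -
  have pow: "(\<lambda>z. z powi (- k)) \<in> Y"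
  proof -
    have "(\<lambda>z. z ^ nat (- k)) \<in> L_infinity"
      by (rule L_infinityI[of _ 1]) (auto simp: norm_power)
    moreover have "(\<lambda>z. z powi (- k)) = (\<lambda>z::complex. z ^ nat (- k))"
      using assms(2) by (simp add: power_int_def)
    ultimately show ?thesis
      using L_infinity_Y by auto
  qed
  have "closedin (weak_topology X Y) {f \<in> X. fourier_coeff f k = 0}"
    unfolding closedin_def
  proof (intro conjI)
    have "topspace (weak_topology X Y) - {f \<in> X. fourier_coeff f k = 0}
        = {f \<in> X. (LINT z|arc_length. f z * z powi (- k)) \<in> - {0}}"
      by (auto simp: fourier_coeff_def)
    also have "openin (weak_topology X Y) \<dots>"
      by (rule openin_weak_topology[OF pow]) auto
    finally show "openin (weak_topology X Y) (topspace (weak_topology X Y) - {f \<in> X. fourier_coeff f k = 0})" .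
  qed auto
  then have "H \<subseteq> {f \<in> X. fourier_coeff f k = 0}"
    unfolding H_def
    by (intro closure_of_minimal) (use assms L_infinity_X in \<open>auto simp: H_infinity_def\<close>)
  with assms(1) show ?thesis by blast
qed

text \<open>Multiplication by \<open>z\<close> is weakly continuous and moves each Fourier
  coefficient up by one place, so it preserves \<open>H_infinity\<close> and then its closure. This
  serves the converse half of the classification.\<close>

lemma H_mult_ident:
  assumes "f \<in> H" shows "(\<lambda>z. z * f z) \<in> H"
proof -
  have "continuous_map (weak_topology X Y) (weak_topology X Y) (\<lambda>f z. z * f z)"
    by (intro continuous_map_weak_topology_mult X_mult Y_mult) auto
  then have "(\<lambda>f z. z * f z) ` (weak_topology X Y closure_of H_infinity)
      \<subseteq> weak_topology X Y closure_of ((\<lambda>f z. z * f z) ` H_infinity)"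
    by (rule continuous_map_image_closure_subset)
  also have "(\<lambda>f z. z * f z) ` H_infinity \<subseteq> H_infinity"
  proof safe
    fix f assume f: "f \<in> H_infinity"
    have "fourier_coeff (\<lambda>z. z * f z) k = fourier_coeff f (k - 1)" for k
      unfolding fourier_coeff_def
    proof (rule integral_cong_AE)
      have [measurable]: "f \<in> borel_measurable arc_length"
        using f by (auto simp: H_infinity_def L_infinity_def)
      have m: "(\<lambda>z. z powi j) \<in> borel_measurable arc_length" for j :: int
        by (intro borel_measurable_continuous_arc_length continuous_on_power_int continuous_intros) auto
      show "(\<lambda>z. z * f z * z powi - k) \<in> borel_measurable arc_length"
        "(\<lambda>z. f z * z powi - (k - 1)) \<in> borel_measurable arc_length"
        using m by measurable
      show "AE z in arc_length. z * f z * z powi - k = f z * z powi - (k - 1)"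
        using AE_arc_length_norm
      proof eventually_elim
        fix z :: complex assume "cmod z = 1"
        then have "z \<noteq> 0" by auto
        then show "z * f z * z powi - k = f z * z powi - (k - 1)"
          using power_int_add[of z "- k" 1] by simp
      qed
    qed
    then show "(\<lambda>z. z * f z) \<in> H_infinity"
      using f L_infinity_bounded_mult[of f "\<lambda>z. z" 1] AE_I2[of arc_length "\<lambda>z. cmod z \<le> 1"]
      by (auto simp: H_infinity_def)
  qed
  then have "weak_topology X Y closure_of ((\<lambda>f z. z * f z) ` H_infinity) \<subseteq> weak_topology X Y closure_of H_infinity"
    by (rule closure_of_mono)
  finally show ?thesis
    using assms by (auto simp: H_def)
qed

end

text \<open>\<open>W\<close> is closed for the topology of the smaller space \<open>Z\<close>, which
  is the coarser of the two, so it is closed for that of \<open>Y\<close> as well.\<close>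

locale shift_invariant = solid_dual_pair +
  fixes W :: "(complex \<Rightarrow> complex) set"
  assumes W_X: "W \<subseteq> X"
    and W_linear: "linear_subspace W"
    and W_closed: "closedin (weak_topology X Z) W"
    and W_shift: "\<And>f. f \<in> W \<Longrightarrow> (\<lambda>z. z * f z) \<in> W"
begin

text \<open>For \<open>h\<close> in \<open>Z\<close> the product \<open>F * h\<close> is integrable,
  so dominated convergence applies to every pairing. Most appeals to weak closedness go through this
  form.\<close>

lemma W_limit:
  assumes f: "\<And>n. f n \<in> W" and F: "F \<in> X" and g: "g \<in> X"
    and bound: "\<And>n. AE z in arc_length. cmod (f n z) \<le> C * cmod (F z)"
    and lim: "AE z in arc_length. (\<lambda>n. f n z) \<longlonglongrightarrow> g z"
  shows "g \<in> W"
proof (rule weak_topology_seq_closed[OF W_closed f g])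
  fix h assume "h \<in> Z"
  then have h: "h \<in> Y"
    using Z_Y by blast
  have [measurable]: "h \<in> borel_measurable arc_length" "g \<in> borel_measurable arc_length"
    "\<And>n. f n \<in> borel_measurable arc_length"
    using h g f W_X X_measurable Y_measurable by auto
  show "(\<lambda>n. LINT z|arc_length. f n z * h z) \<longlonglongrightarrow> (LINT z|arc_length. g z * h z)"
  proof (rule integral_dominated_convergence[where w="\<lambda>z. C * cmod (F z * h z)"])
    show "AE z in arc_length. (\<lambda>n. f n z * h z) \<longlonglongrightarrow> g z * h z"
      using lim by eventually_elim (intro tendsto_intros)
    show "AE z in arc_length. norm (f n z * h z) \<le> C * cmod (F z * h z)" for n
      using bound[of n]
    proof eventually_elim
      fix z assume "cmod (f n z) \<le> C * cmod (F z)"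
      from mult_right_mono[OF this norm_ge_zero[of "h z"]]
      show "norm (f n z * h z) \<le> C * cmod (F z * h z)"
        by (simp add: norm_mult mult.assoc)
    qed
  qed (use pairing[OF F h] in auto)
qed

text \<open>A constant sequence converges almost everywhere to each function that agrees with it
  almost everywhere.\<close>

lemma W_cong_AE:
  assumes "f \<in> W" "g \<in> borel_measurable arc_length" "AE z in arc_length. g z = f z"
  shows "g \<in> W"
proof (rule W_limit[of "\<lambda>n. f" f _ 1])
  have "AE z in arc_length. cmod (g z) \<le> cmod (f z)"
    using assms(3) by eventually_elim simp
  then show "g \<in> X"
    by (rule X_solid[OF subsetD[OF W_X assms(1)] assms(2)])
  show "AE z in arc_length. (\<lambda>n. f z) \<longlonglongrightarrow> g z"
    using assms(3) by eventually_elim simp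
qed (use assms W_X in auto)

lemma W_poly: "f \<in> W \<Longrightarrow> (\<lambda>z. poly p z * f z) \<in> W"
proof (induction p)
  case 0
  then show ?case
    using W_linear by (simp add: linear_subspace_def)
next
  case (pCons a p)
  have "(\<lambda>z. a * f z + z * (poly p z * f z)) \<in> W"
    using pCons by (intro linear_subspace_add linear_subspace_cmult W_linear W_shift) auto
  then show ?case
    by (simp add: algebra_simps)
qed

text \<open>The Taylor polynomials of \<open>exp\<close>, composed with \<open>p\<close>, are
  polynomials in \<open>z\<close> and are bounded on the circle by \<open>exp C\<close>. The sign of
  \<open>Re p\<close> puts the limit into \<open>X\<close>.\<close>

lemma W_exp_poly:
  assumes f: "f \<in> W" and p: "\<And>z. cmod z = 1 \<Longrightarrow> Re (poly p z) \<le> 0"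
  shows "(\<lambda>z. exp (poly p z) * f z) \<in> W"
proof -
  obtain C where C: "\<And>z. cmod z = 1 \<Longrightarrow> cmod (poly p z) \<le> C"
    using poly_bounded_circle by blast
  define q where "q n = (\<Sum>i<n. smult (1 / fact i) (p ^ i))" for n
  have q: "poly (q n) z = (\<Sum>i<n. poly p z ^ i /\<^sub>R fact i)" for n z
    by (simp add: q_def poly_sum scaleR_conv_of_real divide_inverse mult.commute)
  have f_X: "f \<in> X"
    using f W_X by blast
  show ?thesis
  proof (rule W_limit[of "\<lambda>n z. poly (q n) z * f z" f _ "exp C"])
    show "(\<lambda>z. poly (q n) z * f z) \<in> W" for n
      by (rule W_poly[OF f])
    show "(\<lambda>z. exp (poly p z) * f z) \<in> X"
      using p by (intro X_mult f_X) auto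
    show "AE z in arc_length. cmod (poly (q n) z * f z) \<le> exp C * cmod (f z)" for n
    proof (rule AE_I2)
      fix z :: complex assume "z \<in> space arc_length"
      then have z: "cmod z = 1" by simp
      have "cmod (poly (q n) z) \<le> (\<Sum>i<n. cmod (poly p z) ^ i /\<^sub>R fact i)"
        unfolding q by (rule sum_norm_le) (simp add: norm_power)
      also have "\<dots> \<le> (\<Sum>i. cmod (poly p z) ^ i /\<^sub>R fact i)"
        by (rule sum_le_suminf[OF summable_exp_generic]) auto
      also have "\<dots> = exp (cmod (poly p z))"
        by (simp add: exp_def)
      also have "\<dots> \<le> exp C"
        using C[OF z] by simp
      finally show "cmod (poly (q n) z * f z) \<le> exp C * cmod (f z)"
        by (simp add: norm_mult mult_right_mono)
    qed
    have "(\<lambda>n. poly (q n) z) \<longlonglongrightarrow> exp (poly p z)" for z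
      using exp_converges[of "poly p z"] by (simp add: q sums_def)
    then show "AE z in arc_length. (\<lambda>n. poly (q n) z * f z) \<longlonglongrightarrow> exp (poly p z) * f z"
      by (intro AE_I2 tendsto_intros)
  qed (use f f_X in auto)
qed

text \<open>Exponentials of the approximating polynomials have modulus at most 1, so their products
  with \<open>f\<close> are dominated by \<open>f\<close>. The existential form lets later proofs
  choose a whole sequence of exponents at once.\<close>

lemma W_outer:
  assumes "(\<lambda>z. complex_of_real (u z)) \<in> L2 arc_length" and u: "\<And>z. u z \<le> 0"
  shows "\<exists>k. k \<in> L2 arc_length \<and> (AE z in arc_length. Re (k z) = u z) \<and>
    sqn arc_length k \<le> 8 * sqn arc_length (\<lambda>z. complex_of_real (u z)) \<and>
    (\<forall>f\<in>W. (\<lambda>z. exp (k z) * f z) \<in> W)"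
proof -
  obtain k p where k: "k \<in> L2 arc_length" "AE z in arc_length. Re (k z) = u z"
    "sqn arc_length k \<le> 8 * sqn arc_length (\<lambda>z. complex_of_real (u z))"
    and p: "\<And>(n::nat) z. cmod z = 1 \<Longrightarrow> Re (poly (p n) z) \<le> 0"
    "AE z in arc_length. (\<lambda>n. poly (p n) z) \<longlonglongrightarrow> k z"
    by (rule outer_exponent[OF assms]) blast
  have [measurable]: "k \<in> borel_measurable arc_length"
    by (rule L2_measurable[OF k(1)])
  have "(\<lambda>z. exp (k z) * f z) \<in> W" if f: "f \<in> W" for f
  proof (rule W_limit[of "\<lambda>n z. exp (poly (p n) z) * f z" f _ 1])
    have f_X: "f \<in> X"
      using f W_X by blast
    then show "(\<lambda>z. exp (k z) * f z) \<in> X"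
      using k(2) u by (intro X_mult) (auto elim!: eventually_mono)
    show "AE z in arc_length. (\<lambda>n. exp (poly (p n) z) * f z) \<longlonglongrightarrow> exp (k z) * f z"
      using p(2) by eventually_elim (intro tendsto_intros)
    show "AE z in arc_length. cmod (exp (poly (p n) z) * f z) \<le> 1 * cmod (f z)" for n
      using p(1) by (intro AE_I2) (simp add: norm_mult mult_left_le_one_le)
  qed (use f W_X p W_exp_poly in auto)
  with k show ?thesis by blast
qed

end

text \<open>Meant for \<open>x = cmod g\<close>, \<open>y = cmod (f - g)\<close> and a bound
  \<open>C\<close> of \<open>f\<close>: the exponent needed to cut \<open>g\<close> down to modulus
  \<open>C\<close> is at most the distance from \<open>g\<close> to \<open>f\<close>. It follows
  from \<open>ln t \<le> t - 1\<close>.\<close>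

lemma ln_max_one_le:
  fixes x y :: real
  assumes "0 \<le> x" "0 \<le> y" "x \<le> C + y" "C \<ge> 1"
  shows "ln (max 1 (x / C)) \<le> y"
proof -
  have "ln (max 1 (x / C)) \<le> max 1 (x / C) - 1"
    by (rule ln_le_minus_one) simp
  also have "\<dots> \<le> y"
  proof -
    have "x / C \<le> (C + y) / C"
      using assms by (intro divide_right_mono) auto
    also have "\<dots> = 1 + y / C"
      using assms by (simp add: add_divide_distrib)
    also have "y / C \<le> y"
      using assms mult_left_mono[of 1 C y] by (simp add: divide_le_eq)
    finally show ?thesis
      using assms by simp
  qed
  finally show ?thesis .
qed

lemma divide_max_one_le: "a / max 1 (a / C) \<le> C" if "0 \<le> a" "0 < C" for a C :: real
proof (cases "a \<le> C")
  case True
  then have "max 1 (a / C) = 1"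
    using that by (simp add: max_def)
  then show ?thesis
    using True by simp
next
  case False
  then have "max 1 (a / C) = a / C"
    using that by (simp add: max_def divide_le_eq)
  then show ?thesis
    using that False by simp
qed

lemma ln_sq_le: "(ln x)\<^sup>2 \<le> 4 * x" if "x \<ge> 1" for x :: real
proof -
  have "ln x = 2 * ln (sqrt x)"
    using that by (simp add: ln_sqrt)
  also have "\<dots> \<le> 2 * sqrt x"
    using ln_le_minus_one[of "sqrt x"] that by simp
  finally have "ln x \<le> 2 * sqrt x" .
  then have "(ln x)\<^sup>2 \<le> (2 * sqrt x)\<^sup>2"
    using that by (intro power_mono) auto
  then show ?thesis
    using that by (simp add: power_mult_distrib)
qed

section \<open>Bounded elements of \<open>W\<close> and their L^2 closure\<close>

context shift_invariant
begin

definition V :: "(complex \<Rightarrow> complex) set" where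
  "V = W \<inter> L_infinity"

definition M :: "(complex \<Rightarrow> complex) set" where
  "M = L2_closure arc_length V"

lemma V_L2: "V \<subseteq> L2 arc_length"
  using L_infinity_L2 by (auto simp: V_def)

lemma M_L2: "M \<subseteq> L2 arc_length"
  by (simp add: M_def L2_closure_subset)

lemma V_M: "V \<subseteq> M"
  unfolding M_def by (rule L2_closure_superset[OF V_L2])

lemma M_linear: "linear_subspace M"
  unfolding M_def V_def
  by (intro linear_subspace_L2_closure linear_subspace_Int_L_infinity W_linear V_L2[unfolded V_def])

lemma M_cong_AE:
  assumes f: "f \<in> M" and g: "g \<in> borel_measurable arc_length" "AE z in arc_length. g z = f z"
  shows "g \<in> M"
  unfolding M_def
proof (rule L2_closureI)
  have fL: "f \<in> L2 arc_length"
    using f M_L2 by blast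
  show "g \<in> L2 arc_length"
    by (rule sqn_mono(1)[OF fL g(1)]) (use g(2) in eventually_elim, simp)
  fix e :: real assume "e > 0"
  then obtain v where v: "v \<in> V" "sqn arc_length (\<lambda>z. f z - v z) < e"
    using L2_closure_approx f unfolding M_def by blast
  have [measurable]: "v \<in> borel_measurable arc_length" "f \<in> borel_measurable arc_length"
      "g \<in> borel_measurable arc_length"
    using v V_L2 fL g by (auto intro: L2_measurable)
  have "sqn arc_length (\<lambda>z. g z - v z) = sqn arc_length (\<lambda>z. f z - v z)"
    unfolding sqn_def
  proof (rule integral_cong_AE)
    show "AE z in arc_length. (cmod (g z - v z))\<^sup>2 = (cmod (f z - v z))\<^sup>2"
      using g(2) by eventually_elim simp
  qed measurable
  then show "\<exists>h\<in>V. sqn arc_length (\<lambda>z. g z - h z) < e"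
    using v by (intro bexI[of _ v]) auto
qed

lemma M_shift:
  assumes f: "f \<in> M" shows "(\<lambda>z. z * f z) \<in> M"
  unfolding M_def
proof (rule L2_closure_linear_map[where C=1 and T="\<lambda>f z. z * f z"])
  show "f \<in> L2_closure arc_length V"
    using f by (simp add: M_def)
  have shift: "(\<lambda>z. z * g z) \<in> L2 arc_length" "sqn arc_length (\<lambda>z. z * g z) \<le> sqn arc_length g"
    if "g \<in> L2 arc_length" for g
  proof -
    have *: "AE z in arc_length. cmod (z * g z) \<le> cmod (g z)"
      by (rule AE_I2) (simp add: norm_mult)
    have "(\<lambda>z. z * g z) \<in> borel_measurable arc_length"
      using L2_measurable[OF that] by measurable
    then show "(\<lambda>z. z * g z) \<in> L2 arc_length" "sqn arc_length (\<lambda>z. z * g z) \<le> sqn arc_length g"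
      using sqn_mono[OF that _ *] by blast+
  qed
  show "(\<lambda>z. z * f z) \<in> L2 arc_length"
    using f M_L2 by (intro shift) auto
  fix g assume g: "g \<in> V"
  then have "(\<lambda>z. z * g z) \<in> V"
    unfolding V_def using W_shift L_infinity_bounded_mult[of g "\<lambda>z. z" 1]
      AE_I2[of arc_length "\<lambda>z. cmod z \<le> 1"] by auto
  moreover have "sqn arc_length (\<lambda>z. z * f z - z * g z) \<le> sqn arc_length (\<lambda>z. f z - g z)"
    using shift(2)[of "\<lambda>z. f z - g z"] f g M_L2 V_L2 L2_diff[of f arc_length g]
    by (auto simp: right_diff_distrib)
  ultimately show "(\<lambda>z. z * g z) \<in> V \<and>
      sqn arc_length (\<lambda>z. z * f z - z * g z) \<le> 1 * sqn arc_length (\<lambda>z. f z - g z)"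
    by simp
qed simp

lemma M_shift_power: "f \<in> M \<Longrightarrow> (\<lambda>z. z ^ n * f z) \<in> M"
  by (induction n) (use M_shift in \<open>auto simp: mult.assoc\<close>)

lemma M_projection:
  assumes "f \<in> L2 arc_length"
  obtains p where "p \<in> M" "\<And>g. g \<in> M \<Longrightarrow> (LINT z|arc_length. (f z - p z) * cnj (g z)) = 0"
proof -
  have "L2_closure arc_length M \<subseteq> M"
    unfolding M_def by (simp add: L2_closure_closed V_L2)
  then show thesis
    using L2_projection[OF arc.finite_measure_axioms M_linear M_L2 _ assms] that by blast
qed

text \<open>An \<open>L\<^sup>2\<close> approximation from \<open>V\<close> is cut down to a bounded one by outer multipliers of modulus
  \<open>min 1 (C / \<bar>f n\<bar>)\<close>. These tend to \<open>1\<close> because the conjugate function is an \<open>L\<^sup>2\<close> contraction.\<close>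
lemma M_bounded_W:
  assumes f: "f \<in> M" "f \<in> L_infinity" shows "f \<in> W"
proof -
  obtain C0 where "AE z in arc_length. cmod (f z) \<le> C0"
    using f by (auto simp: L_infinity_def)
  \<comment> \<open>\<open>ln_max_one_le\<close> wants a bound of at least 1.\<close>
  define C where "C = max 1 C0"
  then have C: "C \<ge> 1" "AE z in arc_length. cmod (f z) \<le> C"
    using \<open>AE z in arc_length. cmod (f z) \<le> C0\<close> by (auto elim: eventually_mono)
  have fL: "f \<in> L2 arc_length"
    using f M_L2 by blast
  have "\<exists>g\<in>V. sqn arc_length (\<lambda>z. f z - g z) < 1 / Suc n" for n
    using f(1) L2_closure_approx[of f arc_length V "1 / Suc n"] unfolding M_def
    by (metis of_nat_0_less_iff zero_less_Suc zero_less_divide_1_iff)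
  then obtain g where gV: "\<And>n. g n \<in> V" and g: "\<And>n. sqn arc_length (\<lambda>z. f z - g n z) < 1 / Suc n"
    by metis
  have gL: "g n \<in> L2 arc_length" and gW: "g n \<in> W" for n
    using gV V_L2 by (auto simp: V_def)
  have [measurable]: "f \<in> borel_measurable arc_length" "\<And>n. g n \<in> borel_measurable arc_length"
    using fL gL by (auto intro: L2_measurable)
  define u where "u n z = - ln (max 1 (cmod (g n z) / C))" for n z
  have u_bound: "AE z in arc_length. cmod (complex_of_real (u n z)) \<le> cmod (f z - g n z)" for n
    using C(2)
  proof eventually_elim
    fix z assume "cmod (f z) \<le> C"
    then have "cmod (g n z) \<le> C + cmod (f z - g n z)"
      using norm_triangle_ineq2[of "g n z" "f z"] by (simp add: norm_minus_commute)
    then show "cmod (complex_of_real (u n z)) \<le> cmod (f z - g n z)"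
      using ln_max_one_le[of "cmod (g n z)" "cmod (f z - g n z)" C] C(1) by (simp add: u_def)
  qed
  have um: "(\<lambda>z. complex_of_real (u n z)) \<in> borel_measurable arc_length" for n
    unfolding u_def by measurable
  have uL: "(\<lambda>z. complex_of_real (u n z)) \<in> L2 arc_length"
    and u_sqn: "sqn arc_length (\<lambda>z. complex_of_real (u n z)) \<le> sqn arc_length (\<lambda>z. f z - g n z)" for n
    by (rule sqn_mono[OF L2_diff[OF fL gL] um u_bound])+
  have "u n z \<le> 0" for n z
    by (simp add: u_def)
  then have "\<exists>k. k \<in> L2 arc_length \<and> (AE z in arc_length. Re (k z) = u n z) \<and>
      sqn arc_length k \<le> 8 * sqn arc_length (\<lambda>z. complex_of_real (u n z)) \<and>
      (\<forall>f\<in>W. (\<lambda>z. exp (k z) * f z) \<in> W)" for n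
    by (intro W_outer uL)
  then obtain k where kL: "\<And>n. k n \<in> L2 arc_length" and Re_k: "\<And>n. AE z in arc_length. Re (k n z) = u n z"
    and k_sqn: "\<And>n. sqn arc_length (k n) \<le> 8 * sqn arc_length (\<lambda>z. complex_of_real (u n z))"
    and kW: "\<And>n f. f \<in> W \<Longrightarrow> (\<lambda>z. exp (k n z) * f z) \<in> W"
    by metis
  have inv0: "(\<lambda>n. 1 / real (Suc n)) \<longlonglongrightarrow> 0"
    using LIMSEQ_inverse_real_of_nat by (simp add: inverse_eq_divide)
  have "(\<lambda>n. sqn arc_length (\<lambda>z. k n z - 0)) \<longlonglongrightarrow> 0"
  proof (rule real_tendsto_sandwich[OF _ _ tendsto_const])
    show "(\<lambda>n. 8 * (1 / real (Suc n))) \<longlonglongrightarrow> 0"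
      using tendsto_mult_left[OF inv0, of 8] by simp
    have "sqn arc_length (\<lambda>z. k n z - 0) \<le> 8 * (1 / real (Suc n))" for n
      using k_sqn[of n] u_sqn[of n] g[of n] by simp
    then show "\<forall>\<^sub>F n in sequentially. sqn arc_length (\<lambda>z. k n z - 0) \<le> 8 * (1 / real (Suc n))"
      by simp
  qed simp
  \<comment> \<open>Two extractions in a row: \<open>r\<close> for the exponents, then
    \<open>s\<close> for the approximants along \<open>r\<close>. The exponents keep their limit
    along the second subsequence.\<close>
  then obtain r where r: "strict_mono r" "AE z in arc_length. (\<lambda>n. k (r n) z) \<longlonglongrightarrow> 0"
    using L2_tendsto_AE_subseq[of k arc_length "\<lambda>z. 0"] kL by (auto simp: L2_def)
  have "(\<lambda>n. sqn arc_length (\<lambda>z. g n z - f z)) \<longlonglongrightarrow> 0"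
  proof (rule real_tendsto_sandwich[OF _ _ tendsto_const inv0])
    show "\<forall>\<^sub>F n in sequentially. sqn arc_length (\<lambda>z. g n z - f z) \<le> 1 / real (Suc n)"
      using g by (intro always_eventually allI) (simp add: sqn_minus_commute[of _ _ f] less_imp_le)
  qed simp
  then have "(\<lambda>n. sqn arc_length (\<lambda>z. g (r n) z - f z)) \<longlonglongrightarrow> 0"
    using r(1) LIMSEQ_subseq_LIMSEQ unfolding o_def by blast
  then obtain s where s: "strict_mono s" "AE z in arc_length. (\<lambda>n. g (r (s n)) z) \<longlonglongrightarrow> f z"
    using L2_tendsto_AE_subseq[of "\<lambda>n. g (r n)", OF gL fL] by blast
  have ks: "AE z in arc_length. (\<lambda>n. k (r (s n)) z) \<longlonglongrightarrow> 0"
    using r(2)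
  proof eventually_elim
    fix z assume "(\<lambda>n. k (r n) z) \<longlonglongrightarrow> 0"
    from LIMSEQ_subseq_LIMSEQ[OF this s(1)] show "(\<lambda>n. k (r (s n)) z) \<longlonglongrightarrow> 0"
      by (simp add: o_def)
  qed
  show ?thesis
  \<comment> \<open>The dominating function is the constant 1, with factor \<open>C\<close>: the
    multiplier caps the modulus of the approximant at \<open>C\<close>.\<close>
  proof (rule W_limit[of "\<lambda>n z. exp (k (r (s n)) z) * g (r (s n)) z" "\<lambda>z. 1" _ C])
    show "(\<lambda>z. exp (k (r (s n)) z) * g (r (s n)) z) \<in> W" for n
      by (rule kW[OF gW])
    show "(\<lambda>z. 1) \<in> X"
      using L_infinity_X L_infinityI[of "\<lambda>z. 1" 1] by auto
    show "f \<in> X"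
      using f(2) L_infinity_X by blast
    show "AE z in arc_length. cmod (exp (k (r (s n)) z) * g (r (s n)) z) \<le> C * cmod 1" for n
      using Re_k[of "r (s n)"]
    proof eventually_elim
      fix z assume Re: "Re (k (r (s n)) z) = u (r (s n)) z"
      define a where "a = cmod (g (r (s n)) z)"
      have "cmod (exp (k (r (s n)) z) * g (r (s n)) z) = a / max 1 (a / C)"
        by (simp add: Re norm_mult u_def exp_minus divide_inverse mult.commute flip: a_def)
      also have "\<dots> \<le> C"
        using C(1) by (simp add: a_def max_def divide_le_eq field_simps)
      finally show "cmod (exp (k (r (s n)) z) * g (r (s n)) z) \<le> C * cmod 1"
        by simp
    qed
    show "AE z in arc_length. (\<lambda>n. exp (k (r (s n)) z) * g (r (s n)) z) \<longlonglongrightarrow> f z"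
      using ks s(2)
    proof eventually_elim
      fix z assume "(\<lambda>n. k (r (s n)) z) \<longlonglongrightarrow> 0" "(\<lambda>n. g (r (s n)) z) \<longlonglongrightarrow> f z"
      from tendsto_mult[OF tendsto_exp[OF this(1)] this(2)]
      show "(\<lambda>n. exp (k (r (s n)) z) * g (r (s n)) z) \<longlonglongrightarrow> f z" by simp
    qed
  qed
qed

text \<open>Here the outer multipliers have modulus \<open>min 1 (n / \<bar>f\<bar>)\<close>. Their exponents are in \<open>L\<^sup>2\<close> already
  for integrable \<open>f\<close>, since \<open>(ln x)\<^sup>2 \<le> 4 x\<close> for \<open>x \<ge> 1\<close>.\<close>
lemma W_approx_V:
  assumes f: "f \<in> W"
  obtains h where "\<And>n. h n \<in> borel_measurable arc_length"
    "\<And>n. AE z in arc_length. cmod (h n z) \<le> 1" "\<And>n z. h n z \<noteq> 0"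
    "\<And>n. (\<lambda>z. h n z * f z) \<in> V" "AE z in arc_length. (\<lambda>n. h n z) \<longlonglongrightarrow> 1"
proof -
  have fX: "f \<in> X"
    using f W_X by blast
  have fi: "integrable arc_length f"
    by (rule X_integrable[OF fX])
  have [measurable]: "f \<in> borel_measurable arc_length"
    using fi by auto
  \<comment> \<open>The truncation level is \<open>Suc n\<close>, which is positive also for
    \<open>n = 0\<close>.\<close>
  define u where "u n z = - ln (max 1 (cmod (f z) / real (Suc n)))" for n z
  have um[measurable]: "u n \<in> borel_measurable arc_length" for n
    unfolding u_def by measurable
  have u_bound: "(cmod (complex_of_real (u n z)))\<^sup>2 \<le> 4 + 4 * cmod (f z)" for n z
  proof -
    have "(cmod (complex_of_real (u n z)))\<^sup>2 \<le> 4 * max 1 (cmod (f z) / real (Suc n))"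
      using ln_sq_le[of "max 1 (cmod (f z) / real (Suc n))"] by (simp add: u_def)
    also have "cmod (f z) / real (Suc n) \<le> cmod (f z) / 1"
      by (intro divide_left_mono) auto
    then have "4 * max 1 (cmod (f z) / real (Suc n)) \<le> 4 + 4 * cmod (f z)"
      using norm_ge_zero[of "f z"] unfolding max_def by (auto simp del: of_nat_Suc simp: field_simps)
    finally show ?thesis .
  qed
  have int: "integrable arc_length (\<lambda>z. 4 + 4 * cmod (f z))"
    using fi by simp
  have uL: "(\<lambda>z. complex_of_real (u n z)) \<in> L2 arc_length" for n
    unfolding L2_def
  proof (intro CollectI conjI)
    show "integrable arc_length (\<lambda>z. (cmod (complex_of_real (u n z)))\<^sup>2)"
      by (rule Bochner_Integration.integrable_bound[OF int])
         (use u_bound in \<open>auto simp del: norm_of_real intro: order_trans[OF _ abs_ge_self]\<close>)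
  qed measurable
  have u_sqn: "(\<lambda>n. sqn arc_length (\<lambda>z. complex_of_real (u n z))) \<longlonglongrightarrow> (LINT z|arc_length. 0)"
    unfolding sqn_def
  proof (rule integral_dominated_convergence[OF _ _ int])
    show "AE z in arc_length. (\<lambda>n. (cmod (complex_of_real (u n z)))\<^sup>2) \<longlonglongrightarrow> 0"
    proof (rule AE_I2, rule tendsto_eventually)
      fix z
      obtain N where "cmod (f z) \<le> real N"
        using real_arch_simple by blast
      then have "u n z = 0" if "n \<ge> N" for n
        using that by (simp add: u_def max_def divide_le_eq)
      then show "\<forall>\<^sub>F n in sequentially. (cmod (complex_of_real (u n z)))\<^sup>2 = 0"
        by (intro eventually_mono[OF eventually_ge_at_top[of N]]) simp
    qed
    show "AE z in arc_length. norm ((cmod (complex_of_real (u n z)))\<^sup>2) \<le> 4 + 4 * cmod (f z)" for n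
      using u_bound[of n] by (intro AE_I2) simp
  qed measurable
  have u0: "u n z \<le> 0" for n z
    by (simp add: u_def)
  then have "\<exists>k. k \<in> L2 arc_length \<and> (AE z in arc_length. Re (k z) = u n z) \<and>
      sqn arc_length k \<le> 8 * sqn arc_length (\<lambda>z. complex_of_real (u n z)) \<and>
      (\<forall>f\<in>W. (\<lambda>z. exp (k z) * f z) \<in> W)" for n
    by (intro W_outer uL)
  then obtain k where kL: "\<And>n. k n \<in> L2 arc_length" and Re_k: "\<And>n. AE z in arc_length. Re (k n z) = u n z"
    and k_sqn: "\<And>n. sqn arc_length (k n) \<le> 8 * sqn arc_length (\<lambda>z. complex_of_real (u n z))"
    and kW: "\<And>n f. f \<in> W \<Longrightarrow> (\<lambda>z. exp (k n z) * f z) \<in> W"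
    by metis
  have [measurable]: "k n \<in> borel_measurable arc_length" for n
    by (rule L2_measurable[OF kL])
  have "(\<lambda>n. sqn arc_length (\<lambda>z. k n z - 0)) \<longlonglongrightarrow> 0"
  proof (rule real_tendsto_sandwich[OF _ _ tendsto_const])
    show "(\<lambda>n. 8 * sqn arc_length (\<lambda>z. complex_of_real (u n z))) \<longlonglongrightarrow> 0"
      using tendsto_mult_left[OF u_sqn, of 8] by simp
  qed (use k_sqn in auto)
  then obtain r where r: "strict_mono r" "AE z in arc_length. (\<lambda>n. k (r n) z) \<longlonglongrightarrow> 0"
    using L2_tendsto_AE_subseq[of k arc_length "\<lambda>z. 0"] kL by (auto simp: L2_def)
  show thesis
  \<comment> \<open>An exponential has no zeros, so \<open>h n * f\<close> vanishes exactly where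
    \<open>f\<close> does; \<open>reducing_W\<close> relies on this.\<close>
  proof (rule that[of "\<lambda>n z. exp (k (r n) z)"])
    show "AE z in arc_length. cmod (exp (k (r n) z)) \<le> 1" for n
      using Re_k[of "r n"] by eventually_elim (simp add: u0)
    show "(\<lambda>z. exp (k (r n) z) * f z) \<in> V" for n
      unfolding V_def
    proof (intro IntI kW f L_infinityI)
      show "AE z in arc_length. cmod (exp (k (r n) z) * f z) \<le> real (Suc (r n))"
        using Re_k[of "r n"]
      proof eventually_elim
        fix z assume Re: "Re (k (r n) z) = u (r n) z"
        define a where "a = cmod (f z)"
        have "cmod (exp (k (r n) z) * f z) = a / max 1 (a / Suc (r n))"
          by (simp add: Re norm_mult u_def exp_minus divide_inverse mult.commute flip: a_def)
        also have "\<dots> \<le> Suc (r n)"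
          by (rule divide_max_one_le) (auto simp: a_def)
        finally show "cmod (exp (k (r n) z) * f z) \<le> real (Suc (r n))" .
      qed
    qed measurable
    show "AE z in arc_length. (\<lambda>n. exp (k (r n) z)) \<longlonglongrightarrow> 1"
      using r(2)
    proof eventually_elim
      fix z assume "(\<lambda>n. k (r n) z) \<longlonglongrightarrow> 0"
      from tendsto_exp[OF this] show "(\<lambda>n. exp (k (r n) z)) \<longlonglongrightarrow> 1" by simp
    qed
  qed (use in auto)
qed

end

section \<open>Beurling's argument\<close>

context shift_invariant
begin

text \<open>Beurling's wandering vector: \<open>\<phi>\<close> is orthogonal to \<open>z M\<close>.\<close>
lemma wandering_unimodular:
  assumes \<phi>: "\<phi> \<in> M" "sqn arc_length \<phi> = 1"
    and orth: "\<And>g. g \<in> M \<Longrightarrow> (LINT z|arc_length. z * g z * cnj (\<phi> z)) = 0"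
  shows "unimodular \<phi>"
proof -
  define F where "F z = complex_of_real ((cmod (\<phi> z))\<^sup>2 - 1)" for z
  have \<phi>L: "\<phi> \<in> L2 arc_length"
    using \<phi> M_L2 by blast
  have Fr: "integrable arc_length (\<lambda>z. (cmod (\<phi> z))\<^sup>2 - 1)"
    by (rule Bochner_Integration.integrable_diff[OF L2_integrable[OF \<phi>L] arc.integrable_const])
  have Fi: "integrable arc_length F"
    unfolding F_def by (rule integrable_of_real[OF Fr])
  have pos: "(LINT z|arc_length. F z * z ^ n) = 0" for n
  proof (cases n)
    case 0
    have "(LINT z|arc_length. F z) = complex_of_real (LINT z|arc_length. (cmod (\<phi> z))\<^sup>2 - 1)"
      unfolding F_def by (rule integral_of_real[OF Fr])
    also have "(LINT z|arc_length. (cmod (\<phi> z))\<^sup>2 - 1) = 0"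
      using L2_integrable[OF \<phi>L] \<phi>(2) by (simp add: sqn_def)
    finally show ?thesis
      by (simp add: 0)
  next
    case (Suc m)
    have i1: "integrable arc_length (\<lambda>z. z * (z ^ m * \<phi> z) * cnj (\<phi> z))"
      using M_shift[OF M_shift_power[OF \<phi>(1)]] M_L2 \<phi>L by (intro L2_mult_integrable L2_cnj) auto
    have i2: "integrable arc_length (\<lambda>z. z ^ n)"
      by (rule arc.integrable_const_bound[of _ 1]) (auto simp: norm_power)
    have "F z * z ^ n = z * (z ^ m * \<phi> z) * cnj (\<phi> z) - z ^ n" for z
      unfolding F_def of_real_diff complex_norm_square by (simp add: Suc algebra_simps)
    then have "(LINT z|arc_length. F z * z ^ n)
        = (LINT z|arc_length. z * (z ^ m * \<phi> z) * cnj (\<phi> z)) - (LINT z|arc_length. z ^ n)"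
      by (simp only: Bochner_Integration.integral_diff[OF i1 i2])
    then show ?thesis
      using orth[OF M_shift_power[OF \<phi>(1)]] Suc by (simp add: integral_power_arc_length del: power_Suc)
  qed
  \<comment> \<open>\<open>F\<close> is real, so its negative coefficients are conjugates of the
    positive ones.\<close>
  have "(LINT z|arc_length. F z * cnj z ^ n) = cnj (LINT z|arc_length. F z * z ^ n)" for n
    by (subst Bochner_Integration.integral_cnj[symmetric]) (simp add: F_def)
  then have "AE z in arc_length. F z = 0"
    using pos by (intro Fourier_unique Fi) auto
  then have "AE z in arc_length. cmod (\<phi> z) = 1"
  proof eventually_elim
    fix z assume "F z = 0"
    then have "(cmod (\<phi> z))\<^sup>2 = 1\<^sup>2"
      unfolding F_def of_real_eq_0_iff by simp
    then show "cmod (\<phi> z) = 1"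
      by (rule power2_eq_imp_eq) auto
  qed
  then show ?thesis
    using L2_measurable[OF \<phi>L] by (simp add: unimodular_def)
qed

text \<open>Orthogonality to \<open>z M\<close> says that \<open>cnj \<phi> * f\<close> has no
  negative Fourier coefficients for \<open>f\<close> in \<open>V\<close>. Conversely
  \<open>\<phi> * g\<close> lies in \<open>M\<close> for \<open>g\<close> in
  \<open>H_infinity\<close>, because its remainder after projection vanishes. Each inclusion then
  passes from bounded functions to the full spaces.\<close>

lemma wandering_W:
  assumes \<phi>M: "\<phi> \<in> M" and uni: "unimodular \<phi>"
    and orth: "\<And>g. g \<in> M \<Longrightarrow> (LINT z|arc_length. z * g z * cnj (\<phi> z)) = 0"
  shows "W = mult_set \<phi> H"
proof -
  have \<phi>m [measurable]: "\<phi> \<in> borel_measurable arc_length" and \<phi>1: "AE z in arc_length. cmod (\<phi> z) = 1"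
    using uni by (auto simp: unimodular_def)
  have \<phi>_le: "AE z in arc_length. cmod (\<phi> z) \<le> 1" "AE z in arc_length. cmod (cnj (\<phi> z)) \<le> 1"
    using \<phi>1 by (eventually_elim, simp)+
  have \<phi>_cnj: "AE z in arc_length. \<phi> z * cnj (\<phi> z) = 1"
    using \<phi>1 by eventually_elim (simp add: complex_norm_square[symmetric])
  then have cancel: "AE z in arc_length. \<phi> z * (cnj (\<phi> z) * w z) = w z" for w
    by eventually_elim (simp add: mult.assoc[symmetric])
  \<comment> \<open>One factor \<open>z\<close> is split off because \<open>orth\<close> is about
    \<open>z * g\<close> with \<open>g\<close> in \<open>M\<close>; this leaves the exponent
    \<open>- k - 1\<close>.\<close>
  have power_nat: "z powi (- k) = z * z ^ nat (- k - 1)" if "k < 0" for k and z :: complex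
  proof -
    have "z powi (- k) = z ^ nat (- k)"
      using that by (simp add: power_int_def)
    also have "nat (- k) = Suc (nat (- k - 1))"
      using that by simp
    finally show ?thesis by simp
  qed
  have V_H: "(\<lambda>z. cnj (\<phi> z) * f z) \<in> H_infinity" if f: "f \<in> V" for f
  proof -
    have "(\<lambda>z. cnj (\<phi> z) * f z) \<in> L_infinity"
      using f \<phi>_le(2) by (intro L_infinity_bounded_mult[of _ _ 1]) (auto simp: V_def)
    moreover have "fourier_coeff (\<lambda>z. cnj (\<phi> z) * f z) k = 0" if "k < 0" for k
      using orth[OF M_shift_power[of f "nat (- k - 1)"]] f V_M that
      by (auto simp: fourier_coeff_def power_nat mult_ac)
    ultimately show ?thesis
      by (simp add: H_infinity_def)
  qed
  have H_W: "(\<lambda>z. \<phi> z * g z) \<in> W" if g: "g \<in> H_infinity" for g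
  proof -
    have gL: "g \<in> L_infinity"
      using g by (simp add: H_infinity_def)
    then have \<phi>g: "(\<lambda>z. \<phi> z * g z) \<in> L_infinity"
      by (rule L_infinity_bounded_mult[OF _ \<phi>m \<phi>_le(1)])
    then have \<phi>gL: "(\<lambda>z. \<phi> z * g z) \<in> L2 arc_length"
      using L_infinity_L2 by blast
    obtain p where p: "p \<in> M" "\<And>f. f \<in> M \<Longrightarrow> (LINT z|arc_length. (\<phi> z * g z - p z) * cnj (f z)) = 0"
      using M_projection[OF \<phi>gL] by blast
    have pL: "p \<in> L2 arc_length"
      using p M_L2 by blast
    define q where "q z = \<phi> z * g z - p z" for z
    have qL: "q \<in> L2 arc_length"
      unfolding q_def by (rule L2_diff[OF \<phi>gL pL])
    have [measurable]: "q \<in> borel_measurable arc_length" "g \<in> borel_measurable arc_length"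
        "p \<in> borel_measurable arc_length"
      using qL gL pL by (auto intro: L2_measurable L_infinity_measurable)
    have \<phi>L: "\<phi> \<in> L2 arc_length"
      using \<phi>M M_L2 by blast
    \<comment> \<open>Coefficients against \<open>cnj z ^ n\<close> vanish because \<open>q\<close>
      is orthogonal to \<open>z ^ n * \<phi>\<close>, an element of \<open>M\<close>. Against
      \<open>z ^ n\<close> with \<open>n > 0\<close>, the part from \<open>g\<close> vanishes since
      \<open>g\<close> is in \<open>H_infinity\<close>, and the part from \<open>p\<close> by
      \<open>orth\<close>.\<close>
    have "AE z in arc_length. q z * cnj (\<phi> z) = 0"
    proof (rule Fourier_unique)
      show "integrable arc_length (\<lambda>z. q z * cnj (\<phi> z))"
        by (intro L2_mult_integrable L2_cnj qL \<phi>L)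
      show "(LINT z|arc_length. q z * cnj (\<phi> z) * cnj z ^ n) = 0" for n
        using p(2)[OF M_shift_power[OF \<phi>M, of n]] by (simp add: q_def mult_ac)
      show "(LINT z|arc_length. q z * cnj (\<phi> z) * z ^ n) = 0" for n
      proof (cases n)
        case 0
        then show ?thesis
          using p(2)[OF \<phi>M] by (simp add: q_def)
      next
        case (Suc m)
        have i1: "integrable arc_length (\<lambda>z. g z * z ^ n)"
          by (rule integrable_bounded_mult[where C=1])
             (use gL L_infinity_L2 arc.L2_integrable1 in \<open>auto simp: norm_power\<close>)
        have i2: "integrable arc_length (\<lambda>z. z * (z ^ m * p z) * cnj (\<phi> z))"
          using M_shift[OF M_shift_power[OF p(1)]] M_L2 \<phi>L by (intro L2_mult_integrable L2_cnj) auto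
        have "AE z in arc_length. q z * cnj (\<phi> z) * z ^ n = g z * z ^ n - z * (z ^ m * p z) * cnj (\<phi> z)"
          using \<phi>_cnj
        proof eventually_elim
          fix z assume e: "\<phi> z * cnj (\<phi> z) = 1"
          have "q z * cnj (\<phi> z) * z ^ n
              = (\<phi> z * cnj (\<phi> z)) * (g z * z ^ n) - z * (z ^ m * p z) * cnj (\<phi> z)"
            by (simp add: q_def Suc algebra_simps)
          then show "q z * cnj (\<phi> z) * z ^ n = g z * z ^ n - z * (z ^ m * p z) * cnj (\<phi> z)"
            by (simp only: e mult_1_left)
        qed
        then have "(LINT z|arc_length. q z * cnj (\<phi> z) * z ^ n)
            = (LINT z|arc_length. g z * z ^ n - z * (z ^ m * p z) * cnj (\<phi> z))"
          by (intro integral_cong_AE) auto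
        also have "\<dots> = (LINT z|arc_length. g z * z ^ n)"
          using orth[OF M_shift_power[OF p(1), of m]] by (simp add: Bochner_Integration.integral_diff[OF i1 i2])
        also have "\<dots> = fourier_coeff g (- int n)"
          by (simp add: fourier_coeff_def)
        finally show ?thesis
          using g Suc by (simp add: H_infinity_def)
      qed
    qed
    then have "AE z in arc_length. \<phi> z * g z = p z"
      using \<phi>1 by eventually_elim (auto simp: q_def)
    then have "(\<lambda>z. \<phi> z * g z) \<in> M"
      by (intro M_cong_AE[OF p(1)]) auto
    then show ?thesis
      using \<phi>g by (rule M_bounded_W)
  qed
  show ?thesis
  proof safe
    fix f assume f: "f \<in> W"
    then have fX: "f \<in> X"
      using W_X by blast
    have [measurable]: "f \<in> borel_measurable arc_length"
      using fX X_measurable by blast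
    obtain h :: "nat \<Rightarrow> complex \<Rightarrow> complex" where [measurable]: "\<And>n. h n \<in> borel_measurable arc_length"
      and h: "\<And>n. AE z in arc_length. cmod (h n z) \<le> 1" "\<And>n. (\<lambda>z. h n z * f z) \<in> V"
        "AE z in arc_length. (\<lambda>n. h n z) \<longlonglongrightarrow> 1"
      by (rule W_approx_V[OF f]) blast
    have \<phi>fX: "(\<lambda>z. cnj (\<phi> z) * f z) \<in> X"
      using fX \<phi>_le(2) by (intro X_mult) auto
    \<comment> \<open>Nothing identifies \<open>W\<close> with a weak closure of \<open>V\<close>,
      so this inclusion follows the dominated sequence \<open>h n * f\<close> instead of a
      continuity argument.\<close>
    have "(\<lambda>z. cnj (\<phi> z) * f z) \<in> H"
      unfolding H_def
    proof (rule weak_topology_seq_closed[OF closedin_closure_of])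
      show "(\<lambda>z. cnj (\<phi> z) * f z) \<in> X"
        by (rule \<phi>fX)
      show "(\<lambda>z. cnj (\<phi> z) * (h n z * f z)) \<in> weak_topology X Y closure_of H_infinity" for n
        using V_H[OF h(2)] H_infinity_H by (auto simp: H_def)
      fix g assume g: "g \<in> Y"
      then have [measurable]: "g \<in> borel_measurable arc_length"
        using Y_measurable by blast
      show "(\<lambda>n. LINT z|arc_length. cnj (\<phi> z) * (h n z * f z) * g z)
          \<longlonglongrightarrow> (LINT z|arc_length. cnj (\<phi> z) * f z * g z)"
      proof (rule integral_dominated_convergence[where w="\<lambda>z. cmod (f z * g z)"])
        show "AE z in arc_length. (\<lambda>n. cnj (\<phi> z) * (h n z * f z) * g z) \<longlonglongrightarrow> cnj (\<phi> z) * f z * g z"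
          using h(3)
        proof eventually_elim
          fix z assume "(\<lambda>n. h n z) \<longlonglongrightarrow> 1"
          then have "(\<lambda>n. cnj (\<phi> z) * (h n z * f z) * g z) \<longlonglongrightarrow> cnj (\<phi> z) * (1 * f z) * g z"
            by (intro tendsto_intros)
          then show "(\<lambda>n. cnj (\<phi> z) * (h n z * f z) * g z) \<longlonglongrightarrow> cnj (\<phi> z) * f z * g z"
            by simp
        qed
        show "AE z in arc_length. norm (cnj (\<phi> z) * (h n z * f z) * g z) \<le> cmod (f z * g z)" for n
          using h(1)[of n] \<phi>1 by eventually_elim (simp add: norm_mult mult_left_le_one_le mult_right_mono)
      qed (use pairing[OF fX g] in auto)
    qed
    moreover have "AE z in arc_length. f z = \<phi> z * (cnj (\<phi> z) * f z)"
      using cancel[of f] by eventually_elim simp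
    ultimately have "\<exists>g\<in>H. AE z in arc_length. f z = \<phi> z * g z"
      by (intro bexI[where x="\<lambda>z. cnj (\<phi> z) * f z"])
    then show "f \<in> mult_set \<phi> H"
      by (simp add: mult_set_def)
  next
    fix f assume "f \<in> mult_set \<phi> H"
    then obtain g where f: "f \<in> borel_measurable arc_length" and g: "g \<in> H" "AE z in arc_length. f z = \<phi> z * g z"
      by (auto simp: mult_set_def)
    \<comment> \<open>Continuity from the \<open>Y\<close> topology to the \<open>Z\<close>
      topology: the closure defining \<open>H\<close> is sent into a closure under which
      \<open>W\<close> is closed.\<close>
    have "continuous_map (weak_topology X Y) (weak_topology X Z) (\<lambda>f z. \<phi> z * f z)"
      using \<phi>_le(1) Z_Y by (intro continuous_map_weak_topology_mult X_mult Y_mult) auto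
    then have "(\<lambda>f z. \<phi> z * f z) ` H \<subseteq> weak_topology X Z closure_of ((\<lambda>f z. \<phi> z * f z) ` H_infinity)"
      unfolding H_def by (rule continuous_map_image_closure_subset)
    also have "\<dots> \<subseteq> W"
      using H_W by (intro closure_of_minimal W_closed) auto
    finally have "(\<lambda>z. \<phi> z * g z) \<in> W"
      using g(1) by blast
    then show "f \<in> W"
      by (rule W_cong_AE[OF _ f g(2)])
  qed
qed

text \<open>With \<open>M\<close> invariant under \<open>z\<close> and \<open>cnj z\<close>, a
  function orthogonal to \<open>M\<close> has zero product with each element of \<open>M\<close>, by
  \<open>Fourier_unique\<close>. For the projection \<open>\<xi>\<close> of 1 this gives
  \<open>(1 - \<xi>) * \<xi> = 0\<close>, so \<open>\<xi>\<close> is an indicator, and it shows that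
  elements of \<open>M\<close> vanish off its set \<open>E\<close>.\<close>

lemma reducing_W:
  assumes red: "\<And>f. f \<in> M \<Longrightarrow> (\<lambda>z. cnj z * f z) \<in> M"
  shows "\<exists>E\<in>sets arc_length. W = mult_set (indicator E) X"
proof -
  have red_power: "f \<in> M \<Longrightarrow> (\<lambda>z. cnj z ^ n * f z) \<in> M" for f n
    by (induction n) (use red in \<open>auto simp: mult.assoc\<close>)
  have disjoint: "AE z in arc_length. q z = 0 \<or> g z = 0"
    if q: "q \<in> L2 arc_length" "\<And>g. g \<in> M \<Longrightarrow> (LINT z|arc_length. q z * cnj (g z)) = 0" and g: "g \<in> M" for q g
  proof -
    have "AE z in arc_length. q z * cnj (g z) = 0"
    proof (rule Fourier_unique)
      show "integrable arc_length (\<lambda>z. q z * cnj (g z))"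
        using g M_L2 by (intro L2_mult_integrable L2_cnj q(1)) auto
      show "(LINT z|arc_length. q z * cnj (g z) * z ^ n) = 0" for n
        using q(2)[OF red_power[OF g, of n]] by (simp add: mult_ac)
      show "(LINT z|arc_length. q z * cnj (g z) * cnj z ^ n) = 0" for n
        using q(2)[OF M_shift_power[OF g, of n]] by (simp add: mult_ac)
    qed
    then show ?thesis
      by eventually_elim simp
  qed
  have oneL: "(\<lambda>z. 1) \<in> L2 arc_length"
    by (simp add: L2_def)
  obtain \<xi> where \<xi>: "\<xi> \<in> M" "\<And>g. g \<in> M \<Longrightarrow> (LINT z|arc_length. (1 - \<xi> z) * cnj (g z)) = 0"
    using M_projection[OF oneL] by blast
  have \<xi>L: "\<xi> \<in> L2 arc_length"
    using \<xi> M_L2 by blast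
  have [measurable]: "\<xi> \<in> borel_measurable arc_length"
    by (rule L2_measurable[OF \<xi>L])
  define E where "E = {z \<in> space arc_length. \<xi> z = 1}"
  have E [measurable]: "E \<in> sets arc_length"
    unfolding E_def by measurable
  have \<xi>_zero: "AE z in arc_length. 1 - \<xi> z = 0 \<or> g z = 0" if "g \<in> M" for g
    by (rule disjoint[OF L2_diff[OF oneL \<xi>L] \<xi>(2) that])
  have \<xi>E: "AE z in arc_length. indicator E z = \<xi> z"
    using \<xi>_zero[OF \<xi>(1)] AE_arc_length_norm
    by eventually_elim (auto simp: E_def indicator_def)
  have M_E: "AE z in arc_length. z \<in> E \<or> g z = 0" if "g \<in> M" for g
    using \<xi>_zero[OF that] AE_arc_length_norm by eventually_elim (auto simp: E_def)
  have EM: "indicator E \<in> M"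
    using \<xi>E by (intro M_cong_AE[OF \<xi>(1)]) auto
  have bounded_E: "(\<lambda>z. indicator E z * b z) \<in> W" if b: "b \<in> L_infinity" for b
  proof -
    have Eb: "(\<lambda>z. indicator E z * b z) \<in> L_infinity"
      by (rule L_infinity_bounded_mult[OF b, of _ 1]) (auto simp: indicator_def)
    then have EbL: "(\<lambda>z. indicator E z * b z) \<in> L2 arc_length"
      using L_infinity_L2 by blast
    obtain p where p: "p \<in> M" "\<And>g. g \<in> M \<Longrightarrow> (LINT z|arc_length. (indicator E z * b z - p z) * cnj (g z)) = 0"
      using M_projection[OF EbL] by blast
    have pL: "p \<in> L2 arc_length"
      using p M_L2 by blast
    \<comment> \<open>The remainder vanishes on \<open>E\<close> because it is disjoint from the
      indicator of \<open>E\<close>, an element of \<open>M\<close>. Off \<open>E\<close> both terms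
      vanish already.\<close>
    have "AE z in arc_length. indicator E z * b z - p z = 0 \<or> (indicator E z :: complex) = 0"
      by (rule disjoint[OF L2_diff[OF EbL pL] p(2) EM])
    then have "AE z in arc_length. indicator E z * b z = p z"
      using M_E[OF p(1)] by eventually_elim (auto simp: indicator_def split: if_splits)
    then have "(\<lambda>z. indicator E z * b z) \<in> M"
      using L2_measurable[OF EbL] by (intro M_cong_AE[OF p(1)])
    then show ?thesis
      using Eb by (rule M_bounded_W)
  qed
  have "W = mult_set (indicator E) X"
  proof safe
    fix f assume f: "f \<in> W"
    obtain h :: "nat \<Rightarrow> complex \<Rightarrow> complex" where "\<And>n z. h n z \<noteq> 0" "\<And>n. (\<lambda>z. h n z * f z) \<in> V"
      by (rule W_approx_V[OF f]) blast
    then have "AE z in arc_length. z \<in> E \<or> f z = 0"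
      using M_E[of "\<lambda>z. h 0 z * f z"] V_M by auto
    then have "AE z in arc_length. f z = indicator E z * f z"
      by eventually_elim auto
    then show "f \<in> mult_set (indicator E) X"
      using f W_X X_measurable unfolding mult_set_def by blast
  next
    fix f assume "f \<in> mult_set (indicator E) X"
    then obtain g where f: "f \<in> borel_measurable arc_length"
      and g: "g \<in> X" "AE z in arc_length. f z = indicator E z * g z"
      by (auto simp: mult_set_def)
    have [measurable]: "g \<in> borel_measurable arc_length"
      using g X_measurable by blast
    show "f \<in> W"
    proof (rule W_limit[of "\<lambda>n z. indicator E z * (if cmod (g z) \<le> real n then g z else 0)" g _ 1])
      show "(\<lambda>z. indicator E z * (if cmod (g z) \<le> real n then g z else 0)) \<in> W" for n
        by (rule bounded_E, rule L_infinityI[of _ "real n"]) auto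
      show "f \<in> X"
      proof (rule X_solid[OF g(1) f])
        show "AE z in arc_length. cmod (f z) \<le> cmod (g z)"
          using g(2) by eventually_elim (simp add: indicator_def)
      qed
      show "AE z in arc_length. cmod (indicator E z * (if cmod (g z) \<le> real n then g z else 0)) \<le> 1 * cmod (g z)" for n
        by (rule AE_I2) (simp add: indicator_def)
      show "AE z in arc_length. (\<lambda>n. indicator E z * (if cmod (g z) \<le> real n then g z else 0)) \<longlonglongrightarrow> f z"
        using g(2)
      proof eventually_elim
        fix z assume fz: "f z = indicator E z * g z"
        obtain N where "cmod (g z) \<le> real N"
          using real_arch_simple by blast
        then show "(\<lambda>n. indicator E z * (if cmod (g z) \<le> real n then g z else 0)) \<longlonglongrightarrow> f z"
          unfolding fz by (intro tendsto_eventually eventually_mono[OF eventually_ge_at_top[of N]]) auto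
      qed
    qed (rule g(1))
  qed
  then show ?thesis
    using E by blast
qed

text \<open>If \<open>f\<close> is in \<open>M\<close> but \<open>cnj z * f\<close> is not, let
  \<open>p\<close> be the projection of \<open>cnj z * f\<close> to \<open>M\<close>. Multiplying
  the nonzero remainder by \<open>z\<close> gives \<open>f - z * p\<close>, which stays in
  \<open>M\<close> and is orthogonal to \<open>z M\<close>. Projecting \<open>cnj z * f\<close> to
  \<open>M\<close>, rather than \<open>f\<close> to \<open>z M\<close>, uses only that
  \<open>M\<close> is closed.\<close>

theorem classification:
  "(\<exists>\<phi>. unimodular \<phi> \<and> W = mult_set \<phi> H) \<or>
   (\<exists>E\<in>sets arc_length. W = mult_set (indicator E) X)"
proof (cases "\<forall>f\<in>M. (\<lambda>z. cnj z * f z) \<in> M")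
  case True
  then show ?thesis
    using reducing_W by blast
next
  case False
  then obtain f where f: "f \<in> M" "(\<lambda>z. cnj z * f z) \<notin> M"
    by blast
  have fL: "f \<in> L2 arc_length"
    using f M_L2 by blast
  have [measurable]: "f \<in> borel_measurable arc_length"
    by (rule L2_measurable[OF fL])
  have zfL: "(\<lambda>z. cnj z * f z) \<in> L2 arc_length"
    by (rule sqn_mono(1)[OF fL]) (auto simp: norm_mult)
  obtain p where p: "p \<in> M" "\<And>g. g \<in> M \<Longrightarrow> (LINT z|arc_length. (cnj z * f z - p z) * cnj (g z)) = 0"
    using M_projection[OF zfL] by blast
  have pL: "p \<in> L2 arc_length"
    using p M_L2 by blast
  have [measurable]: "p \<in> borel_measurable arc_length"
    by (rule L2_measurable[OF pL])
  define \<psi> where "\<psi> z = f z + (- 1) * (z * p z)" for z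
  have \<psi>M: "\<psi> \<in> M"
    unfolding \<psi>_def by (intro linear_subspace_add linear_subspace_cmult M_linear M_shift f p)
  then have \<psi>L: "\<psi> \<in> L2 arc_length"
    using M_L2 by blast
  have [measurable]: "\<psi> \<in> borel_measurable arc_length"
    by (rule L2_measurable[OF \<psi>L])
  have \<psi>: "cnj z * \<psi> z = cnj z * f z - p z" if "cmod z = 1" for z
  proof -
    have "cnj z * z = 1"
      using that complex_norm_square[of z] by (simp add: mult.commute)
    then show ?thesis
      by (simp add: \<psi>_def right_diff_distrib flip: mult.assoc)
  qed
  have "sqn arc_length \<psi> \<noteq> 0"
  proof
    assume "sqn arc_length \<psi> = 0"
    then have "AE z in arc_length. \<psi> z = 0"
      using sqn_zero_iff[OF \<psi>L] by simp
    then have "AE z in arc_length. cnj z * f z = p z"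
      using AE_arc_length_norm by eventually_elim (use \<psi> in force)
    then have "(\<lambda>z. cnj z * f z) \<in> M"
      by (intro M_cong_AE[OF p(1)]) auto
    with f(2) show False by contradiction
  qed
  then have pos: "sqn arc_length \<psi> > 0"
    using sqn_nonneg[of arc_length \<psi>] by linarith
  define c where "c = complex_of_real (1 / sqrt (sqn arc_length \<psi>))"
  define \<phi> where "\<phi> z = c * \<psi> z" for z
  have \<phi>M: "\<phi> \<in> M"
    unfolding \<phi>_def by (intro linear_subspace_cmult M_linear \<psi>M)
  have norm\<phi>: "sqn arc_length \<phi> = 1"
    unfolding \<phi>_def sqn_cmult using pos by (simp add: c_def power_divide norm_divide)
  have orth: "(LINT z|arc_length. z * g z * cnj (\<phi> z)) = 0" if g: "g \<in> M" for g
  proof -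
    have [measurable]: "g \<in> borel_measurable arc_length"
      using g M_L2 L2_measurable by blast
    have "(LINT z|arc_length. z * g z * cnj (\<phi> z))
        = (LINT z|arc_length. cnj c * cnj ((cnj z * f z - p z) * cnj (g z)))"
    proof (rule integral_cong_AE)
      show "AE z in arc_length. z * g z * cnj (\<phi> z) = cnj c * cnj ((cnj z * f z - p z) * cnj (g z))"
        using AE_arc_length_norm
        by eventually_elim (simp add: \<phi>_def mult_ac flip: \<psi>)
    qed (unfold \<phi>_def, measurable)
    also have "\<dots> = cnj c * cnj (LINT z|arc_length. (cnj z * f z - p z) * cnj (g z))"
      by (simp only: integral_mult_right_zero Bochner_Integration.integral_cnj)
    finally show ?thesis
      by (simp add: p(2)[OF g])
  qed
  show ?thesis
    using wandering_W[OF \<phi>M wandering_unimodular[OF \<phi>M norm\<phi> orth] orth]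
      wandering_unimodular[OF \<phi>M norm\<phi> orth] by blast
qed

end

section \<open>Gauge norms\<close>

lemma norm_extension_mono:
  assumes "AE z in arc_length. cmod (f z) \<le> cmod (g z)"
  shows "norm_extension N f \<le> norm_extension N g"
  unfolding norm_extension_def
proof (rule SUP_subset_mono)
  show "{s. simple_function arc_length s \<and> (AE z in arc_length. 0 \<le> s z \<and> s z \<le> cmod (f z))}
      \<subseteq> {s. simple_function arc_length s \<and> (AE z in arc_length. 0 \<le> s z \<and> s z \<le> cmod (g z))}"
  proof (intro Collect_mono impI conjI; elim conjE)
    fix s assume "AE z in arc_length. 0 \<le> s z \<and> s z \<le> cmod (f z)"
    with assms show "AE z in arc_length. 0 \<le> s z \<and> s z \<le> cmod (g z)"
      by eventually_elim auto
  qed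
qed simp

lemma finite_norm_space_solid:
  assumes "f \<in> finite_norm_space N" "g \<in> borel_measurable arc_length"
    "AE z in arc_length. cmod (g z) \<le> cmod (f z)"
  shows "g \<in> finite_norm_space N"
  using assms norm_extension_mono[OF assms(3), of N] by (auto simp: finite_norm_space_def)

text \<open>Write \<open>g = h * f\<close> with \<open>cmod h\<close> at most 1. If a bounded
  \<open>b\<close> is close to \<open>f\<close>, then \<open>h * b\<close> is bounded and at least
  as close to \<open>g\<close>.\<close>

lemma closure_of_L_infinity_solid:
  assumes f: "f \<in> closure_of_L_infinity N" and g: "g \<in> borel_measurable arc_length"
    and le: "AE z in arc_length. cmod (g z) \<le> cmod (f z)"
  shows "g \<in> closure_of_L_infinity N"
  unfolding closure_of_L_infinity_def
proof (intro CollectI conjI allI impI)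
  have fN: "f \<in> finite_norm_space N"
    using f by (simp add: closure_of_L_infinity_def)
  then show "g \<in> finite_norm_space N"
    using g le by (rule finite_norm_space_solid)
  have [measurable]: "f \<in> borel_measurable arc_length"
    using fN by (simp add: finite_norm_space_def)
  \<comment> \<open>Where \<open>f\<close> vanishes so does \<open>g\<close>, and division by zero
    yields 0, so \<open>g = h * f\<close> holds there too.\<close>
  define h where "h z = g z / f z" for z
  have h: "h \<in> borel_measurable arc_length" "AE z in arc_length. cmod (h z) \<le> 1"
    "AE z in arc_length. g z = h z * f z"
  proof -
    show "h \<in> borel_measurable arc_length"
      unfolding h_def using g by measurable
    show "AE z in arc_length. cmod (h z) \<le> 1"
      using le by eventually_elim (simp add: h_def norm_divide divide_le_eq_1)
    show "AE z in arc_length. g z = h z * f z"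
      using le by eventually_elim (auto simp: h_def)
  qed
  fix e :: ennreal assume "e > 0"
  then obtain b where b: "b \<in> L_infinity" "norm_extension N (\<lambda>z. f z - b z) < e"
    using f by (auto simp: closure_of_L_infinity_def)
  have "AE z in arc_length. cmod (g z - h z * b z) \<le> cmod (f z - b z)"
    using h(2,3)
  proof eventually_elim
    fix z assume "cmod (h z) \<le> 1" "g z = h z * f z"
    then show "cmod (g z - h z * b z) \<le> cmod (f z - b z)"
      by (simp add: norm_mult mult_left_le_one_le flip: right_diff_distrib)
  qed
  then have "norm_extension N (\<lambda>z. g z - h z * b z) < e"
    using b(2) by (rule le_less_trans[OF norm_extension_mono])
  then show "\<exists>b\<in>L_infinity. norm_extension N (\<lambda>z. g z - b z) < e"
    by (rule bexI[where x="\<lambda>z. h z * b z"]) (rule L_infinity_bounded_mult[OF b(1) h(1,2)])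
qed

lemma simple_function_L_infinity:
  fixes s :: "complex \<Rightarrow> real"
  assumes "simple_function arc_length s" shows "(\<lambda>z. complex_of_real (s z)) \<in> L_infinity"
proof -
  have "finite (s ` space arc_length)"
    using assms by (simp add: simple_function_def)
  then obtain C where "\<And>z. z \<in> space arc_length \<Longrightarrow> \<bar>s z\<bar> \<le> C"
    using finite_imp_bounded[of "s ` space arc_length"] unfolding bounded_iff
    by (metis imageI real_norm_def)
  then show ?thesis
    using borel_measurable_simple_function[OF assms]
    by (intro L_infinityI[of _ C] AE_I2) auto
qed

lemma L_infinity_diff:
  assumes "f \<in> L_infinity" "g \<in> L_infinity" shows "(\<lambda>z. f z - g z) \<in> L_infinity"
proof -
  have L: "linear_subspace L_infinity"
    using linear_subspace_Int_L_infinity[of UNIV] by (simp add: linear_subspace_def)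
  show ?thesis
    using linear_subspace_add[OF L assms(1) linear_subspace_cmult[OF L assms(2), of "- 1"]] by simp
qed

section \<open>The dual pair of a gauge norm\<close>

locale gauge_norm =
  fixes \<alpha> :: "(complex \<Rightarrow> complex) \<Rightarrow> real"
  assumes gauge: "normalized_gauge_norm \<alpha>" and dominating: "L1_dominating \<alpha>"
begin

lemma nonneg: "f \<in> L_infinity \<Longrightarrow> 0 \<le> \<alpha> f"
  and zero_iff: "f \<in> L_infinity \<Longrightarrow> \<alpha> f = 0 \<longleftrightarrow> (AE z in arc_length. f z = 0)"
  and scale: "f \<in> L_infinity \<Longrightarrow> \<alpha> (\<lambda>z. c * f z) = cmod c * \<alpha> f"
  and triangle: "f \<in> L_infinity \<Longrightarrow> g \<in> L_infinity \<Longrightarrow> \<alpha> (\<lambda>z. f z + g z) \<le> \<alpha> f + \<alpha> g"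
  and one: "\<alpha> (\<lambda>z. 1) = 1"
  and abs: "f \<in> L_infinity \<Longrightarrow> \<alpha> (\<lambda>z. of_real (cmod (f z))) = \<alpha> f"
  using gauge by (auto simp: normalized_gauge_norm_def norm_on_L_infinity_def)

text \<open>The difference has norm 0 by definiteness, and the triangle inequality does the
  rest.\<close>

lemma le_AE:
  assumes "f \<in> L_infinity" "g \<in> L_infinity" "AE z in arc_length. f z = g z"
  shows "\<alpha> f \<le> \<alpha> g"
proof -
  have "\<alpha> (\<lambda>z. f z - g z) = 0"
    using assms by (subst zero_iff[OF L_infinity_diff]) auto
  then show ?thesis
    using triangle[OF assms(2) L_infinity_diff[OF assms(1,2)]] by simp
qed

text \<open>A function with values in \<open>[0, C]\<close> is the mean of two functions of constant modulus \<open>C\<close>.\<close>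
lemma le_const:
  assumes s: "s \<in> borel_measurable arc_length" "AE z in arc_length. 0 \<le> s z \<and> s z \<le> C" and C: "C \<ge> 0"
  shows "\<alpha> (\<lambda>z. of_real (s z)) \<le> C"
proof -
  have sL: "(\<lambda>z. complex_of_real (s z)) \<in> L_infinity"
  proof (rule L_infinityI)
    show "AE z in arc_length. cmod (complex_of_real (s z)) \<le> C"
      using s(2) by eventually_elim simp
  qed (use s(1) in measurable)
  \<comment> \<open>\<open>s\<close> satisfies its bounds only almost everywhere; clamping makes the
    square root below meaningful at every point.\<close>
  define t where "t z = max 0 (min C (s z))" for z
  have t: "0 \<le> t z" "t z \<le> C" for z
    using C by (auto simp: t_def)
  have [measurable]: "t \<in> borel_measurable arc_length"
    unfolding t_def using s(1) by measurable
  \<comment> \<open>For \<open>\<sigma>\<close> equal to 1 or -1 these are the two points of modulus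
    \<open>C\<close> with real part \<open>t z\<close>, whose mean is \<open>t z\<close>.\<close>
  define w where "w \<sigma> z = Complex (t z) (\<sigma> * sqrt (C\<^sup>2 - (t z)\<^sup>2))" for \<sigma> z
  have w_norm: "cmod (w \<sigma> z) = C" if "\<sigma>\<^sup>2 = 1" for \<sigma> z
  proof -
    have "(t z)\<^sup>2 \<le> C\<^sup>2"
      using t by (intro power_mono)
    then have "(cmod (w \<sigma> z))\<^sup>2 = C\<^sup>2"
      using that by (simp add: w_def cmod_power2 power_mult_distrib)
    then show ?thesis
      by (rule power2_eq_imp_eq) (use C in auto)
  qed
  have w_eq: "w \<sigma> = (\<lambda>z. complex_of_real (t z) + \<i> * complex_of_real (\<sigma> * sqrt (C\<^sup>2 - (t z)\<^sup>2)))" for \<sigma>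
    by (simp add: w_def fun_eq_iff complex_eq_iff)
  have wL: "w \<sigma> \<in> L_infinity" if "\<sigma>\<^sup>2 = 1" for \<sigma>
  proof (rule L_infinityI)
    show "w \<sigma> \<in> borel_measurable arc_length"
      unfolding w_eq by measurable
    show "AE z in arc_length. cmod (w \<sigma> z) \<le> C"
      using w_norm[OF that] by simp
  qed
  have oneL: "(\<lambda>z. 1) \<in> L_infinity"
    by (rule L_infinityI[of _ 1]) auto
  have \<alpha>w: "\<alpha> (w \<sigma>) = C" if "\<sigma>\<^sup>2 = 1" for \<sigma>
    using abs[OF wL[OF that]] scale[OF oneL, of "complex_of_real C"] C
    by (simp add: w_norm[OF that] one)
  have half: "(\<lambda>z. 1/2 * w \<sigma> z) \<in> L_infinity" if "\<sigma>\<^sup>2 = 1" for \<sigma>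
    by (rule L_infinity_bounded_mult[OF wL[OF that], of _ "1/2"]) auto
  have "complex_of_real (t z) = 1/2 * w 1 z + 1/2 * w (- 1) z" for z
    by (simp add: w_def complex_eq_iff)
  then have "\<alpha> (\<lambda>z. complex_of_real (t z)) \<le> \<alpha> (\<lambda>z. 1/2 * w 1 z) + \<alpha> (\<lambda>z. 1/2 * w (- 1) z)"
    by (simp only:) (intro triangle half; simp)
  also have "\<dots> = C"
    using scale[OF wL[of 1], of "1/2"] scale[OF wL[of "- 1"], of "1/2"]
    by (simp add: \<alpha>w norm_divide)
  finally have "\<alpha> (\<lambda>z. complex_of_real (t z)) \<le> C" .
  moreover have "\<alpha> (\<lambda>z. complex_of_real (s z)) \<le> \<alpha> (\<lambda>z. complex_of_real (t z))"
  proof (rule le_AE[OF sL])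
    show "(\<lambda>z. complex_of_real (t z)) \<in> L_infinity"
      using t by (intro L_infinityI[of _ C]) auto
    show "AE z in arc_length. complex_of_real (s z) = complex_of_real (t z)"
      using s(2) by eventually_elim (simp add: t_def)
  qed
  ultimately show ?thesis by linarith
qed

text \<open>Every simple function below \<open>cmod f\<close> takes values in [0, C], so
  \<open>le_const\<close> bounds each competitor in the supremum at once.\<close>

lemma L_infinity_finite: "L_infinity \<subseteq> finite_norm_space (\<lambda>f. ennreal (\<alpha> f))"
proof
  fix f assume f: "f \<in> L_infinity"
  then obtain C0 where C0: "AE z in arc_length. cmod (f z) \<le> C0"
    by (auto simp: L_infinity_def)
  define C where "C = max 0 C0"
  have C: "C \<ge> 0" "AE z in arc_length. cmod (f z) \<le> C"
    using C0 by (auto simp: C_def elim!: eventually_mono)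
  have "norm_extension (\<lambda>f. ennreal (\<alpha> f)) f \<le> ennreal C"
    unfolding norm_extension_def
  proof (rule SUP_least, safe)
    fix s :: "complex \<Rightarrow> real"
    assume s: "simple_function arc_length s" "AE z in arc_length. 0 \<le> s z \<and> s z \<le> cmod (f z)"
    have "AE z in arc_length. 0 \<le> s z \<and> s z \<le> C"
      using s(2) C(2) by eventually_elim auto
    then show "ennreal (\<alpha> (\<lambda>z. of_real (s z))) \<le> ennreal C"
      using C(1) by (intro ennreal_leI le_const borel_measurable_simple_function s(1))
  qed
  also have "\<dots> < \<infinity>" by simp
  finally show "f \<in> finite_norm_space (\<lambda>f. ennreal (\<alpha> f))"
    using f by (simp add: finite_norm_space_def L_infinity_measurable)
qed

lemma L_infinity_L_space: "L_infinity \<subseteq> L_space \<alpha>"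
proof
  fix f assume f: "f \<in> L_infinity"
  have "norm_extension (\<lambda>f. ennreal (\<alpha> f)) (\<lambda>z. f z - f z) \<le> 0"
    unfolding norm_extension_def
  proof (rule SUP_least, safe)
    fix s :: "complex \<Rightarrow> real"
    assume s: "simple_function arc_length s" "AE z in arc_length. 0 \<le> s z \<and> s z \<le> cmod (f z - f z)"
    have "AE z in arc_length. complex_of_real (s z) = 0"
      using s(2) by eventually_elim simp
    then show "ennreal (\<alpha> (\<lambda>z. of_real (s z))) \<le> 0"
      using zero_iff[OF simple_function_L_infinity[OF s(1)]] by simp
  qed
  then show "f \<in> L_space \<alpha>"
    using f L_infinity_finite unfolding L_space_def closure_of_L_infinity_def
    by (auto intro!: bexI[where x=f] elim: le_less_trans)
qed

text \<open>Domination of the L^1 norm enters here: \<open>\<alpha> h \<le> 1\<close> bounds the L^1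
  norm of \<open>h\<close> by \<open>1 / c\<close>, hence its pairing with a function of modulus at
  most \<open>C\<close> by \<open>C / c\<close>.\<close>

lemma L_infinity_dual_finite: "L_infinity \<subseteq> dual_finite_norm_space \<alpha>"
proof
  fix f assume f: "f \<in> L_infinity"
  then obtain C0 where C0: "AE z in arc_length. cmod (f z) \<le> C0"
    by (auto simp: L_infinity_def)
  define C where "C = max 0 C0"
  have C: "C \<ge> 0" "AE z in arc_length. cmod (f z) \<le> C"
    using C0 by (auto simp: C_def elim!: eventually_mono)
  obtain c where c: "c > 0" "\<And>h. h \<in> L_infinity \<Longrightarrow> c * (LINT z|arc_length. cmod (h z)) \<le> \<alpha> h"
    using dominating by (auto simp: L1_dominating_def)
  have "norm_extension (dual_norm \<alpha>) f \<le> ennreal (C * (1 / c))"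
    unfolding norm_extension_def dual_norm_def
  proof (intro SUP_least, safe)
    fix s :: "complex \<Rightarrow> real" and h
    assume s: "simple_function arc_length s" "AE z in arc_length. 0 \<le> s z \<and> s z \<le> cmod (f z)"
      and h: "h \<in> L_infinity" "\<alpha> h \<le> 1"
    have hi: "integrable arc_length h"
      using h(1) L_infinity_L2 arc.L2_integrable1 by blast
    have [measurable]: "h \<in> borel_measurable arc_length" "s \<in> borel_measurable arc_length"
      using hi borel_measurable_simple_function[OF s(1)] by auto
    have bound: "AE z in arc_length. cmod (of_real (s z) * h z) \<le> C * cmod (h z)"
      using s(2) C(2) by eventually_elim (simp add: norm_mult mult_right_mono)
    have "cmod (LINT z|arc_length. of_real (s z) * h z) \<le> (LINT z|arc_length. C * cmod (h z))"
    proof (rule order_trans[OF integral_norm_bound integral_mono_AE])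
      have "integrable arc_length (\<lambda>z. C * cmod (h z))"
        using hi by simp
      then have "integrable arc_length (\<lambda>z. of_real (s z) * h z)"
        by (rule Bochner_Integration.integrable_bound) (use bound C(1) in \<open>auto elim!: eventually_mono\<close>)
      then show "integrable arc_length (\<lambda>z. cmod (of_real (s z) * h z))"
        by (rule integrable_norm)
    qed (use hi bound in auto)
    also have "\<dots> = C * (LINT z|arc_length. cmod (h z))"
      by simp
    also have "(LINT z|arc_length. cmod (h z)) \<le> 1 / c"
      using c(2)[OF h(1)] h(2) c(1) by (simp add: field_simps)
    finally show "ennreal (cmod (LINT z|arc_length. of_real (s z) * h z)) \<le> ennreal (C * (1 / c))"
      using C(1) by (simp add: ennreal_leI mult_left_mono)
  qed
  also have "\<dots> < \<infinity>" by simp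
  finally show "f \<in> dual_finite_norm_space \<alpha>"
    using f by (simp add: dual_finite_norm_space_def finite_norm_space_def L_infinity_measurable)
qed

text \<open>Hoelder's inequality, first for simple functions and then in the limit.\<close>
lemma pairing_integrable:
  assumes f: "f \<in> L_space \<alpha>" and g: "g \<in> dual_finite_norm_space \<alpha>"
  shows "integrable arc_length (\<lambda>z. f z * g z)"
proof -
  have fg [measurable]: "f \<in> borel_measurable arc_length" "g \<in> borel_measurable arc_length"
    using f g by (auto simp: L_space_def dual_finite_norm_space_def closure_of_L_infinity_def finite_norm_space_def)
  have "norm_extension (\<lambda>f. ennreal (\<alpha> f)) f < \<infinity>"
    using f by (simp add: L_space_def closure_of_L_infinity_def finite_norm_space_def)
  then obtain A where A: "A \<ge> 0" "norm_extension (\<lambda>f. ennreal (\<alpha> f)) f = ennreal A"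
    by (cases "norm_extension (\<lambda>f. ennreal (\<alpha> f)) f") auto
  have "norm_extension (dual_norm \<alpha>) g < \<infinity>"
    using g by (simp add: dual_finite_norm_space_def finite_norm_space_def)
  then obtain B where B: "B \<ge> 0" "norm_extension (dual_norm \<alpha>) g = ennreal B"
    by (cases "norm_extension (dual_norm \<alpha>) g") auto
  \<comment> \<open>The approximating simple functions are only bounded by
    \<open>2 * cmod h\<close>, whereas the extended norm admits functions below
    \<open>cmod h\<close>. Halving repairs this, and makes the limit of the products a quarter of
    \<open>cmod (f * g)\<close>.\<close>
  have half_simple: "\<exists>s :: nat \<Rightarrow> complex \<Rightarrow> real. (\<forall>i. simple_function arc_length (s i)) \<and>
      (\<forall>i. \<forall>z\<in>sphere 0 1. 0 \<le> s i z \<and> s i z \<le> cmod (h z)) \<and>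
      (\<forall>z\<in>sphere 0 1. (\<lambda>i. s i z) \<longlonglongrightarrow> cmod (h z) / 2)"
    if h: "h \<in> borel_measurable arc_length" for h :: "complex \<Rightarrow> complex"
  proof -
    obtain F where "\<forall>i. simple_function arc_length (F i)"
      "\<forall>z\<in>space arc_length. (\<lambda>i. F i z) \<longlonglongrightarrow> h z"
      "\<forall>i. \<forall>z\<in>space arc_length. dist (F i z) 0 \<le> 2 * dist (h z) 0"
      using borel_measurable_implies_sequence_metric[OF h, of 0] by blast
    then have F: "\<And>i. simple_function arc_length (F i)"
      "\<And>z. z \<in> sphere 0 1 \<Longrightarrow> (\<lambda>i. F i z) \<longlonglongrightarrow> h z"
      "\<And>i z. z \<in> sphere 0 1 \<Longrightarrow> dist (F i z) 0 \<le> 2 * dist (h z) 0"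
      by auto
    show ?thesis
    proof (intro exI[of _ "\<lambda>i z. cmod (F i z) / 2"] conjI allI ballI)
      show "simple_function arc_length (\<lambda>z. cmod (F i z) / 2)" for i
        using simple_function_compose1[OF F(1), of "\<lambda>w. cmod w / 2"] .
      show "(\<lambda>i. cmod (F i z) / 2) \<longlonglongrightarrow> cmod (h z) / 2" if "z \<in> sphere 0 1" for z
        by (intro tendsto_intros F(2) that) simp
      show "cmod (F i z) / 2 \<le> cmod (h z)" if "z \<in> sphere 0 1" for i z
        using F(3)[OF that, of i] by simp
    qed simp
  qed
  obtain s where s: "\<And>i. simple_function arc_length (s i)"
    "\<And>i z. z \<in> sphere 0 1 \<Longrightarrow> 0 \<le> s i z \<and> s i z \<le> cmod (f z)"
    "\<And>z. z \<in> sphere 0 1 \<Longrightarrow> (\<lambda>i. s i z) \<longlonglongrightarrow> cmod (f z) / 2"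
    using half_simple[OF fg(1)] by blast
  obtain t where t: "\<And>i. simple_function arc_length (t i)"
    "\<And>i z. z \<in> sphere 0 1 \<Longrightarrow> 0 \<le> t i z \<and> t i z \<le> cmod (g z)"
    "\<And>z. z \<in> sphere 0 1 \<Longrightarrow> (\<lambda>i. t i z) \<longlonglongrightarrow> cmod (g z) / 2"
    using half_simple[OF fg(2)] by blast
  have [measurable]: "s i \<in> borel_measurable arc_length" "t i \<in> borel_measurable arc_length" for i
    using s(1) t(1) by (auto intro: borel_measurable_simple_function)
  have bound: "(\<integral>\<^sup>+z. ennreal (s i z * t i z) \<partial>arc_length) \<le> ennreal (A * B)" for i
  proof -
    define S where "S z = complex_of_real (s i z)" for z
    have SL: "S \<in> L_infinity"
      unfolding S_def by (rule simple_function_L_infinity[OF s(1)])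
    have "ennreal (\<alpha> S) \<le> ennreal A"
      unfolding A(2)[symmetric] norm_extension_def S_def
      by (rule SUP_upper) (use s in auto)
    then have SA: "\<alpha> S \<le> A"
      using A(1) by simp
    have tB: "dual_norm \<alpha> (\<lambda>z. of_real (t i z)) \<le> ennreal B"
      unfolding B(2)[symmetric] norm_extension_def
      by (rule SUP_upper) (use t in auto)
    have st_int: "integrable arc_length (\<lambda>z. s i z * t i z)"
    proof -
      have "integrable arc_length (\<lambda>z. S z * of_real (t i z))"
        using SL simple_function_L_infinity[OF t(1), of i] L_infinity_L2
        by (intro L2_mult_integrable) auto
      then have "integrable arc_length (\<lambda>z. Re (S z * of_real (t i z)))"
        by (rule integrable_Re)
      then show ?thesis
        by (simp add: S_def)
    qed
    have "(LINT z|arc_length. s i z * t i z) \<le> A * B"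
    \<comment> \<open>\<open>S\<close> is to be normalised to a competitor in the dual norm; if its
      norm is 0 it vanishes almost everywhere.\<close>
    proof (cases "\<alpha> S = 0")
      case True
      then have "AE z in arc_length. s i z * t i z = 0"
        using zero_iff[OF SL] by (auto simp: S_def elim!: eventually_mono)
      then have "(LINT z|arc_length. s i z * t i z) = (LINT z|arc_length. 0)"
        by (intro integral_cong_AE) auto
      then show ?thesis
        using A(1) B(1) by simp
    next
      case False
      then have a: "\<alpha> S > 0"
        using nonneg[OF SL] by linarith
      define h where "h z = complex_of_real (1 / \<alpha> S) * S z" for z
      have hL: "h \<in> L_infinity"
        unfolding h_def by (rule L_infinity_bounded_mult[OF SL, of _ "1 / \<alpha> S"])
          (use a in \<open>auto simp: norm_divide\<close>)
      have "\<alpha> h = 1"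
        unfolding h_def using a by (subst scale[OF SL]) (simp add: norm_divide)
      then have "ennreal (cmod (LINT z|arc_length. of_real (t i z) * h z)) \<le> dual_norm \<alpha> (\<lambda>z. of_real (t i z))"
        unfolding dual_norm_def by (intro SUP_upper) (use hL in auto)
      also have "\<dots> \<le> ennreal B"
        by (rule tB)
      finally have "cmod (LINT z|arc_length. of_real (t i z) * h z) \<le> B"
        using B(1) by simp
      also have "(LINT z|arc_length. of_real (t i z) * h z)
          = (LINT z|arc_length. complex_of_real (1 / \<alpha> S * (s i z * t i z)))"
        by (simp add: h_def S_def mult_ac)
      also have "\<dots> = complex_of_real (1 / \<alpha> S * (LINT z|arc_length. s i z * t i z))"
        using st_int by (subst integral_of_real) auto
      finally have "1 / \<alpha> S * (LINT z|arc_length. s i z * t i z) \<le> B"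
        unfolding norm_of_real by linarith
      then have "(LINT z|arc_length. s i z * t i z) \<le> \<alpha> S * B"
        using a by (simp add: field_simps)
      also have "\<dots> \<le> A * B"
        using SA B(1) by (rule mult_right_mono)
      finally show ?thesis .
    qed
    moreover have "(\<integral>\<^sup>+z. ennreal (s i z * t i z) \<partial>arc_length) = ennreal (LINT z|arc_length. s i z * t i z)"
      using s(2) t(2) by (intro nn_integral_eq_integral st_int AE_I2) auto
    ultimately show ?thesis
      by (simp add: ennreal_leI)
  qed
  have "(\<integral>\<^sup>+z. ennreal (cmod (f z * g z) / 4) \<partial>arc_length)
      = (\<integral>\<^sup>+z. liminf (\<lambda>i. ennreal (s i z * t i z)) \<partial>arc_length)"
  proof (rule nn_integral_cong)
    fix z assume "z \<in> space arc_length"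
    then have z: "z \<in> sphere 0 1" by simp
    have "(\<lambda>i. ennreal (s i z * t i z)) \<longlonglongrightarrow> ennreal (cmod (f z) / 2 * (cmod (g z) / 2))"
      by (intro tendsto_ennrealI tendsto_mult s(3) t(3) z)
    then show "ennreal (cmod (f z * g z) / 4) = liminf (\<lambda>i. ennreal (s i z * t i z))"
      by (simp add: lim_imp_Liminf norm_mult)
  qed
  also have "\<dots> \<le> liminf (\<lambda>i. \<integral>\<^sup>+z. ennreal (s i z * t i z) \<partial>arc_length)"
    by (rule nn_integral_liminf) measurable
  also have "\<dots> \<le> ennreal (A * B)"
    by (rule Liminf_le) (use bound in auto)
  also have "\<dots> < \<infinity>" by simp
  finally have "integrable arc_length (\<lambda>z. f z * g z / 4)"
    by (intro integrableI_bounded) (auto simp: norm_divide norm_mult)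
  then show ?thesis
    using integrable_mult_right[of 4 arc_length "\<lambda>z. f z * g z / 4"] by simp
qed

sublocale solid_dual_pair "L_space \<alpha>" "dual_finite_norm_space \<alpha>" "dual_L_space \<alpha>"
proof
  show "L_space \<alpha> \<subseteq> borel_measurable arc_length" "dual_finite_norm_space \<alpha> \<subseteq> borel_measurable arc_length"
    by (auto simp: L_space_def dual_finite_norm_space_def closure_of_L_infinity_def finite_norm_space_def)
  show "L_infinity \<subseteq> L_space \<alpha>" "L_infinity \<subseteq> dual_finite_norm_space \<alpha>"
    by (rule L_infinity_L_space L_infinity_dual_finite)+
  show "dual_L_space \<alpha> \<subseteq> dual_finite_norm_space \<alpha>"
    by (auto simp: dual_L_space_def dual_finite_norm_space_def closure_of_L_infinity_def)
  fix f g :: "complex \<Rightarrow> complex"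
  show "f \<in> L_space \<alpha> \<Longrightarrow> g \<in> dual_finite_norm_space \<alpha> \<Longrightarrow> integrable arc_length (\<lambda>z. f z * g z)"
    by (rule pairing_integrable)
  assume g: "g \<in> borel_measurable arc_length" "AE z in arc_length. cmod (g z) \<le> cmod (f z)"
  show "f \<in> L_space \<alpha> \<Longrightarrow> g \<in> L_space \<alpha>"
    unfolding L_space_def by (rule closure_of_L_infinity_solid[OF _ g])
  show "f \<in> dual_finite_norm_space \<alpha> \<Longrightarrow> g \<in> dual_finite_norm_space \<alpha>"
    unfolding dual_finite_norm_space_def by (rule finite_norm_space_solid[OF _ g])
qed

lemma H_eq: "H = H_space \<alpha>"
  by (simp add: H_def H_space_def)

end

text \<open>For the converse, both models inherit invariance from \<open>H_space\<close> and
  \<open>L_space\<close>. In the last claim \<open>\<phi>\<close> itself lies in \<open>W\<close>,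
  being \<open>\<phi>\<close> times 1, so it has no negative coefficients; the model with an
  indicator can lie in \<open>H_space\<close> only if \<open>E\<close> is null.\<close>

theorem theorem3p10:
  fixes \<alpha> :: "(complex \<Rightarrow> complex) \<Rightarrow> real" and W :: "(complex \<Rightarrow> complex) set"
  assumes "normalized_gauge_norm \<alpha>"
    and "L1_dominating \<alpha>"
    and "W \<subseteq> L_space \<alpha>"
    and "linear_subspace W"
    and "closedin (weak_topology (L_space \<alpha>) (dual_L_space \<alpha>)) W"
  shows "(mult_set (\<lambda>z. z) W \<subseteq> W \<longleftrightarrow>
            (\<exists>\<phi>. unimodular \<phi> \<and> W = mult_set \<phi> (H_space \<alpha>)) \<or>
            (\<exists>E\<in>sets arc_length. W = mult_set (indicator E) (L_space \<alpha>))) \<and>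
         (mult_set (\<lambda>z. z) W \<subseteq> W \<and> (\<exists>f\<in>W. \<not> (AE z in arc_length. f z = 0)) \<and> W \<subseteq> H_space \<alpha> \<longrightarrow>
            (\<exists>\<phi>. inner_function \<phi> \<and> W = mult_set \<phi> (H_space \<alpha>)))"
proof -
  interpret gauge_norm \<alpha>
    by (rule gauge_norm.intro[OF assms(1,2)])
  have W_meas: "f \<in> borel_measurable arc_length" if "f \<in> W" for f
    using that assms(3) X_measurable by blast
  have shift: "shift_invariant (L_space \<alpha>) (dual_finite_norm_space \<alpha>) (dual_L_space \<alpha>) W"
    if inv: "mult_set (\<lambda>z. z) W \<subseteq> W"
  proof unfold_locales
    fix f assume f: "f \<in> W"
    have "(\<lambda>z. z * f z) \<in> mult_set (\<lambda>z. z) W"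
      using f W_meas[OF f] by (auto simp: mult_set_def)
    then show "(\<lambda>z. z * f z) \<in> W"
      using inv by blast
  qed (use assms in auto)
  have forward: "(\<exists>\<phi>. unimodular \<phi> \<and> W = mult_set \<phi> (H_space \<alpha>)) \<or>
      (\<exists>E\<in>sets arc_length. W = mult_set (indicator E) (L_space \<alpha>))"
    if "mult_set (\<lambda>z. z) W \<subseteq> W"
    using shift_invariant.classification[OF shift[OF that]] by (simp add: H_eq)
  \<comment> \<open>Kept general in \<open>\<phi>\<close> and \<open>S\<close> so that one argument
    serves both models.\<close>
  have backward: "mult_set (\<lambda>z. z) W \<subseteq> W"
    if W: "W = mult_set \<phi> S" and S: "\<And>g. g \<in> S \<Longrightarrow> (\<lambda>z. z * g z) \<in> S" for \<phi> S
  proof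
    fix f assume "f \<in> mult_set (\<lambda>z. z) W"
    then obtain w where f: "f \<in> borel_measurable arc_length" and w: "w \<in> W" "AE z in arc_length. f z = z * w z"
      by (auto simp: mult_set_def)
    from w(1) obtain g where g: "g \<in> S" "AE z in arc_length. w z = \<phi> z * g z"
      unfolding W mult_set_def by blast
    have "AE z in arc_length. f z = \<phi> z * (z * g z)"
      using w(2) g(2) by eventually_elim simp
    then have "\<exists>g\<in>S. AE z in arc_length. f z = \<phi> z * g z"
      using S[OF g(1)] by (intro bexI[where x="\<lambda>z. z * g z"])
    then show "f \<in> W"
      using f unfolding W mult_set_def by blast
  qed
  have "mult_set (\<lambda>z. z) W \<subseteq> W \<longleftrightarrow>
      (\<exists>\<phi>. unimodular \<phi> \<and> W = mult_set \<phi> (H_space \<alpha>)) \<or>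
      (\<exists>E\<in>sets arc_length. W = mult_set (indicator E) (L_space \<alpha>))"
  proof
    assume "(\<exists>\<phi>. unimodular \<phi> \<and> W = mult_set \<phi> (H_space \<alpha>)) \<or>
      (\<exists>E\<in>sets arc_length. W = mult_set (indicator E) (L_space \<alpha>))"
    then show "mult_set (\<lambda>z. z) W \<subseteq> W"
    proof (elim disjE exE conjE bexE)
      fix \<phi> assume "W = mult_set \<phi> (H_space \<alpha>)"
      then show ?thesis
        by (rule backward) (use H_mult_ident in \<open>simp add: H_eq\<close>)
    next
      fix E assume "W = mult_set (indicator E) (L_space \<alpha>)"
      then show ?thesis
      proof (rule backward)
        show "(\<lambda>z. z * g z) \<in> L_space \<alpha>" if "g \<in> L_space \<alpha>" for g
          by (rule X_mult[OF that]) (auto intro: AE_I2)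
      qed
    qed
  qed (use forward in blast)
  moreover have "\<exists>\<phi>. inner_function \<phi> \<and> W = mult_set \<phi> (H_space \<alpha>)"
    if inv: "mult_set (\<lambda>z. z) W \<subseteq> W" and nz: "\<exists>f\<in>W. \<not> (AE z in arc_length. f z = 0)"
      and WH: "W \<subseteq> H_space \<alpha>"
    using forward[OF inv]
  proof (elim disjE exE conjE bexE)
    fix \<phi> assume \<phi>: "unimodular \<phi>" "W = mult_set \<phi> (H_space \<alpha>)"
    have "(\<lambda>z. 1) \<in> H_infinity"
      using integral_power_arc_length L_infinityI[of "\<lambda>z. 1" 1]
      by (auto simp: H_infinity_def fourier_coeff_def power_int_def)
    then have "(\<lambda>z. 1) \<in> H_space \<alpha>"
      using H_infinity_H H_eq by blast
    then have "\<phi> \<in> W"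
      using \<phi> unfolding \<phi>(2) mult_set_def by (auto simp: unimodular_def intro!: bexI[where x="\<lambda>z. 1"])
    then have "\<phi> \<in> H"
      using WH H_eq by blast
    then have "\<phi> \<in> H_infinity"
      using H_fourier_coeff \<phi>(1) by (auto simp: H_infinity_def unimodular_def intro!: L_infinityI[of _ 1] elim: eventually_mono)
    then show ?thesis
      using \<phi> by (auto simp: inner_function_def)
  next
    fix E assume E: "E \<in> sets arc_length" "W = mult_set (indicator E) (L_space \<alpha>)"
    \<comment> \<open>The test element of \<open>W\<close> is the indicator of \<open>E\<close>
      times \<open>cnj z\<close>: its coefficient of index -1 is the measure of \<open>E\<close>,
      which must therefore be 0.\<close>
    have "cnj \<in> L_infinity"
      by (rule L_infinityI[of _ 1]) auto
    then have "cnj \<in> L_space \<alpha>"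
      using L_infinity_X by blast
    then have "(\<lambda>z. indicator E z * cnj z) \<in> W"
      using E by (auto simp: mult_set_def)
    then have "fourier_coeff (\<lambda>z. indicator E z * cnj z) (- 1) = 0"
      using WH H_eq H_fourier_coeff by auto
    moreover have "fourier_coeff (\<lambda>z. indicator E z * cnj z) (- 1) = (LINT z|arc_length. complex_of_real (indicator E z))"
      unfolding fourier_coeff_def
    proof (rule integral_cong_AE)
      show "AE z in arc_length. indicator E z * cnj z * z powi - (- 1) = complex_of_real (indicator E z)"
        using AE_arc_length_norm
        by eventually_elim (simp add: indicator_def mult.commute[of "cnj _"] flip: complex_norm_square)
    qed (use E(1) in auto)
    moreover have "(LINT z|arc_length. complex_of_real (indicator E z)) = complex_of_real (LINT z|arc_length. indicat_real E z)"
      by (rule integral_of_real) (use E(1) in \<open>simp add: sets.Int_space_eq2[of _ arc_length, simplified]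
          integrable_indicator_iff arc.emeasure_finite less_top[symmetric]\<close>)
    ultimately have "measure arc_length E = 0"
      using E(1) sets.sets_into_space[OF E(1)] by (simp add: Int_absorb2)
    then have "E \<in> null_sets arc_length"
      using E(1) by (simp add: null_sets_def arc.emeasure_eq_measure)
    then have "AE z in arc_length. z \<notin> E"
      by (rule AE_not_in)
    then have "AE z in arc_length. f z = 0" if "f \<in> W" for f
      using that unfolding E(2) mult_set_def by (auto elim: eventually_elim2)
    with nz show ?thesis by blast
  qed
  ultimately show ?thesis by blast
qed

end
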